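(* Let $d,m$ be positive integers with $m>d/2$, let $\Omega\subset\mathbb{R}^d$ be a bounded open set, and let $\sigma\ge 0$. Assume $f\in C_c(\Omega)$ and put $r_0:=\mathrm{dist}(\mathrm{supp}\,f,\partial\Omega)>0$. Assume $\Xi\subset\Omega$ is a finite set of centers such that $\Xi_f:=\Xi\cap\mathrm{supp}\,f$ is nonempty, and that $\Xi$ has a local density parameter $\rho$ of precision $\ell\ge m$ and stability constant $K$, satisfying $1-\epsilon$ slow growth ($0<\epsilon<1$) and weak quasi-uniformity with ratio $c_0$. Then the penalized Lebesgue constant $$ \mathcal{L}_{\sigma,\rho}=\sup_{x\in\Omega}\sum_{\xi\in\Xi_f}|\chi_\xi(x)|\left(1+\frac{|x-\xi|}{\rho(x)}\right)^{\sigma} $$ is bounded by a constant depending only on $\Omega,\sigma,d,m,\epsilon,c_0,K$ and $r_0$ (and not on $\rho$).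
   Context: $\Pi_\ell$ denotes the space of polynomials on $\mathbb{R}^d$ of (total) degree at most $\ell$. $C_c(\Omega)$ is the space of continuous functions with compact support in $\Omega$. Local density parameter (LD): given a finite set $\Xi\subset\Omega$, an LD of precision $\ell$ and stability constant $K$ is a function $\rho:\Omega\to(0,\infty)$ for which there is a local polynomial reproduction $a:\Xi\times\Omega\to\mathbb{R}$ with: (Support) $a(\xi,\alpha)=0$ whenever $|\xi-\alpha|>\rho(\alpha)$; (Precision) $\sum_{\xi\in\Xi}a(\xi,\alpha)p(\xi)=p(\alpha)$ for all $p\in\Pi_\ell$ and all $\alpha$; (Stability) $\sum_{\xi\in\Xi}|a(\xi,\alpha)|<K$ for all $\alpha$. Slow growth: $\rho$ satisfies $1-\epsilon$ slow growth if $\rho(\alpha)\le\rho(x)\left(1+\frac{|x-\alpha|}{\rho(x)}\right)^{1-\epsilon}$ for all $x,\alpha\in\Omega$. Weak quasi-uniformity: with $q(\xi):=\min_{\zeta\in\Xi,\zeta\ne\xi}|\xi-\zeta|$, the distance between nearby centers is controlled from below by the local density, $q(\xi)\ge c\,\rho(\xi)$ for all $\xi\in\Xi$ with some $c>0$; the ratio of weak quasi-uniformity is $c_0=\max_{\xi\in\Xi}\rho(\xi)/q(\xi)$. Seminorm and Lagrange function: for open $\Upsilon\subset\mathbb{R}^d$, $|f|_{W_2^m(\Upsilon)}:=\left(\sum_{|\beta|=m}\frac{m!}{\beta!}\int_\Upsilon|D^\beta f(x)|^2\,dx\right)^{1/2}$. The homogeneous Sobolev space $\mathring{W}_2^m$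 is the space of locally integrable functions on $\mathbb{R}^d$ with $|f|_{W_2^m(\mathbb{R}^d)}<\infty$; since $m>d/2$, its elements are identified with their continuous representatives. For $\xi\in\Xi$, $\chi_\xi$ is the Lagrange function for surface spline interpolation: the unique function in $\mathring{W}_2^m$ equal to $1$ at $\xi$, vanishing on $\Xi\setminus\{\xi\}$, and having minimal seminorm $|\cdot|_{W_2^m(\mathbb{R}^d)}$ among all functions with these properties. *)

theory Defs
  imports "HOL-Analysis.Analysis"
begin

section \<open>Multi-indices and polynomials of bounded total degree\<close>

type_synonym 'n multiindex = "'n \<Rightarrow> nat"

definition mi_order :: "'n::finite multiindex \<Rightarrow> nat" where
  "mi_order \<beta> = (\<Sum>i\<in>UNIV. \<beta> i)"

definition mi_fact :: "'n::finite multiindex \<Rightarrow> real" where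
  "mi_fact \<beta> = (\<Prod>i\<in>UNIV. fact (\<beta> i))"

definition monomial_fun :: "'n::finite multiindex \<Rightarrow> real ^ 'n \<Rightarrow> real" where
  "monomial_fun \<beta> x = (\<Prod>i\<in>UNIV. (x $ i) ^ \<beta> i)"

definition poly_space :: "nat \<Rightarrow> (real ^ 'n::finite \<Rightarrow> real) set" where
  "poly_space l =
     {p. \<exists>c. \<forall>x. p x = (\<Sum>\<beta> | mi_order \<beta> \<le> l. c \<beta> * monomial_fun \<beta> x)}"

definition supp_on :: "(real ^ 'n::finite) set \<Rightarrow> (real ^ 'n \<Rightarrow> real) \<Rightarrow> (real ^ 'n) set" where
  "supp_on \<Omega> f = closure {x \<in> \<Omega>. f x \<noteq> 0}"

text \<open>Only the values on the domain matter: functions on the domain are represented by total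
  functions.\<close>

definition Cc :: "(real ^ 'n::finite) set \<Rightarrow> (real ^ 'n \<Rightarrow> real) set" where
  "Cc \<Omega> = {f. continuous_on \<Omega> f \<and> compact (supp_on \<Omega> f) \<and> supp_on \<Omega> f \<subseteq> \<Omega>}"


section \<open>Weak derivatives, the Sobolev seminorm and the homogeneous Sobolev space\<close>

text \<open>\<open>smooth_jet \<phi> \<Phi>\<close> says that \<open>\<phi>\<close> is infinitely differentiable on the whole space and that
  \<open>\<Phi> \<beta>\<close> is its classical partial derivative of multi-index \<open>\<beta>\<close>.  Recording all derivatives at
  once avoids fixing an order of differentiation on the index type; \<open>\<Phi>\<close> is determined by \<open>\<phi>\<close>.\<close>

definition smooth_jet ::
  "(real ^ 'n::finite \<Rightarrow> real) \<Rightarrow> ('n multiindex \<Rightarrow> real ^ 'n \<Rightarrow> real) \<Rightarrow> bool" where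
  "smooth_jet \<phi> \<Phi> \<longleftrightarrow>
     \<Phi> (\<lambda>_. 0) = \<phi> \<and>
     (\<forall>\<beta>. continuous_on UNIV (\<Phi> \<beta>)) \<and>
     (\<forall>\<beta> i x. ((\<lambda>t. \<Phi> \<beta> (x + t *\<^sub>R axis i 1)) has_real_derivative
                 \<Phi> (\<beta>(i := Suc (\<beta> i))) x) (at 0))"

definition locally_integrable_on ::
  "(real ^ 'n::finite \<Rightarrow> real) \<Rightarrow> (real ^ 'n) set \<Rightarrow> bool" where
  "locally_integrable_on f \<Upsilon> \<longleftrightarrow> (\<forall>C. compact C \<and> C \<subseteq> \<Upsilon> \<longrightarrow> set_integrable lebesgue C f)"

definition has_weak_deriv ::
  "(real ^ 'n::finite) set \<Rightarrow> 'n multiindex \<Rightarrow> (real ^ 'n \<Rightarrow> real) \<Rightarrow> (real ^ 'n \<Rightarrow> real) \<Rightarrow> bool"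
  where
  "has_weak_deriv \<Upsilon> \<beta> f g \<longleftrightarrow>
     locally_integrable_on f \<Upsilon> \<and> locally_integrable_on g \<Upsilon> \<and>
     (\<forall>\<phi> \<Phi>. smooth_jet \<phi> \<Phi> \<and>
            compact (closure {x. \<phi> x \<noteq> 0}) \<and> closure {x. \<phi> x \<noteq> 0} \<subseteq> \<Upsilon> \<longrightarrow>
        (LINT x:\<Upsilon>|lebesgue. f x * \<Phi> \<beta> x)
          = (- 1) ^ mi_order \<beta> * (LINT x:\<Upsilon>|lebesgue. g x * \<phi> x))"

text \<open>Weak derivatives are unique only up to null sets; any representative serves below, as it
  only occurs under an integral.\<close>

definition weak_D ::
  "(real ^ 'n::finite) set \<Rightarrow> 'n multiindex \<Rightarrow> (real ^ 'n \<Rightarrow> real) \<Rightarrow> real ^ 'n \<Rightarrow> real" where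
  "weak_D \<Upsilon> \<beta> f = (SOME g. has_weak_deriv \<Upsilon> \<beta> f g)"

text \<open>The seminorm is real-valued, hence only meaningful for functions having square-integrable
  weak derivatives of order \<open>m\<close>; finiteness is part of the definition of the space below.\<close>

definition sobolev_seminorm ::
  "nat \<Rightarrow> (real ^ 'n::finite) set \<Rightarrow> (real ^ 'n \<Rightarrow> real) \<Rightarrow> real" where
  "sobolev_seminorm m \<Upsilon> f =
     sqrt (\<Sum>\<beta> | mi_order \<beta> = m. fact m / mi_fact \<beta> *
             (LINT x:\<Upsilon>|lebesgue. \<bar>weak_D \<Upsilon> \<beta> f x\<bar>\<^sup>2))"

text \<open>For \<open>m > d/2\<close> every class of locally integrable functions with finite seminorm has a unique
  continuous representative, and the elements of the space are these representatives.\<close>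

definition homog_sobolev :: "nat \<Rightarrow> (real ^ 'n::finite \<Rightarrow> real) set" where
  "homog_sobolev m =
     {f. continuous_on UNIV f \<and>
         (\<forall>\<beta>. mi_order \<beta> = m \<longrightarrow>
            (\<exists>g. has_weak_deriv UNIV \<beta> f g \<and> integrable lebesgue (\<lambda>x. \<bar>g x\<bar>\<^sup>2)))}"


section \<open>Surface spline Lagrange functions\<close>

definition lagrange_admissible ::
  "nat \<Rightarrow> (real ^ 'n::finite) set \<Rightarrow> real ^ 'n \<Rightarrow> (real ^ 'n \<Rightarrow> real) \<Rightarrow> bool" where
  "lagrange_admissible m \<Xi> \<xi> g \<longleftrightarrow>
     g \<in> homog_sobolev m \<and> g \<xi> = 1 \<and> (\<forall>\<zeta>\<in>\<Xi> - {\<xi>}. g \<zeta> = 0)"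

text \<open>If only the zero polynomial of degree less than \<open>m\<close> vanishes on \<open>\<Xi>\<close>, there is exactly one
  function with this property.\<close>

definition is_lagrange_function ::
  "nat \<Rightarrow> (real ^ 'n::finite) set \<Rightarrow> real ^ 'n \<Rightarrow> (real ^ 'n \<Rightarrow> real) \<Rightarrow> bool" where
  "is_lagrange_function m \<Xi> \<xi> chi \<longleftrightarrow>
     lagrange_admissible m \<Xi> \<xi> chi \<and>
     (\<forall>g. lagrange_admissible m \<Xi> \<xi> g \<longrightarrow>
        sobolev_seminorm m UNIV chi \<le> sobolev_seminorm m UNIV g)"


section \<open>Local density parameters\<close>

definition local_density ::
  "(real ^ 'n::finite) set \<Rightarrow> (real ^ 'n) set \<Rightarrow> nat \<Rightarrow> real \<Rightarrow> (real ^ 'n \<Rightarrow> real) \<Rightarrow> bool" where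
  "local_density \<Omega> \<Xi> l K \<rho> \<longleftrightarrow>
     (\<forall>\<alpha>\<in>\<Omega>. 0 < \<rho> \<alpha>) \<and>
     (\<exists>a :: real ^ 'n \<Rightarrow> real ^ 'n \<Rightarrow> real.
        (\<forall>\<xi>\<in>\<Xi>. \<forall>\<alpha>\<in>\<Omega>. norm (\<xi> - \<alpha>) > \<rho> \<alpha> \<longrightarrow> a \<xi> \<alpha> = 0) \<and>
        (\<forall>p\<in>poly_space l. \<forall>\<alpha>\<in>\<Omega>. (\<Sum>\<xi>\<in>\<Xi>. a \<xi> \<alpha> * p \<xi>) = p \<alpha>) \<and>
        (\<forall>\<alpha>\<in>\<Omega>. (\<Sum>\<xi>\<in>\<Xi>. \<bar>a \<xi> \<alpha>\<bar>) < K))"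

definition slow_growth ::
  "(real ^ 'n::finite) set \<Rightarrow> real \<Rightarrow> (real ^ 'n \<Rightarrow> real) \<Rightarrow> bool" where
  "slow_growth \<Omega> \<epsilon> \<rho> \<longleftrightarrow>
     (\<forall>x\<in>\<Omega>. \<forall>\<alpha>\<in>\<Omega>. \<rho> \<alpha> \<le> \<rho> x * (1 + norm (x - \<alpha>) / \<rho> x) powr (1 - \<epsilon>))"

text \<open>The minimum is meaningful when \<open>\<Xi>\<close> is finite with at least two points, which holds for any
  set of centers in a nonempty open set having a local density parameter of positive precision.\<close>

definition center_sep :: "(real ^ 'n::finite) set \<Rightarrow> real ^ 'n \<Rightarrow> real" where
  "center_sep \<Xi> \<xi> = Min ((\<lambda>\<zeta>. norm (\<xi> - \<zeta>)) ` (\<Xi> - {\<xi>}))"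

definition weakly_quasi_uniform ::
  "(real ^ 'n::finite) set \<Rightarrow> (real ^ 'n \<Rightarrow> real) \<Rightarrow> bool" where
  "weakly_quasi_uniform \<Xi> \<rho> \<longleftrightarrow> (\<exists>c>0. \<forall>\<xi>\<in>\<Xi>. center_sep \<Xi> \<xi> \<ge> c * \<rho> \<xi>)"

definition quasi_uniformity_ratio ::
  "(real ^ 'n::finite) set \<Rightarrow> (real ^ 'n \<Rightarrow> real) \<Rightarrow> real" where
  "quasi_uniformity_ratio \<Xi> \<rho> = Max ((\<lambda>\<xi>. \<rho> \<xi> / center_sep \<Xi> \<xi>) ` \<Xi>)"


section \<open>The penalized Lebesgue constant\<close>

text \<open>Here \<open>chi \<xi>\<close> is the Lagrange function of \<open>\<xi>\<close>, and \<open>\<Xi>\<^sub>f\<close> is the set of centers summed over.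
  The supremum is taken in the extended reals, so that it is not a junk value when unbounded.\<close>

definition penalized_lebesgue ::
  "(real ^ 'n::finite) set \<Rightarrow> (real ^ 'n) set \<Rightarrow> (real ^ 'n \<Rightarrow> real ^ 'n \<Rightarrow> real) \<Rightarrow>
   real \<Rightarrow> (real ^ 'n \<Rightarrow> real) \<Rightarrow> ereal" where
  "penalized_lebesgue \<Omega> \<Xi>\<^sub>f chi \<sigma> \<rho> =
     (SUP x\<in>\<Omega>. ereal (\<Sum>\<xi>\<in>\<Xi>\<^sub>f. \<bar>chi \<xi> x\<bar> * (1 + norm (x - \<xi>) / \<rho> x) powr \<sigma>))"

end

theory Submission
  imports Defs
begin

text \<open>
  The idea is that a Lagrange function \<open>\<chi>\<close> decays so fast away from its center \<open>\<xi>\<close>, in units of the local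
  density parameter \<open>\<rho> \<xi>\<close>, that the penalized sum over all centers converges with a bound depending on
  the given constants only.

  Decay comes from minimality.  If \<open>\<chi>\<close> is multiplied by a cutoff function that drops from one to zero in an
  annulus of width \<open>w\<close> about \<open>\<xi>\<close>, the values at the centers stay admissible, so the energy of \<open>\<chi>\<close> beyond the
  annulus is at most the energy of the product in the annulus.  That energy is bounded by a multiple
  of the energy of \<open>\<chi>\<close> itself in a slightly larger annulus, provided that \<open>\<chi>\<close> vanishes on a set that is dense at scale
  \<open>w\<close>, that is, if \<open>\<rho> \<le> w\<close> there.  Hence the energy outside a cube of radius \<open>R\<close> loses a fixed fraction whenever
  \<open>R\<close> grows by a multiple of \<open>w\<close> (\<open>decay_step\<close>).  Slow growth makes \<open>\<rho>\<close> small compared with the distance to \<open>\<xi>\<close>, so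
  that arbitrarily many such steps fit between \<open>R\<close> and \<open>2 * R\<close> once \<open>R / \<rho> \<xi>\<close> is large; the decay is faster than any power of
  \<open>R / \<rho> \<xi>\<close> (\<open>tail_energy_decay\<close>), as long as the cube stays in \<open>\<Omega>\<close>.  This is where the distance \<open>r0\<close> to the
  boundary enters: up to a constant depending on \<open>r0\<close> and the diameter of \<open>\<Omega>\<close>, the radius may be taken
  proportional to the distance between \<open>x\<close> and \<open>\<xi>\<close>.

  Two analytic estimates support this.  The first is a Sobolev inequality adapted to the polynomial reproduction
  (\<open>sobolev_reproduction\<close>): since \<open>m > CARD('n) / 2\<close>, the error of the reproduction at a point is bounded by the
  energy in a cube about it.  It controls function values on the annulus and, at the end, turns decay of energy into pointwise decay
  (\<open>lagrange_pointwise_decay\<close>).  The second is an interpolation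
  inequality for the intermediate derivatives that the Leibniz formula produces (\<open>weighted_interpolation_all\<close>), proved
  by integration by parts against powers of a weight.

  The weak derivatives in the definition of the Sobolev space are dealt with once and for all by
  mollification: \<open>near_minimizer_exists\<close> provides smooth admissible functions close to \<open>\<chi>\<close> whose energy is minimal
  up to an arbitrarily small tolerance \<open>\<eta>\<close>.  All estimates are carried out for such functions, and \<open>\<eta>\<close> tends
  to zero only in the pointwise bound.

  Finally, quasi-uniformity and slow growth bound the number of centers at a given distance from \<open>x\<close> by a power
  of that distance in units of \<open>\<rho> x\<close> (\<open>separated_sum_le\<close>), and a sufficiently high order of decay makes the sum
  converge.
\<close>


section \<open>Smooth functions of one variable\<close>

text \<open>The function \<open>g 0\<close> is smooth and \<open>g k\<close> is its derivative of order \<open>k\<close>.  As for jets in several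
  variables, all derivatives are carried along, so that a smooth function is always given together with
  formulas for its derivatives.\<close>

definition deriv_seq :: "(nat \<Rightarrow> real \<Rightarrow> real) \<Rightarrow> bool" where
  "deriv_seq g \<longleftrightarrow> (\<forall>k t. (g k has_real_derivative g (Suc k) t) (at t))"

text \<open>For \<open>p = 1\<close> this is the classical smooth function that is flat at the origin.  The polynomial
  factor makes the family closed under differentiation.\<close>

definition flat_exp :: "real poly \<Rightarrow> real \<Rightarrow> real" where
  "flat_exp p t = (if t \<le> 0 then 0 else poly p (1 / t) * exp (- (1 / t)))"

text \<open>The derivative of \<open>1 / t\<close> is \<open>- (1 / t)\<^sup>2\<close>, so differentiating \<open>poly p (1 / t) * exp (- (1 / t))\<close> acts on
  polynomials as follows.\<close>

definition flat_exp_step :: "real poly \<Rightarrow> real poly" where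
  "flat_exp_step p = [:0, 0, 1:] * (p - pderiv p)"

lemma poly_times_exp_tendsto_0:
  fixes p :: "real poly"
  shows "((\<lambda>x. poly p x * exp (- x)) \<longlongrightarrow> 0) at_top"
proof -
  have "((\<lambda>x. \<Sum>i\<le>degree p. coeff p i * (x ^ i / exp x)) \<longlongrightarrow> (\<Sum>i\<le>degree p. coeff p i * 0)) at_top"
    by (intro tendsto_intros tendsto_power_div_exp_0)
  moreover have "(\<lambda>x. \<Sum>i\<le>degree p. coeff p i * (x ^ i / exp x)) = (\<lambda>x. poly p x * exp (- x))"
    by (simp add: poly_altdef sum_distrib_right exp_minus divide_inverse mult.assoc)
  ultimately show ?thesis by simp
qed

lemma flat_exp_tendsto_0: "((\<lambda>t. flat_exp p t) \<longlongrightarrow> 0) (at 0)"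
proof -
  have "((\<lambda>t. poly p (1 / t) * exp (- (1 / t))) \<longlongrightarrow> 0) (at_right 0)"
    using filterlim_compose[OF poly_times_exp_tendsto_0 filterlim_inverse_at_top_right]
    by (simp add: inverse_eq_divide)
  then have "(flat_exp p \<longlongrightarrow> 0) (at_right 0)"
    by (rule Lim_transform_eventually) (auto simp: flat_exp_def eventually_at_filter)
  moreover have "(flat_exp p \<longlongrightarrow> 0) (at_left 0)"
    by (rule Lim_transform_eventually[of "\<lambda>_. 0"]) (auto simp: flat_exp_def eventually_at_filter)
  ultimately show ?thesis
    by (simp add: filterlim_split_at)
qed

text \<open>Only the origin needs an argument: there the difference quotient of \<open>flat_exp p\<close> is again a member of
  the family, with polynomial \<open>X * p\<close>, and all members tend to zero.\<close>

lemma flat_exp_derivative: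
  "(flat_exp p has_real_derivative flat_exp (flat_exp_step p) t) (at t)"
proof -
  consider "t < 0" | "t = 0" | "t > 0" by linarith
  then show ?thesis
  proof cases
    case 1
    have "((\<lambda>_. 0) has_real_derivative 0) (at t)" by simp
    then show ?thesis
      using 1 by (subst DERIV_cong_ev[OF refl _ refl, where g = "\<lambda>_. 0"])
        (auto simp: flat_exp_def flat_exp_step_def intro!: eventually_nhds_in_open[of "{..<0}", THEN eventually_mono])
  next
    case 2
    have "((\<lambda>h. flat_exp ([:0, 1:] * p) h) \<longlongrightarrow> 0) (at 0)" by (rule flat_exp_tendsto_0)
    then have "((\<lambda>h. flat_exp p h / h) \<longlongrightarrow> 0) (at 0)"
      by (rule Lim_transform_eventually) (auto simp: flat_exp_def eventually_at_filter)
    then show ?thesis using 2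
      by (simp add: DERIV_def flat_exp_def)
  next
    case 3
    have "((\<lambda>t. poly p (1 / t) * exp (- (1 / t))) has_real_derivative
        flat_exp (flat_exp_step p) t) (at t)"
      using 3 by (auto intro!: derivative_eq_intros simp: flat_exp_def flat_exp_step_def field_simps power2_eq_square)
    then show ?thesis
      using 3 by (subst DERIV_cong_ev[OF refl _ refl, where g = "\<lambda>t. poly p (1 / t) * exp (- (1 / t))"])
        (auto simp: flat_exp_def intro!: eventually_nhds_in_open[of "{0<..}", THEN eventually_mono])
  qed
qed

definition flat_exp_seq :: "nat \<Rightarrow> real \<Rightarrow> real" where
  "flat_exp_seq k = flat_exp ((flat_exp_step ^^ k) 1)"

lemma deriv_seq_flat_exp: "deriv_seq flat_exp_seq"
  unfolding deriv_seq_def flat_exp_seq_def using flat_exp_derivative by simp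

lemma deriv_seq_mult:
  assumes f: "deriv_seq f" and g: "deriv_seq g"
  shows "deriv_seq (\<lambda>k t. \<Sum>j\<le>k. of_nat (k choose j) * f j t * g (k - j) t)"
  unfolding deriv_seq_def
proof (intro allI)
  fix k t
  have "((\<lambda>t. \<Sum>j\<le>k. of_nat (k choose j) * f j t * g (k - j) t) has_real_derivative
     (\<Sum>j\<le>k. of_nat (k choose j) * (f (Suc j) t * g (k - j) t + f j t * g (Suc (k - j)) t))) (at t)"
    using f g unfolding deriv_seq_def
    by (auto intro!: derivative_eq_intros sum.cong simp: algebra_simps)
  moreover have "(\<Sum>j\<le>k. of_nat (k choose j) * (f (Suc j) t * g (k - j) t + f j t * g (Suc (k - j)) t))
      = (\<Sum>j\<le>Suc k. of_nat (Suc k choose j) * f j t * g (Suc k - j) t)"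
  proof -
    have A: "(\<Sum>j\<le>k. of_nat (k choose j) * f j t * g (Suc k - j) t)
        = g (Suc k) t * f 0 t + (\<Sum>j\<le>k. of_nat (k choose Suc j) * f (Suc j) t * g (k - j) t)"
    proof -
      have "(\<Sum>j\<le>k. of_nat (k choose j) * f j t * g (Suc k - j) t)
         = (\<Sum>j\<le>Suc k. of_nat (k choose j) * f j t * g (Suc k - j) t)" by simp
      then show ?thesis by (subst (asm) sum.atMost_Suc_shift) simp
    qed
    have "(\<Sum>j\<le>k. of_nat (k choose j) * (f (Suc j) t * g (k - j) t + f j t * g (Suc (k - j)) t))
      = (\<Sum>j\<le>k. of_nat (k choose j) * f (Suc j) t * g (k - j) t)
        + (\<Sum>j\<le>k. of_nat (k choose j) * f j t * g (Suc k - j) t)"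
      by (simp add: sum.distrib[symmetric] algebra_simps Suc_diff_le)
    also have "\<dots> = (\<Sum>j\<le>Suc k. of_nat (Suc k choose j) * f j t * g (Suc k - j) t)"
      unfolding A by (subst sum.atMost_Suc_shift) (simp add: algebra_simps sum.distrib)
    finally show ?thesis .
  qed
  ultimately show "((\<lambda>t. \<Sum>j\<le>k. of_nat (k choose j) * f j t * g (k - j) t) has_real_derivative
      (\<Sum>j\<le>Suc k. of_nat (Suc k choose j) * f j t * g (Suc k - j) t)) (at t)" by simp
qed

lemma deriv_seq_affine:
  assumes "deriv_seq f"
  shows "deriv_seq (\<lambda>k t. a ^ k * f k (a * t + b))"
  unfolding deriv_seq_def
proof (intro allI)
  fix k t
  have "(f k has_real_derivative f (Suc k) (a * t + b)) (at (a * t + b))"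
    using assms by (auto simp: deriv_seq_def)
  then have "((\<lambda>t. f k (a * t + b)) has_real_derivative f (Suc k) (a * t + b) * a) (at t)"
    by (rule DERIV_chain2) (auto intro!: derivative_eq_intros)
  then show "((\<lambda>t. a ^ k * f k (a * t + b)) has_real_derivative a ^ Suc k * f (Suc k) (a * t + b)) (at t)"
    by (auto intro!: derivative_eq_intros)
qed

lemma deriv_seq_add:
  "deriv_seq f \<Longrightarrow> deriv_seq g \<Longrightarrow> deriv_seq (\<lambda>k t. f k t + g k t)"
  unfolding deriv_seq_def by (auto intro!: derivative_eq_intros)

lemma deriv_seq_const: "deriv_seq (\<lambda>k t. if k = 0 then c else 0)"
  unfolding deriv_seq_def by auto

lemma deriv_seq_continuous: "deriv_seq f \<Longrightarrow> continuous_on S (f k)"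
  unfolding deriv_seq_def
  by (meson DERIV_isCont continuous_at_imp_continuous_on)

text \<open>The product of the flat exponential at \<open>0\<close> with its mirror image at \<open>1\<close>.\<close>

lemma smooth_bump_exists:
  "\<exists>g. deriv_seq g \<and> (\<forall>k t. t \<le> 0 \<or> t \<ge> 1 \<longrightarrow> g k t = 0) \<and> (\<forall>t. 0 < t \<and> t < 1 \<longrightarrow> g 0 t > 0)"
proof -
  define h where "h = (\<lambda>k t. (-1) ^ k * flat_exp_seq k ((-1) * t + 1))"
  have h: "deriv_seq h" unfolding h_def by (rule deriv_seq_affine[OF deriv_seq_flat_exp])
  let ?g = "\<lambda>k t. \<Sum>j\<le>k. of_nat (k choose j) * flat_exp_seq j t * h (k - j) t"
  have "deriv_seq ?g" by (rule deriv_seq_mult[OF deriv_seq_flat_exp h])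
  moreover have "?g k t = 0" if "t \<le> 0 \<or> t \<ge> 1" for k t
    using that by (auto intro!: sum.neutral simp: flat_exp_seq_def flat_exp_def h_def)
  moreover have "?g 0 t > 0" if "0 < t \<and> t < 1" for t
    using that by (auto simp: flat_exp_seq_def flat_exp_def h_def)
  ultimately show ?thesis by blast
qed

text \<open>The normalized primitive of a bump on the unit interval.\<close>

lemma smooth_step_exists:
  "\<exists>S. deriv_seq S \<and> (\<forall>t. t \<le> 0 \<longrightarrow> S 0 t = 0) \<and> (\<forall>t. t \<ge> 1 \<longrightarrow> S 0 t = 1)
     \<and> (\<forall>t. 0 \<le> S 0 t \<and> S 0 t \<le> 1) \<and> (\<forall>k t. k \<noteq> 0 \<longrightarrow> t \<le> 0 \<or> t \<ge> 1 \<longrightarrow> S k t = 0)"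
proof -
  obtain g where g: "deriv_seq g" and g0: "\<And>k t. t \<le> 0 \<or> t \<ge> 1 \<Longrightarrow> g k t = 0"
    and gpos: "\<And>t. 0 < t \<Longrightarrow> t < 1 \<Longrightarrow> g 0 t > 0"
    using smooth_bump_exists by metis
  have cont: "continuous_on A (g 0)" for A by (rule deriv_seq_continuous[OF g])
  have gnn: "g 0 t \<ge> 0" for t using g0[of t 0] gpos[of t] by force
  have int: "g 0 integrable_on {a..b}" for a b
    by (rule integrable_continuous_interval[OF cont])
  define I where "I t = integral {-1..t} (g 0)" for t
  have I1: "I t = I 1" if "t \<ge> 1" for t
  proof -
    have "I 1 + integral {1..t} (g 0) = I t"
      unfolding I_def using that int by (intro Henstock_Kurzweil_Integration.integral_combine) auto
    moreover have "integral {1..t} (g 0) = 0"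
      using g0 by (subst Henstock_Kurzweil_Integration.integral_cong[of _ _ "\<lambda>_. 0"]) auto
    ultimately show ?thesis by simp
  qed
  have I0: "I t = 0" if "t \<le> 0" for t
    unfolding I_def using that g0 by (subst Henstock_Kurzweil_Integration.integral_cong[of _ _ "\<lambda>_. 0"]) auto
  have Imono: "I s \<le> I t" if "s \<le> t" for s t
    unfolding I_def using that gnn int by (intro integral_subset_le) auto
  have Ipos: "I 1 > 0"
  proof -
    have "I 1 \<noteq> 0"
    proof
      assume "I 1 = 0"
      then have "\<forall>x\<in>{-1..1}. g 0 x = 0"
        unfolding I_def using cont gnn by (subst (asm) integral_eq_0_iff) auto
      then have "g 0 (1/2) = 0" by auto
      then show False using gpos[of "1/2"] by auto
    qed
    then show ?thesis using Imono[of 0 1] I0[of 0] by auto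
  qed
  have Ider: "(I has_real_derivative g 0 t) (at t)" for t
  proof (cases "t > -1")
    case True
    have "((\<lambda>u. integral {-1..u} (g 0)) has_vector_derivative g 0 t) (at t within {-1..t+1})"
      by (rule integral_has_vector_derivative[OF cont]) (use True in auto)
    then have "((\<lambda>u. integral {-1..u} (g 0)) has_vector_derivative g 0 t) (at t within {-1<..<t+1})"
      by (rule has_vector_derivative_within_subset) auto
    then show ?thesis
      using True unfolding has_real_derivative_iff_has_vector_derivative I_def[abs_def]
      by (subst (asm) at_within_open) auto
  next
    case False
    have "((\<lambda>_. 0) has_real_derivative 0) (at t)" by simp
    then show ?thesis
      using False g0[of t 0] by (subst DERIV_cong_ev[OF refl _ refl, where g = "\<lambda>_. 0"])
        (auto simp: I0 intro!: eventually_nhds_in_open[of "{..<0}", THEN eventually_mono])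
  qed
  define S where "S k t = (if k = 0 then I t / I 1 else g (k - 1) t / I 1)" for k t
  have "deriv_seq S"
    unfolding deriv_seq_def
  proof (intro allI)
    fix k t
    show "(S k has_real_derivative S (Suc k) t) (at t)"
    proof (cases k)
      case 0
      have "((\<lambda>t. I t / I 1) has_real_derivative g 0 t / I 1) (at t)"
        by (rule DERIV_cdivide[OF Ider])
      then show ?thesis using 0 by (simp add: S_def[abs_def])
    next
      case (Suc j)
      have "((\<lambda>t. g j t / I 1) has_real_derivative g (Suc j) t / I 1) (at t)"
        by (rule DERIV_cdivide) (use g in \<open>auto simp: deriv_seq_def\<close>)
      then show ?thesis using Suc by (simp add: S_def[abs_def])
    qed
  qed
  moreover have "0 \<le> I t \<and> I t \<le> I 1" for t
    using Imono[of 0 t] Imono[of t 1] I0[of 0] I0[of t] I1[of t] Ipos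
    by (smt (verit))
  moreover have "S 0 t = 1" if "t \<ge> 1" for t
    using I1[OF that] Ipos by (simp add: S_def)
  ultimately show ?thesis
    using Ipos I0 g0 by (intro exI[of _ S]) (auto simp: S_def)
qed

definition smooth_step :: "nat \<Rightarrow> real \<Rightarrow> real" where
  "smooth_step = (SOME S. deriv_seq S \<and> (\<forall>t. t \<le> 0 \<longrightarrow> S 0 t = 0) \<and> (\<forall>t. t \<ge> 1 \<longrightarrow> S 0 t = 1)
     \<and> (\<forall>t. 0 \<le> S 0 t \<and> S 0 t \<le> 1) \<and> (\<forall>k t. k \<noteq> 0 \<longrightarrow> t \<le> 0 \<or> t \<ge> 1 \<longrightarrow> S k t = 0))"

lemma smooth_step:
  shows deriv_seq_smooth_step: "deriv_seq smooth_step"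
    and smooth_step_le0: "t \<le> 0 \<Longrightarrow> smooth_step 0 t = 0"
    and smooth_step_ge1: "t \<ge> 1 \<Longrightarrow> smooth_step 0 t = 1"
    and smooth_step_nonneg: "0 \<le> smooth_step 0 t"
    and smooth_step_le1: "smooth_step 0 t \<le> 1"
    and smooth_step_flat: "k \<noteq> 0 \<Longrightarrow> t \<le> 0 \<or> t \<ge> 1 \<Longrightarrow> smooth_step k t = 0"
  using someI_ex[OF smooth_step_exists, folded smooth_step_def] by blast+

lemma smooth_step_bounded: "\<exists>B\<ge>1. \<forall>k\<le>m. \<forall>t. \<bar>smooth_step k t\<bar> \<le> B"
proof (induction m)
  case 0
  then show ?case using smooth_step_nonneg smooth_step_le1
    by (intro exI[of _ 1]) (auto simp: abs_of_nonneg)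
next
  case (Suc m)
  then obtain B where B: "B \<ge> 1" "\<And>k t. k \<le> m \<Longrightarrow> \<bar>smooth_step k t\<bar> \<le> B" by blast
  have "compact (smooth_step (Suc m) ` {0..1})"
    by (intro compact_continuous_image deriv_seq_continuous deriv_seq_smooth_step) auto
  then obtain D where "\<And>x. x \<in> smooth_step (Suc m) ` {0..1} \<Longrightarrow> norm x \<le> D"
    using compact_imp_bounded[of "smooth_step (Suc m) ` {0..1}"] unfolding bounded_iff by blast
  then have D: "\<And>t. t \<in> {0..1} \<Longrightarrow> \<bar>smooth_step (Suc m) t\<bar> \<le> D" by simp
  have "\<bar>smooth_step (Suc m) t\<bar> \<le> max B D" for t
    using D[of t] smooth_step_flat[of "Suc m" t] B(1) by (cases "t \<in> {0..1}") auto
  then show ?case using B by (intro exI[of _ "max B D"]) (auto simp: le_Suc_eq max.coboundedI1)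
qed

text \<open>A cutoff that is one on \<open>[- R, R]\<close> and zero outside \<open>[- R - w, R + w]\<close>.  It is an ascending and a
  descending step added up, minus one; multiplying the two steps would give the same function but bring
  products into every derivative.\<close>

definition plateau :: "real \<Rightarrow> real \<Rightarrow> nat \<Rightarrow> real \<Rightarrow> real" where
  "plateau R w k t = (- (1 / w)) ^ k * smooth_step k (- (1 / w) * t + (R + w) / w)
     + (1 / w) ^ k * smooth_step k (1 / w * t + (R + w) / w) + (if k = 0 then - 1 else 0)"

lemma deriv_seq_plateau: "deriv_seq (plateau R w)"
  unfolding plateau_def[abs_def]
  by (intro deriv_seq_add deriv_seq_affine deriv_seq_smooth_step deriv_seq_const)

lemma plateau_even: "plateau R w k (- t) = (- 1) ^ k * plateau R w k t"
  by (simp add: plateau_def power_minus' algebra_simps)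

lemma plateau_inside:
  assumes "R \<ge> 0" "w > 0" "\<bar>t\<bar> \<le> R"
  shows "plateau R w k t = (if k = 0 then 1 else 0)"
proof -
  have "- (1 / w) * t + (R + w) / w \<ge> 1" "1 / w * t + (R + w) / w \<ge> 1"
    using assms by (auto simp: field_simps)
  then show ?thesis
    by (simp add: plateau_def smooth_step_ge1 smooth_step_flat)
qed

lemma plateau_outside:
  assumes "R \<ge> 0" "w > 0" "\<bar>t\<bar> \<ge> R + w"
  shows "plateau R w k t = 0"
proof -
  have "(- (1 / w) * t + (R + w) / w \<le> 0 \<and> 1 / w * t + (R + w) / w \<ge> 1)
     \<or> (- (1 / w) * t + (R + w) / w \<ge> 1 \<and> 1 / w * t + (R + w) / w \<le> 0)"
  proof (cases "t \<ge> 0")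
    case True
    then have "- t + (R + w) \<le> 0" "t + R + w \<ge> w" using assms by auto
    then have "(- t + (R + w)) / w \<le> 0" "(t + R + w) / w \<ge> 1"
      using assms by (auto simp: divide_le_0_iff)
    then show ?thesis by (simp add: add_divide_distrib diff_divide_distrib)
  next
    case False
    then have "t + (R + w) \<le> 0" "- t + R + w \<ge> w" using assms by auto
    then have "(t + (R + w)) / w \<le> 0" "(- t + R + w) / w \<ge> 1"
      using assms by (auto simp: divide_le_0_iff)
    then show ?thesis by (simp add: add_divide_distrib diff_divide_distrib)
  qed
  then show ?thesis
    by (auto simp: plateau_def smooth_step_ge1 smooth_step_le0 smooth_step_flat)
qed

lemma plateau_range:
  assumes "R \<ge> 0" "w > 0"
  shows "0 \<le> plateau R w 0 t \<and> plateau R w 0 t \<le> 1"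
proof -
  have "- (1 / w) * t + (R + w) / w \<ge> 1 \<or> 1 / w * t + (R + w) / w \<ge> 1"
    using assms by (auto simp: field_simps)
  then show ?thesis
    using smooth_step_nonneg smooth_step_le1
    by (auto simp: plateau_def smooth_step_ge1)
qed

text \<open>Each derivative of a cutoff with transition width \<open>w\<close> costs a factor \<open>1 / w\<close>.\<close>

lemma plateau_bounded: "\<exists>B\<ge>1. \<forall>R w k t. w > 0 \<longrightarrow> k \<le> m \<longrightarrow> \<bar>plateau R w k t\<bar> \<le> B * (1 / w) ^ k"
proof -
  obtain B where B: "B \<ge> 1" "\<And>k t. k \<le> m \<Longrightarrow> \<bar>smooth_step k t\<bar> \<le> B"
    using smooth_step_bounded by blast
  have "\<bar>plateau R w k t\<bar> \<le> (2 * B + 1) * (1 / w) ^ k" if "w > 0" "k \<le> m" for R w k t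
  proof -
    have "\<bar>plateau R w k t\<bar> \<le> (1 / w) ^ k * \<bar>smooth_step k (- (1 / w) * t + (R + w) / w)\<bar>
      + (1 / w) ^ k * \<bar>smooth_step k (1 / w * t + (R + w) / w)\<bar> + (1 / w) ^ k"
      unfolding plateau_def using that
      by (intro order.trans[OF abs_triangle_ineq] add_mono) (auto simp: abs_mult power_abs)
    also have "\<dots> \<le> (1 / w) ^ k * B + (1 / w) ^ k * B + (1 / w) ^ k"
      using that B by (intro add_mono mult_left_mono) auto
    finally show ?thesis by (simp add: algebra_simps)
  qed
  then show ?thesis using B by (intro exI[of _ "2 * B + 1"]) auto
qed

section \<open>Multi-indices and jets of smooth functions\<close>

abbreviation inc :: "'n::finite multiindex \<Rightarrow> 'n \<Rightarrow> 'n multiindex" where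
  "inc \<beta> i \<equiv> \<beta>(i := Suc (\<beta> i))"

abbreviation zero_mi :: "'n::finite multiindex" where
  "zero_mi \<equiv> (\<lambda>_. 0)"

lemma mi_order_inc [simp]: "mi_order (inc \<beta> i) = Suc (mi_order \<beta>)"
proof -
  have "mi_order (inc \<beta> i) = Suc (\<beta> i) + (\<Sum>j\<in>UNIV - {i}. \<beta> j)"
    by (simp add: mi_order_def sum.remove[of UNIV i])
  then show ?thesis by (simp add: mi_order_def sum.remove[of UNIV i \<beta>])
qed

lemma mi_order_zero [simp]: "mi_order zero_mi = 0"
  by (simp add: mi_order_def)

lemma mi_order_eq_0_iff: "mi_order \<beta> = 0 \<longleftrightarrow> \<beta> = zero_mi"
  by (auto simp: mi_order_def fun_eq_iff)

lemma mi_order_Suc_obtain: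
  assumes "mi_order \<beta> = Suc k"
  obtains \<gamma> i where "\<beta> = inc \<gamma> i" "mi_order \<gamma> = k"
proof -
  obtain i where i: "\<beta> i \<noteq> 0" using assms mi_order_eq_0_iff[of \<beta>] by auto
  define \<gamma> where "\<gamma> = \<beta>(i := \<beta> i - 1)"
  have "\<beta> = inc \<gamma> i" using i by (auto simp: \<gamma>_def fun_eq_iff)
  moreover from this have "mi_order \<gamma> = k" using assms by simp
  ultimately show ?thesis using that by blast
qed

lemma le_mi_order: "\<beta> i \<le> mi_order \<beta>"
  unfolding mi_order_def by (rule member_le_sum) auto

lemma finite_bounded_mi [simp]: "finite {\<gamma> :: 'n::finite multiindex. \<forall>i. \<gamma> i \<le> \<beta> i}"
proof -
  have "{\<gamma> :: 'n multiindex. \<forall>i. \<gamma> i \<le> \<beta> i} \<subseteq> Pi\<^sub>E UNIV (\<lambda>i. {..\<beta> i})" by auto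
  then show ?thesis by (rule finite_subset) (auto intro!: finite_PiE)
qed

lemma finite_mi_order_le [simp]: "finite {\<beta> :: 'n::finite multiindex. mi_order \<beta> \<le> k}"
  by (rule finite_subset[OF _ finite_bounded_mi[of "\<lambda>_. k"]]) (auto intro: order.trans[OF le_mi_order])

lemma finite_mi_order_eq [simp]: "finite {\<beta> :: 'n::finite multiindex. mi_order \<beta> = k}"
  by (rule finite_subset[OF _ finite_mi_order_le[of k]]) auto

definition pdiff :: "(real ^ 'n::finite \<Rightarrow> real) \<Rightarrow> 'n \<Rightarrow> (real ^ 'n \<Rightarrow> real) \<Rightarrow> bool" where
  "pdiff f i f' \<longleftrightarrow> (\<forall>x. ((\<lambda>t. f (x + t *\<^sub>R axis i 1)) has_real_derivative f' x) (at 0))"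

text \<open>A jet is a smooth function together with all of its partial derivatives, which makes the energy and the
  Leibniz formula finite sums over multi-indices; the function itself is the entry at \<open>zero_mi\<close>.\<close>

definition jet :: "('n::finite multiindex \<Rightarrow> real ^ 'n \<Rightarrow> real) \<Rightarrow> bool" where
  "jet U \<longleftrightarrow> (\<forall>\<beta>. continuous_on UNIV (U \<beta>)) \<and> (\<forall>\<beta> i. pdiff (U \<beta>) i (U (inc \<beta> i)))"

lemma smooth_jet_iff: "smooth_jet \<phi> \<Phi> \<longleftrightarrow> \<Phi> zero_mi = \<phi> \<and> jet \<Phi>"
  unfolding smooth_jet_def jet_def pdiff_def by blast

lemma jet_continuous: "jet U \<Longrightarrow> continuous_on S (U \<beta>)"
  unfolding jet_def using continuous_on_subset by blast

lemma jet_borel: "jet U \<Longrightarrow> U \<beta> \<in> borel_measurable borel"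
  by (intro borel_measurable_continuous_onI jet_continuous)

lemma jet_pdiff: "jet U \<Longrightarrow> pdiff (U \<beta>) i (U (inc \<beta> i))"
  unfolding jet_def by blast

text \<open>The definition speaks of the derivative at parameter zero only; translating the base point gives it at
  every point of the line.\<close>

lemma pdiff_line:
  assumes "pdiff f i f'"
  shows "((\<lambda>t. f (x + t *\<^sub>R axis i 1)) has_real_derivative f' (x + s *\<^sub>R axis i 1)) (at s)"
proof -
  have "((\<lambda>t. f ((x + s *\<^sub>R axis i 1) + t *\<^sub>R axis i 1)) has_real_derivative f' (x + s *\<^sub>R axis i 1)) (at (s + (- s)))"
    using assms unfolding pdiff_def by simp
  then have "((\<lambda>t. f ((x + s *\<^sub>R axis i 1) + (t + (- s)) *\<^sub>R axis i 1)) has_real_derivative f' (x + s *\<^sub>R axis i 1)) (at s)"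
    by (subst (asm) DERIV_shift)
  then show ?thesis by (simp add: algebra_simps)
qed

lemma pdiff_add: "pdiff f i f' \<Longrightarrow> pdiff g i g' \<Longrightarrow> pdiff (\<lambda>x. f x + g x) i (\<lambda>x. f' x + g' x)"
  unfolding pdiff_def by (auto intro!: derivative_eq_intros)

lemma pdiff_diff: "pdiff f i f' \<Longrightarrow> pdiff g i g' \<Longrightarrow> pdiff (\<lambda>x. f x - g x) i (\<lambda>x. f' x - g' x)"
  unfolding pdiff_def by (auto intro!: derivative_eq_intros)

lemma pdiff_cmult: "pdiff f i f' \<Longrightarrow> pdiff (\<lambda>x. c * f x) i (\<lambda>x. c * f' x)"
  unfolding pdiff_def by (auto intro!: derivative_eq_intros)

lemma pdiff_mult:
  "pdiff f i f' \<Longrightarrow> pdiff g i g' \<Longrightarrow> pdiff (\<lambda>x. f x * g x) i (\<lambda>x. f' x * g x + f x * g' x)"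
  unfolding pdiff_def
proof (intro allI)
  fix x
  assume *: "\<forall>x. ((\<lambda>t. f (x + t *\<^sub>R axis i 1)) has_real_derivative f' x) (at 0)"
    "\<forall>x. ((\<lambda>t. g (x + t *\<^sub>R axis i 1)) has_real_derivative g' x) (at 0)"
  show "((\<lambda>t. f (x + t *\<^sub>R axis i 1) * g (x + t *\<^sub>R axis i 1)) has_real_derivative f' x * g x + f x * g' x) (at 0)"
    using DERIV_mult[OF *[THEN spec, of x]] by (simp add: algebra_simps)
qed

lemma pdiff_sum: "(\<And>a. a \<in> A \<Longrightarrow> pdiff (f a) i (f' a)) \<Longrightarrow> pdiff (\<lambda>x. \<Sum>a\<in>A. f a x) i (\<lambda>x. \<Sum>a\<in>A. f' a x)"
  unfolding pdiff_def by (auto intro!: derivative_eq_intros)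

lemma pdiff_power:
  assumes "pdiff f i f'"
  shows "pdiff (\<lambda>x. f x ^ Suc n) i (\<lambda>x. real (Suc n) * f x ^ n * f' x)"
  unfolding pdiff_def
proof
  fix x
  have "((\<lambda>t. f (x + t *\<^sub>R axis i 1)) has_real_derivative f' x) (at 0)"
    using assms by (auto simp: pdiff_def)
  from DERIV_power[OF this, of "Suc n"]
  show "((\<lambda>t. f (x + t *\<^sub>R axis i 1) ^ Suc n) has_real_derivative real (Suc n) * f x ^ n * f' x) (at 0)"
    by (simp add: algebra_simps)
qed

lemma jet_add: "jet U \<Longrightarrow> jet V \<Longrightarrow> jet (\<lambda>\<beta> x. U \<beta> x + V \<beta> x)"
  unfolding jet_def by (auto intro!: continuous_intros pdiff_add)

lemma jet_diff: "jet U \<Longrightarrow> jet V \<Longrightarrow> jet (\<lambda>\<beta> x. U \<beta> x - V \<beta> x)"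
  unfolding jet_def by (auto intro!: continuous_intros pdiff_diff)

lemma jet_cmult: "jet U \<Longrightarrow> jet (\<lambda>\<beta> x. c * U \<beta> x)"
  unfolding jet_def by (auto intro!: continuous_intros pdiff_cmult)

lemma jet_sum: "(\<And>a. a \<in> A \<Longrightarrow> jet (U a)) \<Longrightarrow> jet (\<lambda>\<beta> x. \<Sum>a\<in>A. U a \<beta> x)"
  unfolding jet_def by (auto intro!: continuous_intros pdiff_sum)

section \<open>The Leibniz formula\<close>

definition mi_choose :: "'n::finite multiindex \<Rightarrow> 'n multiindex \<Rightarrow> real" where
  "mi_choose \<beta> \<gamma> = (\<Prod>i\<in>UNIV. real (\<beta> i choose \<gamma> i))"

definition mi_diff :: "'n::finite multiindex \<Rightarrow> 'n multiindex \<Rightarrow> 'n multiindex" where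
  "mi_diff \<beta> \<gamma> = (\<lambda>i. \<beta> i - \<gamma> i)"

abbreviation mi_below :: "'n::finite multiindex \<Rightarrow> 'n multiindex set" where
  "mi_below \<beta> \<equiv> {\<gamma>. \<forall>i. \<gamma> i \<le> \<beta> i}"

text \<open>The Leibniz formula, taken as definition of the jet of a product.\<close>

definition mult_jet ::
  "('n::finite multiindex \<Rightarrow> real ^ 'n \<Rightarrow> real) \<Rightarrow> ('n multiindex \<Rightarrow> real ^ 'n \<Rightarrow> real) \<Rightarrow>
   'n multiindex \<Rightarrow> real ^ 'n \<Rightarrow> real" where
  "mult_jet U V \<beta> x = (\<Sum>\<gamma>\<in>mi_below \<beta>. mi_choose \<beta> \<gamma> * (U \<gamma> x * V (mi_diff \<beta> \<gamma>) x))"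

lemma mi_order_mono: "\<gamma> \<in> mi_below \<beta> \<Longrightarrow> mi_order \<gamma> \<le> mi_order \<beta>"
  unfolding mi_order_def by (auto intro: sum_mono)

lemma mi_order_diff: "\<gamma> \<in> mi_below \<beta> \<Longrightarrow> mi_order (mi_diff \<beta> \<gamma>) = mi_order \<beta> - mi_order \<gamma>"
  unfolding mi_order_def mi_diff_def by (auto intro!: sum_subtractf_nat)

lemma mi_choose_eq_0: "\<gamma> \<notin> mi_below \<beta> \<Longrightarrow> mi_choose \<beta> \<gamma> = 0"
proof -
  assume "\<gamma> \<notin> mi_below \<beta>"
  then obtain i where "\<beta> i < \<gamma> i" by (auto simp: not_le)
  then show ?thesis unfolding mi_choose_def by (intro prod_zero) auto
qed

lemma mi_choose_nonneg [simp]: "mi_choose \<beta> \<gamma> \<ge> 0"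
  unfolding mi_choose_def by (intro prod_nonneg) auto

lemma mi_choose_remove:
  "mi_choose \<beta> \<gamma> = real (\<beta> i choose \<gamma> i) * (\<Prod>j\<in>UNIV - {i}. real (\<beta> j choose \<gamma> j))"
  unfolding mi_choose_def by (simp add: prod.remove[of UNIV i])

lemma mi_choose_pascal:
  "mi_choose (inc \<beta> i) \<gamma> = mi_choose \<beta> \<gamma> + (if \<gamma> i = 0 then 0 else mi_choose \<beta> (\<gamma>(i := \<gamma> i - 1)))"
proof -
  have "(\<Prod>j\<in>UNIV - {i}. real (inc \<beta> i j choose \<gamma> j)) = (\<Prod>j\<in>UNIV - {i}. real (\<beta> j choose \<gamma> j))"
    "(\<Prod>j\<in>UNIV - {i}. real (\<beta> j choose (\<gamma>(i := \<gamma> i - 1)) j)) = (\<Prod>j\<in>UNIV - {i}. real (\<beta> j choose \<gamma> j))"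
    by (auto intro!: prod.cong)
  then show ?thesis
    unfolding mi_choose_remove[of _ _ i] by (cases "\<gamma> i") (auto simp: algebra_simps)
qed

text \<open>Differentiating one summand of the Leibniz formula gives two; after the shift \<open>\<gamma> = inc \<gamma>' i\<close> in the first
  of them, Pascal's identity joins the coefficients to those of \<open>inc \<beta> i\<close>.\<close>

lemma jet_mult:
  fixes U V :: "'n::finite multiindex \<Rightarrow> real ^ 'n \<Rightarrow> real"
  assumes U: "jet U" and V: "jet V"
  shows "jet (mult_jet U V)"
  unfolding jet_def
proof (intro conjI allI)
  fix \<beta> :: "'n multiindex"
  show "continuous_on UNIV (mult_jet U V \<beta>)"
    unfolding mult_jet_def by (intro continuous_intros jet_continuous U V)
next
  fix \<beta> :: "'n multiindex" and i
  have 1: "pdiff (mult_jet U V \<beta>) i (\<lambda>x. \<Sum>\<gamma>\<in>mi_below \<beta>. mi_choose \<beta> \<gamma> *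
       (U (inc \<gamma> i) x * V (mi_diff \<beta> \<gamma>) x + U \<gamma> x * V (inc (mi_diff \<beta> \<gamma>) i) x))"
    unfolding mult_jet_def by (intro pdiff_sum pdiff_cmult pdiff_mult jet_pdiff U V)
  have "(\<Sum>\<gamma>\<in>mi_below \<beta>. mi_choose \<beta> \<gamma> *
       (U (inc \<gamma> i) x * V (mi_diff \<beta> \<gamma>) x + U \<gamma> x * V (inc (mi_diff \<beta> \<gamma>) i) x)) = mult_jet U V (inc \<beta> i) x" for x
  proof -
    define h where "h \<gamma> = U \<gamma> x * V (mi_diff (inc \<beta> i) \<gamma>) x" for \<gamma>
    have sub: "mi_below \<beta> \<subseteq> mi_below (inc \<beta> i)"
      by (auto intro: le_SucI)
    have A: "(\<Sum>\<gamma>\<in>mi_below \<beta>. mi_choose \<beta> \<gamma> * (U \<gamma> x * V (inc (mi_diff \<beta> \<gamma>) i) x))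
       = (\<Sum>\<gamma>\<in>mi_below (inc \<beta> i). mi_choose \<beta> \<gamma> * h \<gamma>)"
    proof (rule sum.mono_neutral_cong_left[OF finite_bounded_mi sub])
      show "\<forall>\<gamma>\<in>mi_below (inc \<beta> i) - mi_below \<beta>. mi_choose \<beta> \<gamma> * h \<gamma> = 0"
        by (auto intro!: mi_choose_eq_0)
    next
      fix \<gamma> assume "\<gamma> \<in> mi_below \<beta>"
      then have "inc (mi_diff \<beta> \<gamma>) i = mi_diff (inc \<beta> i) \<gamma>"
        by (auto simp: mi_diff_def fun_eq_iff Suc_diff_le)
      then show "mi_choose \<beta> \<gamma> * (U \<gamma> x * V (inc (mi_diff \<beta> \<gamma>) i) x) = mi_choose \<beta> \<gamma> * h \<gamma>"
        by (simp add: h_def)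
    qed
    have B: "(\<Sum>\<gamma>\<in>mi_below \<beta>. mi_choose \<beta> \<gamma> * (U (inc \<gamma> i) x * V (mi_diff \<beta> \<gamma>) x))
       = (\<Sum>\<gamma>\<in>mi_below (inc \<beta> i). (if \<gamma> i = 0 then 0 else mi_choose \<beta> (\<gamma>(i := \<gamma> i - 1))) * h \<gamma>)"
      (is "?L = sum ?f _")
    proof -
      have "?L = (\<Sum>\<gamma>\<in>(\<lambda>\<gamma>. inc \<gamma> i) ` mi_below \<beta>. ?f \<gamma>)"
      proof (subst sum.reindex)
        show "inj_on (\<lambda>\<gamma>. inc \<gamma> i) (mi_below \<beta>)"
        proof (rule inj_onI)
          fix a b :: "'n multiindex" assume "inc a i = inc b i"
          then show "a = b" by (metis fun_upd_triv fun_upd_upd fun_upd_same nat.inject)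
        qed
        show "?L = (\<Sum>\<gamma>\<in>mi_below \<beta>. (?f \<circ> (\<lambda>\<gamma>. inc \<gamma> i)) \<gamma>)"
        proof (rule sum.cong[OF refl])
          fix \<gamma>
          have "mi_diff (inc \<beta> i) (inc \<gamma> i) = mi_diff \<beta> \<gamma>" by (auto simp: mi_diff_def)
          then show "mi_choose \<beta> \<gamma> * (U (inc \<gamma> i) x * V (mi_diff \<beta> \<gamma>) x) = (?f \<circ> (\<lambda>\<gamma>. inc \<gamma> i)) \<gamma>"
            by (simp add: h_def)
        qed
      qed
      also have "\<dots> = sum ?f (mi_below (inc \<beta> i))"
      proof (rule sum.mono_neutral_left[OF finite_bounded_mi])
        show "(\<lambda>\<gamma>. inc \<gamma> i) ` mi_below \<beta> \<subseteq> mi_below (inc \<beta> i)" by auto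
        show "\<forall>\<gamma>\<in>mi_below (inc \<beta> i) - (\<lambda>\<gamma>. inc \<gamma> i) ` mi_below \<beta>. ?f \<gamma> = 0"
        proof
          fix \<gamma> assume *: "\<gamma> \<in> mi_below (inc \<beta> i) - (\<lambda>\<gamma>. inc \<gamma> i) ` mi_below \<beta>"
          show "?f \<gamma> = 0"
          proof (cases "\<gamma> i = 0")
            case False
            let ?d = "\<gamma>(i := \<gamma> i - 1)"
            have "\<gamma> = inc ?d i" using False by (auto simp: fun_eq_iff)
            moreover have "?d \<in> mi_below \<beta>"
            proof -
              have "?d j \<le> \<beta> j" for j using * by (cases "j = i") (auto simp: le_diff_conv dest!: spec[of _ j])
              then show ?thesis by blast
            qed
            ultimately have "\<gamma> \<in> (\<lambda>\<gamma>. inc \<gamma> i) ` mi_below \<beta>" by blast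
            then show ?thesis using * by blast
          qed simp
        qed
      qed
      finally show ?thesis .
    qed
    have "mult_jet U V (inc \<beta> i) x = (\<Sum>\<gamma>\<in>mi_below (inc \<beta> i).
        (mi_choose \<beta> \<gamma> + (if \<gamma> i = 0 then 0 else mi_choose \<beta> (\<gamma>(i := \<gamma> i - 1)))) * h \<gamma>)"
      unfolding mult_jet_def h_def by (subst mi_choose_pascal) simp
    then show ?thesis
      unfolding distrib_left distrib_right sum.distrib A B by simp
  qed
  then have 2: "(\<lambda>x. \<Sum>\<gamma>\<in>mi_below \<beta>. mi_choose \<beta> \<gamma> *
       (U (inc \<gamma> i) x * V (mi_diff \<beta> \<gamma>) x + U \<gamma> x * V (inc (mi_diff \<beta> \<gamma>) i) x)) = mult_jet U V (inc \<beta> i)"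
    by (intro ext)
  from 1 show "pdiff (mult_jet U V \<beta>) i (mult_jet U V (inc \<beta> i))"
    unfolding 2 .
qed

lemma mult_jet_zero: "mult_jet U V zero_mi x = U zero_mi x * V zero_mi x"
proof -
  have "mi_below zero_mi = {zero_mi}" by auto
  then have "mult_jet U V zero_mi x = (\<Sum>\<gamma>\<in>{zero_mi}. mi_choose zero_mi \<gamma> * (U \<gamma> x * V (mi_diff zero_mi \<gamma>) x))"
    unfolding mult_jet_def by (rule sum.cong) simp
  then show ?thesis by (simp add: mi_choose_def mi_diff_def)
qed

section \<open>Tensor products, cubes and cutoff functions\<close>

text \<open>For products of functions of single coordinates the jet can be written down at once.  All cutoffs below
  are of this kind, which is why cubes take the place of balls throughout.\<close>

definition tensor :: "('n::finite \<Rightarrow> nat \<Rightarrow> real \<Rightarrow> real) \<Rightarrow> 'n multiindex \<Rightarrow> real ^ 'n \<Rightarrow> real" where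
  "tensor g \<beta> x = (\<Prod>i\<in>UNIV. g i (\<beta> i) (x $ i))"

lemma tensor_remove:
  "tensor g \<beta> x = g i (\<beta> i) (x $ i) * (\<Prod>j\<in>UNIV - {i}. g j (\<beta> j) (x $ j))"
  unfolding tensor_def by (simp add: prod.remove[of UNIV i])

lemma jet_tensor:
  fixes g :: "'n::finite \<Rightarrow> nat \<Rightarrow> real \<Rightarrow> real"
  assumes g: "\<And>i. deriv_seq (g i)"
  shows "jet (tensor g)"
  unfolding jet_def
proof (intro conjI allI)
  fix \<beta> :: "'n multiindex"
  show "continuous_on UNIV (tensor g \<beta>)"
    unfolding tensor_def
    by (intro continuous_intros continuous_on_compose2[OF deriv_seq_continuous[OF g, of UNIV]]) auto
next
  fix \<beta> :: "'n multiindex" and i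
  show "pdiff (tensor g \<beta>) i (tensor g (inc \<beta> i))"
    unfolding pdiff_def
  proof
    fix x :: "real ^ 'n"
    let ?c = "\<Prod>j\<in>UNIV - {i}. g j (\<beta> j) (x $ j)"
    have "(g i (\<beta> i) has_real_derivative g i (Suc (\<beta> i)) (x $ i)) (at (0 + x $ i))"
      using g[of i] by (simp add: deriv_seq_def)
    then have "((\<lambda>t. g i (\<beta> i) (t + x $ i) * ?c) has_real_derivative g i (Suc (\<beta> i)) (x $ i) * ?c) (at 0)"
      by (intro DERIV_cmult_right) (simp only: DERIV_shift)
    moreover have "(\<lambda>t. g i (\<beta> i) (t + x $ i) * ?c) = (\<lambda>t. tensor g \<beta> (x + t *\<^sub>R axis i 1))"
      unfolding tensor_remove[of _ _ _ i]
      by (auto simp: fun_eq_iff axis_def add.commute intro!: prod.cong arg_cong2[of _ _ _ _ "(*)"])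
    moreover have "g i (Suc (\<beta> i)) (x $ i) * ?c = tensor g (inc \<beta> i) x"
      unfolding tensor_remove[of _ _ _ i]
      by (auto intro!: prod.cong arg_cong2[of _ _ _ _ "(*)"])
    ultimately show "((\<lambda>t. tensor g \<beta> (x + t *\<^sub>R axis i 1)) has_real_derivative tensor g (inc \<beta> i) x) (at 0)"
      by simp
  qed
qed

definition cube :: "real ^ 'n::finite \<Rightarrow> real \<Rightarrow> (real ^ 'n) set" where
  "cube a r = {x. infnorm (x - a) \<le> r}"

lemma infnorm_le_iff: "infnorm (x :: real ^ 'n::finite) \<le> r \<longleftrightarrow> (\<forall>i. \<bar>x $ i\<bar> \<le> r)"
  by (simp add: infnorm_Max Basis_vec_def cart_eq_inner_axis) 

lemma infnorm_attained: "\<exists>i. infnorm (x :: real ^ 'n::finite) = \<bar>x $ i\<bar>"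
proof (rule ccontr)
  assume "\<not> ?thesis"
  then have *: "\<bar>x $ i\<bar> < infnorm x" for i
    using component_le_infnorm_cart[of x i] by (metis less_eq_real_def)
  define M where "M = Max (range (\<lambda>i. \<bar>x $ i\<bar>))"
  have "infnorm x \<le> M" unfolding infnorm_le_iff M_def by auto
  moreover have "M < infnorm x" unfolding M_def using * by (subst Max_less_iff) auto
  ultimately show False by simp
qed

lemma cube_eq_cbox: "cube a r = cbox (a - (\<chi> i. r)) (a + (\<chi> i. r))"
  by (auto simp: cube_def infnorm_le_iff mem_box_cart abs_le_iff algebra_simps)

lemma compact_cube [simp]: "compact (cube a r)"
  by (simp add: cube_eq_cbox)

lemma closed_cube [simp]: "closed (cube a r)"
  by (simp add: compact_imp_closed)

lemma convex_cube [simp]: "convex (cube a r)"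
  by (simp add: cube_eq_cbox)

lemma cube_borel [measurable]: "cube a r \<in> sets borel"
  by (simp add: cube_eq_cbox)

lemma measure_cube: "r \<ge> 0 \<Longrightarrow> measure lborel (cube (a :: real ^ 'n::finite) r) = (2 * r) ^ CARD('n)"
  unfolding cube_eq_cbox by (subst content_cbox_cart) (auto simp: interval_ne_empty_cart)

lemma emeasure_cube: "r \<ge> 0 \<Longrightarrow> emeasure lborel (cube (a :: real ^ 'n::finite) r) = ennreal ((2 * r) ^ CARD('n))"
  by (metis measure_cube emeasure_eq_ennreal_measure emeasure_lborel_cbox_finite cube_eq_cbox infinity_ennreal_def less_irrefl)

lemma center_in_cube: "r \<ge> 0 \<Longrightarrow> a \<in> cube a r"
  by (simp add: cube_def infnorm_0)

definition cutoff :: "real ^ 'n::finite \<Rightarrow> real \<Rightarrow> real \<Rightarrow> 'n multiindex \<Rightarrow> real ^ 'n \<Rightarrow> real" where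
  "cutoff a R w = tensor (\<lambda>i k t. plateau R w k (t - a $ i))"

lemma deriv_seq_shift: "deriv_seq f \<Longrightarrow> deriv_seq (\<lambda>k t. f k (t - a))"
  using deriv_seq_affine[of f 1 "- a"] by simp

lemma jet_cutoff: "jet (cutoff a R w)"
  unfolding cutoff_def by (intro jet_tensor deriv_seq_shift deriv_seq_plateau)

lemma cutoff_eq: "cutoff a R w \<beta> x = (\<Prod>i\<in>UNIV. plateau R w (\<beta> i) ((x - a) $ i))"
  by (simp add: cutoff_def tensor_def)

lemma cutoff_inside:
  assumes "R \<ge> 0" "w > 0" "infnorm (x - a) \<le> R"
  shows "cutoff a R w \<beta> x = (if \<beta> = zero_mi then 1 else 0)"
proof -
  have *: "plateau R w k ((x - a) $ i) = (if k = 0 then 1 else 0)" for i k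
    using assms by (intro plateau_inside) (auto simp: infnorm_le_iff)
  show ?thesis
    unfolding cutoff_eq * by (auto simp: fun_eq_iff)
qed

lemma cutoff_outside:
  assumes "R \<ge> 0" "w > 0" "infnorm (x - a) \<ge> R + w"
  shows "cutoff a R w \<beta> x = 0"
proof -
  obtain i where "infnorm (x - a) = \<bar>(x - a) $ i\<bar>" using infnorm_attained by blast
  then have "plateau R w (\<beta> i) ((x - a) $ i) = 0"
    using assms by (intro plateau_outside) auto
  then show ?thesis unfolding cutoff_eq by (intro prod_zero) auto
qed

lemma cutoff_range:
  assumes "R \<ge> 0" "w > 0"
  shows "0 \<le> cutoff a R w zero_mi x" "cutoff a R w zero_mi x \<le> 1"
  using plateau_range[OF assms] unfolding cutoff_eq by (auto intro!: prod_nonneg prod_le_1)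

text \<open>Cutoffs depend on \<open>x - a\<close> only and are even or odd in it according to the order of the derivative.  So a
  derivative with respect to the point is, up to sign, a derivative with respect to the center.\<close>

lemma cutoff_swap: "cutoff a R w \<beta> x = (- 1) ^ mi_order \<beta> * cutoff x R w \<beta> a"
proof -
  have "plateau R w (\<beta> i) ((x - a) $ i) = (- 1) ^ \<beta> i * plateau R w (\<beta> i) ((a - x) $ i)" for i
    using plateau_even[of R w "\<beta> i" "(a - x) $ i"] by simp
  then show ?thesis
    unfolding cutoff_eq mi_order_def by (simp add: prod.distrib power_sum)
qed

lemma cutoff_bounded:
  obtains B where "B \<ge> 1" and "\<And>(a :: real ^ 'n::finite) R w \<beta> x. w > 0 \<Longrightarrow> mi_order \<beta> \<le> m \<Longrightarrow>
     \<bar>cutoff a R w \<beta> x\<bar> \<le> B * (1 / w) ^ mi_order \<beta>"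
proof -
  obtain B where B: "B \<ge> 1" and *: "\<And>R w k t. w > 0 \<Longrightarrow> k \<le> m \<Longrightarrow> \<bar>plateau R w k t\<bar> \<le> B * (1 / w) ^ k"
    using plateau_bounded by blast
  have main: "\<bar>cutoff a R w \<beta> x\<bar> \<le> B ^ CARD('n) * (1 / w) ^ mi_order \<beta>"
    if "w > 0" "mi_order \<beta> \<le> m" for a :: "real ^ 'n" and R w \<beta> x
  proof -
    have "\<bar>cutoff a R w \<beta> x\<bar> = (\<Prod>i\<in>UNIV. \<bar>plateau R w (\<beta> i) ((x - a) $ i)\<bar>)"
      unfolding cutoff_eq by (rule abs_prod)
    also have "\<dots> \<le> (\<Prod>i\<in>UNIV. B * (1 / w) ^ \<beta> i)"
      using that by (intro prod_mono conjI *) (auto intro: order.trans[OF le_mi_order])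
    also have "\<dots> = B ^ CARD('n) * (1 / w) ^ mi_order \<beta>"
      by (simp add: prod.distrib power_sum mi_order_def)
    finally show ?thesis .
  qed
  have "B ^ CARD('n) \<ge> 1" using B by simp
  then show ?thesis by (rule that[OF _ main])
qed

section \<open>Integration by parts\<close>

lemma integrable_vanish_outside_cube:
  fixes f :: "real ^ 'n::finite \<Rightarrow> real"
  assumes "continuous_on UNIV f" and "\<And>x. x \<notin> cube a r \<Longrightarrow> f x = 0"
  shows "integrable lborel f"
proof -
  have "integrable lborel (\<lambda>x. indicator (cube a r) x *\<^sub>R f x)"
    using assms(1) by (intro borel_integrable_compact) (auto intro: continuous_on_subset)
  moreover have "(\<lambda>x. indicator (cube a r) x *\<^sub>R f x) = f"
    using assms(2) by (auto simp: fun_eq_iff indicator_def)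
  ultimately show ?thesis by simp
qed

lemma integral_lborel_shift:
  fixes f :: "real ^ 'n::finite \<Rightarrow> real"
  assumes [measurable]: "f \<in> borel_measurable borel"
  shows "(\<integral>x. f (c + x) \<partial>lborel) = (\<integral>x. f x \<partial>lborel)"
  by (subst (2) lborel_distr_plus[of c, symmetric]) (simp add: integral_distr)

lemma integrable_lborel_shift:
  fixes f :: "real ^ 'n::finite \<Rightarrow> real"
  assumes f: "integrable lborel f"
  shows "integrable lborel (\<lambda>x. f (c + x))"
proof -
  have "integrable (distr lborel borel ((+) c)) f" using f by (simp add: lborel_distr_plus)
  moreover have "f \<in> borel_measurable borel" using f by auto
  ultimately show ?thesis by (subst (asm) integrable_distr_eq) auto
qed

text \<open>By translation invariance the integral of every difference quotient vanishes, and the difference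
  quotients converge boundedly on a fixed cube.  This gives integration by parts without iterated
  integrals.\<close>

lemma integral_partial_derivative_eq_0:
  fixes f :: "real ^ 'n::finite \<Rightarrow> real"
  assumes p: "pdiff f i f'" and cf: "continuous_on UNIV f" and cf': "continuous_on UNIV f'"
    and f0: "\<And>x. x \<notin> cube a r \<Longrightarrow> f x = 0" and f0': "\<And>x. x \<notin> cube a r \<Longrightarrow> f' x = 0"
  shows "(\<integral>x. f' x \<partial>lborel) = 0"
proof -
  define e where "e = (axis i 1 :: real ^ 'n)"
  have [measurable]: "f \<in> borel_measurable borel" "f' \<in> borel_measurable borel"
    using cf cf' by (auto intro: borel_measurable_continuous_onI)
  have intf: "integrable lborel f" by (rule integrable_vanish_outside_cube[OF cf f0])
  define D where "D n x = (f ((1 / real (Suc n)) *\<^sub>R e + x) - f x) * real (Suc n)" for n :: nat and x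
  have Dm: "D n \<in> borel_measurable lborel" for n unfolding D_def[abs_def] by measurable
  have D0: "(\<integral>x. D n x \<partial>lborel) = 0" for n
    unfolding D_def using intf by (subst integral_mult_left_zero)
      (simp_all add: integrable_lborel_shift integral_lborel_shift)
  have "bounded (f' ` cube a r)"
    by (intro compact_imp_bounded compact_continuous_image continuous_on_subset[OF cf']) auto
  then obtain B where "\<And>y. y \<in> f' ` cube a r \<Longrightarrow> norm y \<le> B"
    unfolding bounded_iff by blast
  then have B: "\<bar>f' x\<bar> \<le> max B 0" for x using f0'[of x] by (cases "x \<in> cube a r") force+
  have Dmvt: "\<exists>s. 0 < s \<and> s < 1 / real (Suc n) \<and> D n x = f' (x + s *\<^sub>R e)" for n x
  proof -
    have "\<exists>z. z > 0 \<and> z < 1 / real (Suc n) \<and> f (x + (1 / real (Suc n)) *\<^sub>R e) - f (x + 0 *\<^sub>R e)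
       = (1 / real (Suc n) - 0) * f' (x + z *\<^sub>R e)"
      by (rule MVT2) (auto simp: e_def intro: pdiff_line[OF p])
    then obtain z where z: "z > 0" "z < 1 / real (Suc n)"
      and eq: "f (x + (1 / real (Suc n)) *\<^sub>R e) - f x = (1 / real (Suc n)) * f' (x + z *\<^sub>R e)"
      by auto
    have "D n x = f' (x + z *\<^sub>R e)"
      using eq by (simp add: D_def add.commute del: of_nat_Suc)
    then show ?thesis using z by blast
  qed
  have lim: "(\<lambda>n. D n x) \<longlonglongrightarrow> f' x" for x
  proof -
    have "((\<lambda>t. f (x + t *\<^sub>R e)) has_real_derivative f' x) (at 0)"
      using p by (auto simp: pdiff_def e_def)
    then have "((\<lambda>h. (f (x + h *\<^sub>R e) - f x) / h) \<longlongrightarrow> f' x) (at 0)"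
      by (simp add: DERIV_def)
    moreover have "filterlim (\<lambda>n. 1 / real (Suc n)) (at 0) sequentially"
      using LIMSEQ_inverse_real_of_nat by (auto simp: filterlim_at inverse_eq_divide)
    ultimately have "((\<lambda>n. (f (x + (1 / real (Suc n)) *\<^sub>R e) - f x) / (1 / real (Suc n))) \<longlongrightarrow> f' x) sequentially"
      by (rule filterlim_compose)
    then show ?thesis by (simp add: D_def[abs_def] add.commute)
  qed
  have en: "infnorm (s *\<^sub>R e) \<le> 1" if "0 < s" "s < 1 / real (Suc n)" for s n
  proof -
    have "1 / real (Suc n) \<le> 1" by simp
    then have "s \<le> 1" using that by linarith
    then show ?thesis using that by (auto simp: infnorm_le_iff e_def axis_def)
  qed
  have bd: "norm (D n x) \<le> max B 0 * indicator (cube a (r + 1)) x" for n x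
  proof -
    obtain s where s: "0 < s" "s < 1 / real (Suc n)" "D n x = f' (x + s *\<^sub>R e)" using Dmvt by blast
    show ?thesis
    proof (cases "x \<in> cube a (r + 1)")
      case True
      then show ?thesis using B s by simp
    next
      case False
      have "infnorm (x - a) \<le> infnorm (x + s *\<^sub>R e - a) + infnorm (s *\<^sub>R e)"
        using infnorm_triangle[of "x + s *\<^sub>R e - a" "- (s *\<^sub>R e)"] by (simp add: infnorm_neg algebra_simps)
      then have "x + s *\<^sub>R e \<notin> cube a r" using False en[OF s(1,2)] by (auto simp: cube_def)
      then show ?thesis using s f0' False by simp
    qed
  qed
  have "integrable lborel (\<lambda>x. max B 0 * indicator (cube a (r + 1)) x)"
    using emeasure_lborel_cbox_finite[of "a - (\<chi> i. r + 1)" "a + (\<chi> i. r + 1)"]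
    by (auto simp: cube_eq_cbox intro!: integrable_real_indicator)
  then have "(\<lambda>n. \<integral>x. D n x \<partial>lborel) \<longlonglongrightarrow> (\<integral>x. f' x \<partial>lborel)"
    by (rule integral_dominated_convergence[rotated 2]) (use lim bd Dm in auto)
  then show ?thesis unfolding D0 by (simp add: LIMSEQ_const_iff)
qed

lemma lebesgue_borel_integral:
  fixes f :: "real ^ 'n::finite \<Rightarrow> real"
  assumes "f \<in> borel_measurable borel"
  shows "(\<integral>x. f x \<partial>lebesgue) = (\<integral>x. f x \<partial>lborel)"
  using assms by (simp add: integral_completion)

lemma lebesgue_borel_integrable:
  fixes f :: "real ^ 'n::finite \<Rightarrow> real"
  assumes "f \<in> borel_measurable borel"
  shows "integrable lebesgue f \<longleftrightarrow> integrable lborel f"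
  using assms by (simp add: integrable_completion)

lemma set_lebesgue_UNIV [simp]: "(LINT x:UNIV|M. f x) = (\<integral>x. (f x :: real) \<partial>M)"
  by (simp add: set_lebesgue_integral_def)

lemma bounded_subset_cube:
  assumes "bounded (S :: (real ^ 'n::finite) set)"
  obtains r where "r > 0" "S \<subseteq> cube 0 r"
proof -
  obtain B where B: "\<And>x. x \<in> S \<Longrightarrow> norm x \<le> B" using assms unfolding bounded_iff by blast
  have "S \<subseteq> cube 0 (\<bar>B\<bar> + 1)"
  proof
    fix x assume "x \<in> S"
    then have "norm x \<le> B" by (rule B)
    moreover have "infnorm x \<le> norm x" by (rule infnorm_le_norm)
    ultimately show "x \<in> cube 0 (\<bar>B\<bar> + 1)" by (auto simp: cube_def)
  qed
  then show ?thesis using that[of "\<bar>B\<bar> + 1"] by simp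
qed

lemma pdiff_vanish_open:
  assumes p: "pdiff f i f'" and W: "open W" and f0: "\<And>x. x \<in> W \<Longrightarrow> f x = 0" and x: "x \<in> W"
  shows "f' x = 0"
proof -
  have "((\<lambda>t. x + t *\<^sub>R axis i 1) \<longlongrightarrow> x + 0 *\<^sub>R axis i 1) (nhds (0::real))"
    by (intro tendsto_intros filterlim_ident)
  then have "\<forall>\<^sub>F t in nhds 0. x + t *\<^sub>R axis i 1 \<in> W"
    using W x by (intro topological_tendstoD) auto
  then have ev: "\<forall>\<^sub>F t in nhds 0. f (x + t *\<^sub>R axis i 1) = 0"
    by (rule eventually_mono) (use f0 in auto)
  have "((\<lambda>t. f (x + t *\<^sub>R axis i 1)) has_real_derivative f' x) (at 0)"
    using p by (simp add: pdiff_def)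
  then have "((\<lambda>_. 0) has_real_derivative f' x) (at (0::real))"
    using DERIV_cong_ev[OF refl ev refl] by simp
  then show ?thesis by (metis DERIV_const DERIV_unique)
qed

lemma jet_vanish_open:
  assumes U: "jet U" and W: "open W" and U0: "\<And>x. x \<in> W \<Longrightarrow> U zero_mi x = 0" and x: "x \<in> W"
  shows "U \<beta> x = 0"
proof -
  have "\<forall>x\<in>W. U \<beta> x = 0" if "mi_order \<beta> = k" for k \<beta>
    using that
  proof (induction k arbitrary: \<beta>)
    case 0
    then show ?case using U0 by (simp add: mi_order_eq_0_iff)
  next
    case (Suc k)
    then obtain \<gamma> i where "\<beta> = inc \<gamma> i" "mi_order \<gamma> = k" by (auto elim: mi_order_Suc_obtain)
    then show ?case using Suc.IH[of \<gamma>] pdiff_vanish_open[OF jet_pdiff[OF U] W] by blast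
  qed
  then show ?thesis using x by blast
qed

lemma jet_vanish_outside_cube:
  assumes "jet U" and "\<And>x. x \<notin> cube a r \<Longrightarrow> U zero_mi x = 0" and "x \<notin> cube a r"
  shows "U \<beta> x = 0"
  by (rule jet_vanish_open[OF assms(1), of "- cube a r"]) (use assms in auto)

lemma integration_by_parts:
  fixes f g :: "real ^ 'n::finite \<Rightarrow> real"
  assumes "pdiff f i f'" "pdiff g i g'"
    and "continuous_on UNIV f" "continuous_on UNIV f'" "continuous_on UNIV g" "continuous_on UNIV g'"
    and "\<And>x. x \<notin> cube a r \<Longrightarrow> g x = 0" "\<And>x. x \<notin> cube a r \<Longrightarrow> g' x = 0"
  shows "(\<integral>x. f' x * g x \<partial>lborel) = - (\<integral>x. f x * g' x \<partial>lborel)"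
proof -
  have "(\<integral>x. f' x * g x + f x * g' x \<partial>lborel) = 0"
    by (rule integral_partial_derivative_eq_0[OF pdiff_mult[OF assms(1,2)], where a = a and r = r])
      (use assms in \<open>auto intro!: continuous_intros\<close>)
  moreover have "integrable lborel (\<lambda>x. f' x * g x)" "integrable lborel (\<lambda>x. f x * g' x)"
    by (rule integrable_vanish_outside_cube[where a = a and r = r];
        use assms in \<open>auto intro!: continuous_intros\<close>)+
  ultimately show ?thesis by simp
qed

text \<open>Derivatives are moved from \<open>\<Phi>\<close> to \<open>G\<close> one at a time; the induction therefore has to speak of
  an arbitrary entry of \<open>G\<close>.\<close>

lemma jet_integration_by_parts:
  fixes G \<Phi> :: "'n::finite multiindex \<Rightarrow> real ^ 'n \<Rightarrow> real"
  assumes G: "jet G" and \<Phi>: "jet \<Phi>" and \<Phi>0: "\<And>x. x \<notin> cube a r \<Longrightarrow> \<Phi> zero_mi x = 0"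
  shows "(\<integral>x. G zero_mi x * \<Phi> \<beta> x \<partial>lborel) = (- 1) ^ mi_order \<beta> * (\<integral>x. G \<beta> x * \<Phi> zero_mi x \<partial>lborel)"
proof -
  have "(\<integral>x. G \<gamma> x * \<Phi> \<beta> x \<partial>lborel) = (- 1) ^ mi_order \<beta> * (\<integral>x. G (\<lambda>i. \<gamma> i + \<beta> i) x * \<Phi> zero_mi x \<partial>lborel)"
    if "mi_order \<beta> = k" for k \<beta> \<gamma>
    using that
  proof (induction k arbitrary: \<beta> \<gamma>)
    case 0
    then have "\<beta> = zero_mi" by (simp add: mi_order_eq_0_iff)
    then show ?case by simp
  next
    case (Suc k)
    then obtain \<delta> i where \<delta>: "\<beta> = inc \<delta> i" "mi_order \<delta> = k" by (auto elim: mi_order_Suc_obtain)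
    have "(\<integral>x. G (inc \<gamma> i) x * \<Phi> \<delta> x \<partial>lborel) = - (\<integral>x. G \<gamma> x * \<Phi> \<beta> x \<partial>lborel)"
      unfolding \<delta>(1)
      by (rule integration_by_parts[where a = a and r = r])
        (use G \<Phi> jet_vanish_outside_cube[OF \<Phi> \<Phi>0] in \<open>auto intro!: jet_pdiff jet_continuous\<close>)
    moreover have "(\<lambda>j. (inc \<gamma> i) j + \<delta> j) = (\<lambda>j. \<gamma> j + \<beta> j)"
      unfolding \<delta> by auto
    moreover have "(\<integral>x. G (inc \<gamma> i) x * \<Phi> \<delta> x \<partial>lborel)
        = (- 1) ^ k * (\<integral>x. G (\<lambda>j. (inc \<gamma> i) j + \<delta> j) x * \<Phi> zero_mi x \<partial>lborel)"
      by (rule Suc.IH[OF \<delta>(2), unfolded \<delta>(2)])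
    ultimately have "- (\<integral>x. G \<gamma> x * \<Phi> \<beta> x \<partial>lborel)
        = (- 1) ^ k * (\<integral>x. G (\<lambda>j. \<gamma> j + \<beta> j) x * \<Phi> zero_mi x \<partial>lborel)"
      by simp
    then show ?case using Suc.prems by simp
  qed
  from this[OF refl, of zero_mi] show ?thesis by simp
qed

section \<open>Weak derivatives\<close>

lemma locally_integrable_continuous:
  fixes f :: "real ^ 'n::finite \<Rightarrow> real"
  assumes "continuous_on UNIV f"
  shows "locally_integrable_on f UNIV"
  unfolding locally_integrable_on_def set_integrable_def
proof (intro allI impI)
  fix C :: "(real ^ 'n) set" assume C: "compact C \<and> C \<subseteq> UNIV"
  have "integrable lborel (\<lambda>x. indicat_real C x *\<^sub>R f x)"
    using assms C by (intro borel_integrable_compact) (auto intro: continuous_on_subset)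
  then show "integrable lebesgue (\<lambda>x. indicat_real C x *\<^sub>R f x)"
    by (subst lebesgue_borel_integrable) auto
qed

lemma jet_has_weak_deriv:
  fixes G :: "'n::finite multiindex \<Rightarrow> real ^ 'n \<Rightarrow> real"
  assumes G: "jet G"
  shows "has_weak_deriv UNIV \<beta> (G zero_mi) (G \<beta>)"
  unfolding has_weak_deriv_def
proof (intro conjI allI impI)
  show "locally_integrable_on (G zero_mi) UNIV" "locally_integrable_on (G \<beta>) UNIV"
    by (rule locally_integrable_continuous[OF jet_continuous[OF G]])+
next
  fix \<phi> and \<Phi> :: "'n multiindex \<Rightarrow> real ^ 'n \<Rightarrow> real"
  assume "smooth_jet \<phi> \<Phi> \<and> compact (closure {x. \<phi> x \<noteq> 0}) \<and> closure {x. \<phi> x \<noteq> 0} \<subseteq> UNIV"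
  then have \<Phi>: "jet \<Phi>" "\<phi> = \<Phi> zero_mi" and c: "compact (closure {x. \<phi> x \<noteq> 0})"
    by (auto simp: smooth_jet_iff)
  obtain r where "closure {x. \<phi> x \<noteq> 0} \<subseteq> cube 0 r"
    using bounded_subset_cube[OF compact_imp_bounded[OF c]] .
  then have 0: "\<Phi> zero_mi x = 0" if "x \<notin> cube 0 r" for x
    using that closure_subset[of "{x. \<phi> x \<noteq> 0}"] \<Phi>(2) by blast
  have "(\<integral>x. G zero_mi x * \<Phi> \<beta> x \<partial>lebesgue) = (\<integral>x. G zero_mi x * \<Phi> \<beta> x \<partial>lborel)"
    "(\<integral>x. G \<beta> x * \<phi> x \<partial>lebesgue) = (\<integral>x. G \<beta> x * \<phi> x \<partial>lborel)"
    unfolding \<Phi>(2)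
    by (rule lebesgue_borel_integral[OF borel_measurable_times[OF jet_borel[OF G] jet_borel[OF \<Phi>(1)]]])+
  then show "(LINT x:UNIV|lebesgue. G zero_mi x * \<Phi> \<beta> x)
       = (- 1) ^ mi_order \<beta> * (LINT x:UNIV|lebesgue. G \<beta> x * \<phi> x)"
    using jet_integration_by_parts[OF G \<Phi>(1) 0] by (simp add: \<Phi>(2))
qed

lemma test_function_cubeI:
  assumes \<Phi>: "jet \<Phi>" and "\<And>x. x \<notin> cube a r \<Longrightarrow> \<Phi> zero_mi x = 0"
  shows "smooth_jet (\<Phi> zero_mi) \<Phi> \<and> compact (closure {x. \<Phi> zero_mi x \<noteq> 0}) \<and> closure {x. \<Phi> zero_mi x \<noteq> 0} \<subseteq> UNIV"
proof -
  have "{x. \<Phi> zero_mi x \<noteq> 0} \<subseteq> cube a r" using assms by blast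
  then have "bounded {x. \<Phi> zero_mi x \<noteq> 0}" by (rule bounded_subset[rotated]) (simp add: compact_imp_bounded)
  then show ?thesis using \<Phi> by (auto simp: smooth_jet_iff compact_closure)
qed

lemma cutoff_test_function:
  assumes "R \<ge> 0" "w > 0"
  shows "smooth_jet (cutoff a R w zero_mi) (cutoff a R w) \<and> compact (closure {x. cutoff a R w zero_mi x \<noteq> 0})
     \<and> closure {x. cutoff a R w zero_mi x \<noteq> 0} \<subseteq> UNIV"
  by (rule test_function_cubeI[OF jet_cutoff, where a = a and r = "R + w"])
    (use assms in \<open>auto simp: cube_def intro: cutoff_outside\<close>)

text \<open>Tensor products of plateaus with shrinking transition width are test functions that converge to the
  indicator function of an open box.\<close>

lemma integral_box_eq_0_if_weakly_0:
  fixes h :: "real ^ 'n::finite \<Rightarrow> real"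
  assumes li: "locally_integrable_on h UNIV"
    and h0: "\<And>\<phi> \<Phi>. smooth_jet \<phi> \<Phi> \<Longrightarrow> compact (closure {x. \<phi> x \<noteq> 0}) \<Longrightarrow> (\<integral>x. h x * \<phi> x \<partial>lebesgue) = 0"
  shows "(\<integral>x. indicator (box a b) x * h x \<partial>lebesgue) = 0"
proof (cases "box a b = {}")
  case False
  then have ab: "a $ i < b $ i" for i by (auto simp: box_ne_empty(2) Basis_vec_def cart_eq_inner_axis)
  define r where "r i = (b $ i - a $ i) / 2" for i
  define c where "c = (\<chi> i. (a $ i + b $ i) / 2)"
  define d where "d = Min (range r)"
  have d1: "d > 0" unfolding d_def using ab by (auto simp: r_def)
  have d2: "d \<le> r i" for i unfolding d_def by (rule Min_le) auto
  note d = d1 d2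
  define w where "w n = d / real (Suc n)" for n
  have w: "w n > 0" "w n \<le> r i" for n i
  proof -
    show "w n > 0" using d by (simp add: w_def)
    have "w n \<le> d / 1" unfolding w_def using d by (intro divide_left_mono) auto
    then show "w n \<le> r i" using d(2)[of i] by simp
  qed
  have wlim: "w \<longlonglongrightarrow> 0"
    using tendsto_mult_right_zero[OF LIMSEQ_inverse_real_of_nat, of d]
    by (simp add: w_def[abs_def] divide_inverse)
  define \<Phi> where "\<Phi> n = tensor (\<lambda>i k t. plateau (r i - w n) (w n) k (t - c $ i))" for n
  have jet: "jet (\<Phi> n)" for n
    unfolding \<Phi>_def by (intro jet_tensor deriv_seq_shift deriv_seq_plateau)
  have "\<bar>x $ i - c $ i\<bar> < r i \<longleftrightarrow> a $ i < x $ i \<and> x $ i < b $ i"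
    "\<bar>x $ i - c $ i\<bar> \<le> r i \<longleftrightarrow> a $ i \<le> x $ i \<and> x $ i \<le> b $ i" for x :: "real ^ 'n" and i
    unfolding c_def r_def vec_lambda_beta by argo+
  then have box: "x \<in> box a b \<longleftrightarrow> (\<forall>i. \<bar>x $ i - c $ i\<bar> < r i)"
    and cbox: "x \<in> cbox a b \<longleftrightarrow> (\<forall>i. \<bar>x $ i - c $ i\<bar> \<le> r i)" for x
    by (simp_all add: mem_box_cart)
  have out: "\<Phi> n zero_mi x = 0" if "\<bar>x $ i - c $ i\<bar> \<ge> r i" for n x i
  proof -
    have "plateau (r i - w n) (w n) 0 (x $ i - c $ i) = 0"
      using that w by (intro plateau_outside) auto
    then show ?thesis unfolding \<Phi>_def tensor_def by (intro prod_zero) auto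
  qed
  have rng: "0 \<le> \<Phi> n zero_mi x \<and> \<Phi> n zero_mi x \<le> 1" for n x
    unfolding \<Phi>_def tensor_def using plateau_range[of "r _ - w n" "w n"] w
    by (auto intro!: prod_nonneg prod_le_1)
  have "closure {x. \<Phi> n zero_mi x \<noteq> 0} \<subseteq> cbox a b" for n
    using out cbox by (intro closure_minimal) (auto, meson linear)
  then have comp: "compact (closure {x. \<Phi> n zero_mi x \<noteq> 0})" for n
    using compact_closure bounded_cbox bounded_subset closure_subset by (metis (no_types, lifting))
  have 0: "(\<integral>x. h x * \<Phi> n zero_mi x \<partial>lebesgue) = 0" for n
    by (rule h0[of _ "\<Phi> n"]) (use jet comp in \<open>auto simp: smooth_jet_iff\<close>)
  have lim: "(\<lambda>n. \<Phi> n zero_mi x) \<longlonglongrightarrow> indicator (box a b) x" for x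
  proof (cases "x \<in> box a b")
    case True
    have "\<forall>\<^sub>F n in sequentially. \<forall>i. \<bar>x $ i - c $ i\<bar> \<le> r i - w n"
    proof (rule eventually_all_finite)
      fix i
      have "\<bar>x $ i - c $ i\<bar> < r i" using True box by blast
      then have "\<forall>\<^sub>F n in sequentially. w n < r i - \<bar>x $ i - c $ i\<bar>"
        using wlim by (intro order_tendstoD(2)[OF wlim]) auto
      then show "\<forall>\<^sub>F n in sequentially. \<bar>x $ i - c $ i\<bar> \<le> r i - w n"
        by (rule eventually_mono) auto
    qed
    then have "\<forall>\<^sub>F n in sequentially. \<Phi> n zero_mi x = 1"
    proof (rule eventually_mono)
      fix n assume *: "\<forall>i. \<bar>x $ i - c $ i\<bar> \<le> r i - w n"
      have "plateau (r i - w n) (w n) 0 (x $ i - c $ i) = 1" for i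
        using * w by (subst plateau_inside) auto
      then show "\<Phi> n zero_mi x = 1" by (simp add: \<Phi>_def tensor_def)
    qed
    then show ?thesis using True by (simp add: tendsto_eventually)
  next
    case False
    then obtain i where "\<bar>x $ i - c $ i\<bar> \<ge> r i" unfolding box by (auto simp: not_less)
    then show ?thesis using out False by simp
  qed
  have hm: "set_integrable lebesgue (cbox a b) h"
    using li by (auto simp: locally_integrable_on_def)
  have "(\<lambda>n. \<integral>x. h x * \<Phi> n zero_mi x \<partial>lebesgue) \<longlonglongrightarrow> (\<integral>x. indicator (box a b) x * h x \<partial>lebesgue)"
  proof (rule integral_dominated_convergence)
    let ?H = "\<lambda>x. indicator (cbox a b) x *\<^sub>R h x"
    have H: "integrable lebesgue ?H" using hm by (simp add: set_integrable_def)
    show "integrable lebesgue (\<lambda>x. \<bar>?H x\<bar>)" using H by (rule integrable_abs)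
    have [measurable]: "?H \<in> borel_measurable lebesgue" using H by (rule borel_measurable_integrable)
    have "(\<lambda>x. indicator (box a b) x * ?H x) \<in> borel_measurable lebesgue"
      by (rule borel_measurable_times[OF borel_measurable_indicator borel_measurable_integrable[OF H]]) auto
    moreover have "(\<lambda>x. indicator (box a b) x * ?H x) = (\<lambda>x. indicator (box a b) x * h x)"
      using box_subset_cbox[of a b] by (auto simp: fun_eq_iff indicator_def)
    ultimately show "(\<lambda>x. indicator (box a b) x * h x) \<in> borel_measurable lebesgue" by simp
    fix n
    have eq: "(\<lambda>x. h x * \<Phi> n zero_mi x) = (\<lambda>x. ?H x * \<Phi> n zero_mi x)"
    proof
      fix x show "h x * \<Phi> n zero_mi x = ?H x * \<Phi> n zero_mi x"
      proof (cases "x \<in> cbox a b")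
        case False
        then obtain i where "\<bar>x $ i - c $ i\<bar> > r i" unfolding cbox by (auto simp: not_le)
        then have "\<bar>x $ i - c $ i\<bar> \<ge> r i" by simp
        then show ?thesis using out by simp
      qed simp
    qed
    have "\<Phi> n zero_mi \<in> borel_measurable lebesgue"
      using jet_borel[OF jet] by (simp add: measurable_completion)
    then show "(\<lambda>x. h x * \<Phi> n zero_mi x) \<in> borel_measurable lebesgue"
      unfolding eq by (intro borel_measurable_times borel_measurable_integrable[OF H])
    show "AE x in lebesgue. norm (h x * \<Phi> n zero_mi x) \<le> \<bar>?H x\<bar>"
    proof (rule AE_I2)
      fix x
      have "\<bar>?H x\<bar> * \<bar>\<Phi> n zero_mi x\<bar> \<le> \<bar>?H x\<bar> * 1" using rng[of n x] by (intro mult_left_mono) auto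
      then show "norm (h x * \<Phi> n zero_mi x) \<le> \<bar>?H x\<bar>"
        using fun_cong[OF eq, of x] by (metis abs_mult mult.right_neutral real_norm_def)
    qed
  next
    show "AE x in lebesgue. (\<lambda>n. h x * \<Phi> n zero_mi x) \<longlonglongrightarrow> indicator (box a b) x * h x"
      using lim by (auto intro!: AE_I2 tendsto_eq_intros)
  qed
  then show ?thesis unfolding 0 by (simp add: LIMSEQ_const_iff)
qed simp

text \<open>Boxes are stable under intersection and generate the Borel sets, so the integral vanishes over every
  Borel set.\<close>

lemma AE_eq_0_if_box_integrals_0:
  fixes k :: "real ^ 'n::finite \<Rightarrow> real"
  assumes k: "integrable lborel k" and b: "\<And>a b. (\<integral>x. indicator (box a b) x * k x \<partial>lborel) = 0"
    and out: "\<And>x. x \<notin> box c d \<Longrightarrow> k x = 0"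
  shows "AE x in lborel. k x = 0"
proof (rule density_unique_real[OF k])
  show "integrable lborel (\<lambda>x. 0 :: real)" by simp
  have k0: "(\<integral>x. k x \<partial>lborel) = 0"
  proof -
    have "(\<lambda>x. indicator (box c d) x * k x) = k" using out by (auto simp: fun_eq_iff indicator_def)
    then show ?thesis using b[of c d] by simp
  qed
  fix A :: "(real ^ 'n) set" assume "A \<in> sets lborel"
  then have A: "A \<in> sigma_sets UNIV (range (\<lambda>(a, b). box a b))"
    by (simp add: borel_eq_box)
  have int: "integrable lborel (\<lambda>x. indicator A x * k x)" if "A \<in> sets borel" for A
    using integrable_mult_indicator[of A lborel k] that k by simp
  have "Int_stable (range (\<lambda>(a, b). box a b :: (real ^ 'n) set))"
    by (auto simp: Int_stable_def box_Int_box)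
  moreover have "(range (\<lambda>(a, b). box a b :: (real ^ 'n) set)) \<subseteq> Pow UNIV" by auto
  ultimately have "(\<integral>x. indicator A x * k x \<partial>lborel) = 0"
    using A
  proof (induction rule: sigma_sets_induct_disjoint)
    case (basic A)
    then show ?case using b by auto
  next
    case empty
    then show ?case by simp
  next
    case (compl A)
    then have "A \<in> sets borel" by (simp add: borel_eq_box)
    moreover have "(\<lambda>x. indicator (UNIV - A) x * k x) = (\<lambda>x. k x - indicator A x * k x)"
      by (auto simp: fun_eq_iff indicator_def)
    ultimately show ?case using compl.IH k0 k int by simp
  next
    case (union F)
    then have F: "\<And>i. F i \<in> sets borel" by (simp add: borel_eq_box subset_eq)
    have "(\<lambda>n. \<integral>x. (\<Sum>i<n. indicator (F i) x) * k x \<partial>lborel) \<longlonglongrightarrow> (\<integral>x. indicator (\<Union>i. F i) x * k x \<partial>lborel)"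
    proof (rule integral_dominated_convergence[where w = "\<lambda>x. \<bar>k x\<bar>"])
      show "integrable lborel (\<lambda>x. \<bar>k x\<bar>)" using k by simp
      have [measurable]: "k \<in> borel_measurable borel" using k by auto
      have [measurable]: "\<And>i. F i \<in> sets borel" by (rule F)
      show "(\<lambda>x. indicator (\<Union>i. F i) x * k x) \<in> borel_measurable lborel" by measurable
      show "(\<lambda>x. (\<Sum>i<n. indicator (F i) x) * k x) \<in> borel_measurable lborel" for n by measurable
      have ind: "(\<Sum>i<n. indicator (F i) x) = (indicator (\<Union>i<n. F i) x :: real)" for n x
        using union.hyps(1) by (intro indicator_UN_disjoint[symmetric] finite_lessThan)
          (auto simp: disjoint_family_on_def)
      have le: "0 \<le> (\<Sum>i<n. indicator (F i) x :: real) \<and> (\<Sum>i<n. indicator (F i) x) \<le> (1 :: real)" for n x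
        unfolding ind by (simp only: indicator_pos_le indicator_le_1 simp_thms)
      show "AE x in lborel. norm ((\<Sum>i<n. indicator (F i) x) * k x) \<le> \<bar>k x\<bar>" for n
        using le by (auto simp: abs_mult intro!: AE_I2 mult_left_le_one_le)
      have "(\<lambda>n. (\<Sum>i<n. indicator (F i) x)) \<longlonglongrightarrow> (indicator (\<Union>i. F i) x :: real)" for x
        unfolding ind by (rule LIMSEQ_indicator_UN)
      then show "AE x in lborel. (\<lambda>n. (\<Sum>i<n. indicator (F i) x) * k x) \<longlonglongrightarrow> indicator (\<Union>i. F i) x * k x"
        by (auto intro!: AE_I2 tendsto_intros)
    qed
    moreover have "(\<integral>x. (\<Sum>i<n. indicator (F i) x) * k x \<partial>lborel) = 0" for n
      unfolding sum_distrib_right using union.IH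
      by (subst Bochner_Integration.integral_sum[OF int[OF F]]) simp
    ultimately show ?case by (simp add: LIMSEQ_const_iff)
  qed
  then show "(LINT x:A|lborel. k x) = (LINT x:A|lborel. 0)"
    by (simp add: set_lebesgue_integral_def)
qed

lemma AE_eq_0_if_weakly_0:
  fixes h :: "real ^ 'n::finite \<Rightarrow> real"
  assumes li: "locally_integrable_on h UNIV"
    and h0: "\<And>\<phi> \<Phi>. smooth_jet \<phi> \<Phi> \<Longrightarrow> compact (closure {x. \<phi> x \<noteq> 0}) \<Longrightarrow> (\<integral>x. h x * \<phi> x \<partial>lebesgue) = 0"
  shows "AE x in lebesgue. h x = 0"
proof -
  have "AE x in lebesgue. infnorm x < real n \<longrightarrow> h x = 0" for n :: nat
  proof -
    define c :: "real ^ 'n" where "c = (\<chi> i. - real n)"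
    define d :: "real ^ 'n" where "d = (\<chi> i. real n)"
    let ?B = "box c d"
    have "integrable lebesgue (\<lambda>x. indicator (cbox c d) x *\<^sub>R h x)"
      using li by (auto simp: locally_integrable_on_def set_integrable_def)
    then have "integrable lebesgue (\<lambda>x. indicator ?B x *\<^sub>R (indicator (cbox c d) x *\<^sub>R h x))"
      by (rule integrable_mult_indicator[rotated]) auto
    moreover have "(\<lambda>x. indicator ?B x *\<^sub>R (indicator (cbox c d) x *\<^sub>R h x)) = (\<lambda>x. indicator ?B x * h x)"
      using box_subset_cbox[of c d] by (auto simp: fun_eq_iff indicator_def)
    ultimately have hi: "integrable lebesgue (\<lambda>x. indicator ?B x * h x)" by simp
    then obtain k0 where k0: "k0 \<in> borel_measurable lborel" "AE x in lborel. indicator ?B x * h x = k0 x"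
      using completion_ex_borel_measurable_real[OF borel_measurable_integrable] by blast
    define k where "k x = indicator ?B x * k0 x" for x
    have [measurable]: "k0 \<in> borel_measurable borel" using k0 by simp
    have km: "k \<in> borel_measurable borel" unfolding k_def[abs_def] by measurable
    have ae: "AE x in lebesgue. indicator ?B x * h x = k x"
      using AE_completion[OF k0(2)] by (rule AE_mp) (auto intro!: AE_I2 simp: k_def indicator_def)
    have ki: "integrable lborel k"
    proof -
      have "k \<in> borel_measurable lebesgue" using km by (simp add: measurable_completion)
      then have "integrable lebesgue k"
        by (rule integrable_cong_AE_imp[OF hi]) (use ae in \<open>auto elim!: AE_mp intro!: AE_I2\<close>)
      then show ?thesis using lebesgue_borel_integrable[OF km] by blast
    qed
    have "AE x in lborel. k x = 0"
    proof (rule AE_eq_0_if_box_integrals_0[OF ki])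
      show "\<And>x. x \<notin> ?B \<Longrightarrow> k x = 0" by (simp add: k_def)
      fix a b :: "real ^ 'n"
      obtain a' b' where ab': "box a b \<inter> ?B = box a' b'" using box_Int_box by blast
      have "(\<integral>x. indicator (box a b) x * k x \<partial>lborel) = (\<integral>x. indicator (box a b) x * k x \<partial>lebesgue)"
        using km by (intro lebesgue_borel_integral[symmetric]) measurable
      also have "\<dots> = (\<integral>x. indicator (box a' b') x * h x \<partial>lebesgue)"
      proof (rule integral_cong_AE)
        show "(\<lambda>x. indicator (box a b) x * k x) \<in> borel_measurable lebesgue"
          using km by (intro borel_measurable_times borel_measurable_indicator) (auto intro: measurable_completion)
        have "(\<lambda>x. indicator (box a b) x * (indicator ?B x * h x)) \<in> borel_measurable lebesgue"
          by (rule borel_measurable_times[OF borel_measurable_indicator borel_measurable_integrable[OF hi]]) auto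
        moreover have "(\<lambda>x. indicator (box a b) x * (indicator ?B x * h x)) = (\<lambda>x. indicator (box a' b') x * h x)"
          unfolding ab'[symmetric] by (auto simp: indicator_def fun_eq_iff)
        ultimately show "(\<lambda>x. indicator (box a' b') x * h x) \<in> borel_measurable lebesgue" by simp
        show "AE x in lebesgue. indicator (box a b) x * k x = indicator (box a' b') x * h x"
          using ae by (rule AE_mp) (auto intro!: AE_I2 simp: ab'[symmetric] indicator_def)
      qed
      also have "\<dots> = 0" by (rule integral_box_eq_0_if_weakly_0[OF li h0])
      finally show "(\<integral>x. indicator (box a b) x * k x \<partial>lborel) = 0" .
    qed
    then have "AE x in lebesgue. k x = 0" by (rule AE_completion)
    have "x \<in> ?B" if "infnorm x < real n" for x
      using that component_le_infnorm_cart[of x]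
      by (auto simp: mem_box_cart c_def d_def) (smt (verit) abs_le_iff)+
    note inB = this
    from \<open>AE x in lebesgue. k x = 0\<close> ae show ?thesis
    proof eventually_elim
      case (elim x)
      then show ?case using inB[of x] by (auto simp: indicator_def split: if_splits)
    qed
  qed
  then have "AE x in lebesgue. \<forall>n::nat. infnorm x < real n \<longrightarrow> h x = 0"
    by (subst AE_all_countable) blast
  then show ?thesis
    by (rule AE_mp) (auto intro!: AE_I2 simp: reals_Archimedean2)
qed

text \<open>The seminorm is computed from an arbitrarily chosen weak derivative.  Uniqueness up to null sets shows
  that any known weak derivative may be used in its place.\<close>

lemma weak_deriv_unique:
  fixes f :: "real ^ 'n::finite \<Rightarrow> real"
  assumes 1: "has_weak_deriv UNIV \<beta> f g1" and 2: "has_weak_deriv UNIV \<beta> f g2"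
  shows "AE x in lebesgue. g1 x = g2 x"
proof -
  have li: "locally_integrable_on g1 UNIV" "locally_integrable_on g2 UNIV"
    using 1 2 by (auto simp: has_weak_deriv_def)
  have "AE x in lebesgue. g1 x - g2 x = 0"
  proof (rule AE_eq_0_if_weakly_0)
    show "locally_integrable_on (\<lambda>x. g1 x - g2 x) UNIV"
      using li unfolding locally_integrable_on_def by (auto intro: set_integral_diff)
    fix \<phi> :: "real ^ 'n \<Rightarrow> real" and \<Phi> assume \<phi>: "smooth_jet \<phi> \<Phi>" "compact (closure {x. \<phi> x \<noteq> 0})"
    let ?C = "closure {x. \<phi> x \<noteq> 0}"
    have \<phi>c: "continuous_on S \<phi>" for S using \<phi>(1) by (auto simp: smooth_jet_iff jet_continuous)
    obtain B where B: "\<And>x. x \<in> ?C \<Longrightarrow> \<bar>\<phi> x\<bar> \<le> B"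
      using compact_imp_bounded[OF compact_continuous_image[OF \<phi>c \<phi>(2)]] unfolding bounded_iff by auto
    have B': "\<bar>\<phi> x\<bar> \<le> max B 0" for x
      using B[of x] closure_subset[of "{x. \<phi> x \<noteq> 0}"] by (cases "\<phi> x = 0") force+
    have int: "integrable lebesgue (\<lambda>x. g x * \<phi> x)" if "locally_integrable_on g UNIV" for g
    proof (rule Bochner_Integration.integrable_bound)
      have i: "integrable lebesgue (\<lambda>x. indicator ?C x *\<^sub>R g x)"
        using that \<phi>(2) by (auto simp: locally_integrable_on_def set_integrable_def)
      then show "integrable lebesgue (\<lambda>x. max B 0 * (indicator ?C x *\<^sub>R g x))" by simp
      have eq: "(\<lambda>x. g x * \<phi> x) = (\<lambda>x. (indicator ?C x *\<^sub>R g x) * \<phi> x)"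
      proof
        fix x show "g x * \<phi> x = (indicator ?C x *\<^sub>R g x) * \<phi> x"
          using closure_subset[of "{x. \<phi> x \<noteq> 0}"] by (cases "\<phi> x = 0") auto
      qed
      have "\<phi> \<in> borel_measurable lebesgue"
        using borel_measurable_continuous_onI[OF \<phi>c] by (simp add: measurable_completion)
      then show "(\<lambda>x. g x * \<phi> x) \<in> borel_measurable lebesgue"
        unfolding eq by (intro borel_measurable_times borel_measurable_integrable[OF i])
      show "AE x in lebesgue. norm (g x * \<phi> x) \<le> norm (max B 0 * (indicator ?C x *\<^sub>R g x))"
      proof (rule AE_I2)
        fix x
        have "norm (g x * \<phi> x) = \<bar>\<phi> x\<bar> * \<bar>indicator ?C x *\<^sub>R g x\<bar>"
          by (rule trans[OF arg_cong[OF fun_cong[OF eq, of x], of norm]])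
            (simp only: real_norm_def abs_mult mult.commute)
        also have "\<dots> \<le> max B 0 * \<bar>indicator ?C x *\<^sub>R g x\<bar>" using B' by (intro mult_right_mono) auto
        finally show "norm (g x * \<phi> x) \<le> norm (max B 0 * (indicator ?C x *\<^sub>R g x))" by (simp add: abs_mult)
      qed
    qed
    have "(- 1) ^ mi_order \<beta> * (\<integral>x. g1 x * \<phi> x \<partial>lebesgue) = (- 1) ^ mi_order \<beta> * (\<integral>x. g2 x * \<phi> x \<partial>lebesgue)"
    proof -
      have w: "(\<integral>x. f x * \<Phi> \<beta> x \<partial>lebesgue) = (- 1) ^ mi_order \<beta> * (\<integral>x. g x * \<phi> x \<partial>lebesgue)"
        if "has_weak_deriv UNIV \<beta> f g" for g
        using that \<phi> unfolding has_weak_deriv_def set_lebesgue_UNIV by blast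
      show ?thesis using w[OF 1] w[OF 2] by simp
    qed
    then have "(\<integral>x. g1 x * \<phi> x \<partial>lebesgue) = (\<integral>x. g2 x * \<phi> x \<partial>lebesgue)" by simp
    then show "(\<integral>x. (g1 x - g2 x) * \<phi> x \<partial>lebesgue) = 0"
      using int li by (simp add: left_diff_distrib)
  qed
  then show ?thesis by simp
qed

section \<open>The energy of a smooth function\<close>

text \<open>The integrand of the squared Sobolev seminorm, for smooth functions.\<close>

definition edens :: "nat \<Rightarrow> ('n::finite multiindex \<Rightarrow> real ^ 'n \<Rightarrow> real) \<Rightarrow> real ^ 'n \<Rightarrow> real" where
  "edens m U x = (\<Sum>\<beta> | mi_order \<beta> = m. fact m / mi_fact \<beta> * (U \<beta> x)\<^sup>2)"

definition finite_energy :: "nat \<Rightarrow> ('n::finite multiindex \<Rightarrow> real ^ 'n \<Rightarrow> real) \<Rightarrow> bool" where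
  "finite_energy m U \<longleftrightarrow> integrable lborel (edens m U)"

definition energy :: "nat \<Rightarrow> ('n::finite multiindex \<Rightarrow> real ^ 'n \<Rightarrow> real) \<Rightarrow> real" where
  "energy m U = (\<integral>x. edens m U x \<partial>lborel)"

lemma mi_fact_pos: "mi_fact \<beta> > 0"
  unfolding mi_fact_def by (intro prod_pos) auto

lemma mi_fact_nonneg: "mi_fact \<beta> \<ge> 0"
  using mi_fact_pos[of \<beta>] by simp

lemma mi_fact_le: "mi_fact \<beta> \<le> fact (mi_order \<beta>)"
proof -
  have "finite A \<Longrightarrow> (\<Prod>i\<in>A. fact (\<beta> i) :: real) \<le> fact (\<Sum>i\<in>A. \<beta> i)" for A
  proof (induction A rule: finite_induct)
    case (insert x A)
    have "(fact (\<beta> x) :: nat) * fact (sum \<beta> A) \<le> fact (\<beta> x + sum \<beta> A)"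
      by (intro dvd_imp_le fact_fact_dvd_fact) auto
    then have "(fact (\<beta> x) :: real) * fact (sum \<beta> A) \<le> fact (\<beta> x + sum \<beta> A)"
      by (metis of_nat_fact of_nat_le_iff of_nat_mult)
    moreover have "(fact (\<beta> x) :: real) * (\<Prod>i\<in>A. fact (\<beta> i)) \<le> fact (\<beta> x) * fact (sum \<beta> A)"
      using insert.IH by (intro mult_left_mono) auto
    ultimately have "(fact (\<beta> x) :: real) * (\<Prod>i\<in>A. fact (\<beta> i)) \<le> fact (\<beta> x + sum \<beta> A)"
      by (rule order.trans[rotated])
    then show ?case unfolding prod.insert[OF insert.hyps] sum.insert[OF insert.hyps] .
  qed simp
  then show ?thesis by (simp add: mi_fact_def mi_order_def)
qed

text \<open>The coefficients of the energy are at least one, so that each derivative of order \<open>m\<close> is bounded by the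
  energy density.\<close>

lemma energy_coeff_ge1: "mi_order \<beta> = m \<Longrightarrow> fact m / mi_fact \<beta> \<ge> 1"
  using mi_fact_le[of \<beta>] mi_fact_pos[of \<beta>] by (simp add: le_divide_eq)

lemma edens_nonneg [simp]: "edens m U x \<ge> 0"
  unfolding edens_def by (intro sum_nonneg mult_nonneg_nonneg divide_nonneg_nonneg mi_fact_nonneg) auto

lemma energy_nonneg [simp]: "energy m U \<ge> 0"
  unfolding energy_def by simp

lemma sq_le_edens:
  assumes "mi_order \<beta> = m"
  shows "(U \<beta> x)\<^sup>2 \<le> edens m U x"
proof -
  have "(U \<beta> x)\<^sup>2 \<le> fact m / mi_fact \<beta> * (U \<beta> x)\<^sup>2"
    using energy_coeff_ge1[OF assms] mult_right_mono[of 1 "fact m / mi_fact \<beta>" "(U \<beta> x)\<^sup>2"] by simp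
  also have "\<dots> \<le> edens m U x"
    unfolding edens_def using assms
    by (intro member_le_sum) (auto intro!: mult_nonneg_nonneg divide_nonneg_nonneg mi_fact_nonneg)
  finally show ?thesis .
qed

lemma continuous_edens: "jet U \<Longrightarrow> continuous_on S (edens m U)"
  unfolding edens_def by (intro continuous_intros jet_continuous)

lemma edens_borel: "jet U \<Longrightarrow> edens m U \<in> borel_measurable borel"
  by (intro borel_measurable_continuous_onI continuous_edens)

lemma finite_energy_iff:
  assumes U: "jet U"
  shows "finite_energy m U \<longleftrightarrow> (\<forall>\<beta>. mi_order \<beta> = m \<longrightarrow> integrable lborel (\<lambda>x. (U \<beta> x)\<^sup>2))"
proof
  assume *: "finite_energy m U"
  show "\<forall>\<beta>. mi_order \<beta> = m \<longrightarrow> integrable lborel (\<lambda>x. (U \<beta> x)\<^sup>2)"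
  proof (intro allI impI)
    fix \<beta> :: "'a multiindex" assume \<beta>: "mi_order \<beta> = m"
    show "integrable lborel (\<lambda>x. (U \<beta> x)\<^sup>2)"
    proof (rule Bochner_Integration.integrable_bound[OF *[unfolded finite_energy_def]])
      show "(\<lambda>x. (U \<beta> x)\<^sup>2) \<in> borel_measurable lborel"
        using jet_borel[OF U, of \<beta>] by simp
      show "AE x in lborel. norm ((U \<beta> x)\<^sup>2) \<le> norm (edens m U x)"
        using sq_le_edens[OF \<beta>] by simp
    qed
  qed
next
  assume "\<forall>\<beta>. mi_order \<beta> = m \<longrightarrow> integrable lborel (\<lambda>x. (U \<beta> x)\<^sup>2)"
  then show "finite_energy m U"
    unfolding finite_energy_def edens_def by (intro Bochner_Integration.integrable_sum integrable_mult_right) auto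
qed

lemma energy_eq_sum:
  assumes U: "jet U" "finite_energy m U"
  shows "energy m U = (\<Sum>\<beta> | mi_order \<beta> = m. fact m / mi_fact \<beta> * (\<integral>x. (U \<beta> x)\<^sup>2 \<partial>lborel))"
  using U unfolding energy_def edens_def finite_energy_iff[OF U(1)]
  by (subst Bochner_Integration.integral_sum) auto

lemma locally_integrable_measurable:
  fixes g :: "real ^ 'n::finite \<Rightarrow> real"
  assumes "locally_integrable_on g UNIV"
  shows "g \<in> borel_measurable lebesgue"
proof (rule borel_measurable_LIMSEQ_real)
  fix i :: nat
  have "integrable lebesgue (\<lambda>x. indicator (cube 0 (real i)) x *\<^sub>R g x)"
    using assms by (auto simp: locally_integrable_on_def set_integrable_def)
  then show "(\<lambda>x. indicator (cube 0 (real i)) x *\<^sub>R g x) \<in> borel_measurable lebesgue"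
    by (rule borel_measurable_integrable)
next
  fix x :: "real ^ 'n"
  obtain n :: nat where n: "infnorm x \<le> real n" using real_arch_simple by blast
  have "\<forall>\<^sub>F i in sequentially. indicator (cube 0 (real i)) x *\<^sub>R g x = g x"
    using eventually_ge_at_top[of n] by eventually_elim (use n in \<open>auto simp: cube_def\<close>)
  then show "(\<lambda>i. indicator (cube 0 (real i)) x *\<^sub>R g x) \<longlonglongrightarrow> g x"
    by (rule tendsto_eventually)
qed

lemma has_weak_deriv_measurable: "has_weak_deriv UNIV \<beta> f g \<Longrightarrow> g \<in> borel_measurable lebesgue"
  by (intro locally_integrable_measurable) (auto simp: has_weak_deriv_def)

lemma weak_D_integral:
  fixes f :: "real ^ 'n::finite \<Rightarrow> real"
  assumes g: "has_weak_deriv UNIV \<beta> f g"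
  shows "(LINT x:UNIV|lebesgue. \<bar>weak_D UNIV \<beta> f x\<bar>\<^sup>2) = (\<integral>x. (g x)\<^sup>2 \<partial>lebesgue)"
proof -
  have w: "has_weak_deriv UNIV \<beta> f (weak_D UNIV \<beta> f)"
    unfolding weak_D_def by (rule someI[where P = "has_weak_deriv UNIV \<beta> f", OF g])
  have m: "weak_D UNIV \<beta> f \<in> borel_measurable lebesgue" "g \<in> borel_measurable lebesgue"
    using w g by (blast intro: has_weak_deriv_measurable)+
  have "(\<integral>x. (weak_D UNIV \<beta> f x)\<^sup>2 \<partial>lebesgue) = (\<integral>x. (g x)\<^sup>2 \<partial>lebesgue)"
    by (rule integral_cong_AE) (use m weak_deriv_unique[OF w g] in \<open>auto intro!: borel_measurable_power\<close>)
  then show ?thesis by simp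
qed

text \<open>For smooth functions the energy is the square of the Sobolev seminorm.  Through this lemma smooth
  functions are competitors in the minimization that defines Lagrange functions.\<close>

lemma jet_homog_sobolev:
  fixes U :: "'n::finite multiindex \<Rightarrow> real ^ 'n \<Rightarrow> real"
  assumes U: "jet U" "finite_energy m U"
  shows "U zero_mi \<in> homog_sobolev m" and "(sobolev_seminorm m UNIV (U zero_mi))\<^sup>2 = energy m U"
proof -
  have w: "has_weak_deriv UNIV \<beta> (U zero_mi) (U \<beta>)" for \<beta>
    by (rule jet_has_weak_deriv[OF U(1)])
  have b: "(\<lambda>x. (U \<beta> x)\<^sup>2) \<in> borel_measurable borel" for \<beta>
    using jet_borel[OF U(1), of \<beta>] by simp
  show "U zero_mi \<in> homog_sobolev m"
    unfolding homog_sobolev_def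
  proof (intro CollectI conjI allI impI)
    show "continuous_on UNIV (U zero_mi)" by (rule jet_continuous[OF U(1)])
    fix \<beta> :: "'n multiindex" assume "mi_order \<beta> = m"
    then have "integrable lborel (\<lambda>x. (U \<beta> x)\<^sup>2)" using U finite_energy_iff by blast
    then have "integrable lebesgue (\<lambda>x. \<bar>U \<beta> x\<bar>\<^sup>2)" using lebesgue_borel_integrable[OF b] by simp
    then show "\<exists>g. has_weak_deriv UNIV \<beta> (U zero_mi) g \<and> integrable lebesgue (\<lambda>x. \<bar>g x\<bar>\<^sup>2)"
      using w by blast
  qed
  have eq: "(\<Sum>\<beta> | mi_order \<beta> = m. fact m / mi_fact \<beta> *
             (LINT x:UNIV|lebesgue. \<bar>weak_D UNIV \<beta> (U zero_mi) x\<bar>\<^sup>2)) = energy m U"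
    unfolding energy_eq_sum[OF U] weak_D_integral[OF w] lebesgue_borel_integral[OF b] ..
  show "(sobolev_seminorm m UNIV (U zero_mi))\<^sup>2 = energy m U"
    unfolding sobolev_seminorm_def eq by simp
qed

section \<open>Mollification\<close>

definition moll_mass :: "'n::finite itself \<Rightarrow> real \<Rightarrow> real" where
  "moll_mass _ h = (\<integral>y. cutoff (0 :: real ^ 'n) h h zero_mi y \<partial>lborel)"

text \<open>Convolution of \<open>f\<close> with a normalized cutoff of radius \<open>2 * h\<close>; its jet is obtained by differentiating the
  kernel.\<close>

definition mollify :: "(real ^ 'n::finite \<Rightarrow> real) \<Rightarrow> real \<Rightarrow> 'n multiindex \<Rightarrow> real ^ 'n \<Rightarrow> real" where
  "mollify f h \<beta> x = 1 / moll_mass TYPE('n) h * (\<integral>y. f y * cutoff y h h \<beta> x \<partial>lborel)"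

lemma cutoff_integrable:
  assumes "h > 0" shows "integrable lborel (cutoff (a :: real ^ 'n::finite) h h \<beta>)"
  by (rule integrable_vanish_outside_cube[OF jet_continuous[OF jet_cutoff], where a = a and r = "2 * h"])
    (use assms in \<open>auto simp: cube_def intro!: cutoff_outside\<close>)

lemma cutoff_translate: "cutoff (a :: real ^ 'n::finite) R w \<beta> y = cutoff 0 R w \<beta> (- a + y)"
  by (simp add: cutoff_eq)

lemma integral_cutoff: "(\<integral>y. cutoff (a :: real ^ 'n::finite) h h zero_mi y \<partial>lborel) = moll_mass TYPE('n) h"
  unfolding moll_mass_def cutoff_translate[of a]
  by (rule integral_lborel_shift) (rule jet_borel[OF jet_cutoff])

lemma moll_mass_pos:
  assumes h: "h > 0" shows "moll_mass TYPE('n::finite) h > 0"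
proof -
  have "0 < measure lborel (cube (0 :: real ^ 'n) h)" using h by (simp add: measure_cube)
  also have "\<dots> = (\<integral>y. indicator (cube (0 :: real ^ 'n) h) y \<partial>lborel)" by simp
  also have "\<dots> \<le> moll_mass TYPE('n) h"
    unfolding moll_mass_def
  proof (rule integral_mono)
    show "integrable lborel (\<lambda>y. indicator (cube (0 :: real ^ 'n) h) y :: real)"
      using emeasure_cube[of h "0 :: real ^ 'n"] h by (intro integrable_real_indicator) auto
    show "integrable lborel (cutoff (0 :: real ^ 'n) h h zero_mi)" by (rule cutoff_integrable[OF h])
    show "indicator (cube 0 h) y \<le> cutoff (0 :: real ^ 'n) h h zero_mi y" for y
      using h cutoff_inside[of h h y 0 zero_mi] cutoff_range(1)[of h h 0 y]
      by (auto simp: cube_def indicator_def)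
  qed
  finally show ?thesis .
qed

lemma continuous_cutoff_pair:
  assumes "continuous_on S u" "continuous_on S v"
  shows "continuous_on S (\<lambda>z. cutoff (v z :: real ^ 'n::finite) R w \<beta> (u z))"
  unfolding cutoff_eq
  by (intro continuous_on_prod continuous_on_compose2[OF deriv_seq_continuous[OF deriv_seq_plateau, of UNIV]]
      continuous_intros assms) auto

text \<open>Near a point \<open>x\<close> the integrals may be taken over one fixed cube, which is what differentiation under the
  integral sign requires.\<close>

lemma mollify_integral_cube:
  fixes f :: "real ^ 'n::finite \<Rightarrow> real"
  assumes f: "continuous_on UNIV f" and h: "h > 0" and x': "infnorm (x' - x) \<le> 1"
  shows "(\<integral>y. f y * cutoff y h h \<beta> x' \<partial>lborel) = integral (cube x (2 * h + 1)) (\<lambda>y. f y * cutoff y h h \<beta> x')"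
proof -
  let ?g = "\<lambda>y. f y * cutoff y h h \<beta> x'"
  have out: "?g y = 0" if "y \<notin> cube x (2 * h + 1)" for y
  proof -
    have "infnorm (y - x) \<le> infnorm (x' - y) + infnorm (x' - x)"
      using infnorm_triangle[of "y - x'" "x' - x"] by (simp add: infnorm_sub[of y x'])
    then have "infnorm (x' - y) \<ge> h + h" using that x' by (auto simp: cube_def)
    then show ?thesis using cutoff_outside[of h h x' y] h by simp
  qed
  have c: "continuous_on UNIV ?g"
    by (intro continuous_intros f continuous_cutoff_pair)
  have "integrable lborel ?g" by (rule integrable_vanish_outside_cube[OF c out])
  then have "(\<integral>y. ?g y \<partial>lborel) = integral UNIV ?g" by (simp add: integral_lborel)
  also have "\<dots> = integral UNIV (\<lambda>y. if y \<in> cube x (2 * h + 1) then ?g y else 0)"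
    using out by (intro Henstock_Kurzweil_Integration.integral_cong) auto
  also have "\<dots> = integral (cube x (2 * h + 1)) ?g" by (rule integral_restrict_UNIV)
  finally show ?thesis .
qed

lemma jet_mollify:
  fixes f :: "real ^ 'n::finite \<Rightarrow> real"
  assumes f: "continuous_on UNIV f" and h: "h > 0"
  shows "jet (mollify f h)"
proof -
  define M where "M \<beta> x = (\<integral>y. f y * cutoff y h h \<beta> x \<partial>lborel)" for \<beta> x
  have "jet M"
    unfolding jet_def
  proof (intro conjI allI)
    fix \<beta> :: "'n multiindex"
    show "continuous_on UNIV (M \<beta>)"
    proof (rule continuous_at_imp_continuous_on, rule ballI)
      fix x :: "real ^ 'n"
      have "continuous_on (cube x 1) (\<lambda>x'. integral (cube x (2 * h + 1)) (\<lambda>y. f y * cutoff y h h \<beta> x'))"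
        unfolding cube_eq_cbox[of x "2 * h + 1"]
        unfolding split_beta
        by (rule integral_continuous_on_param)
          (auto simp: split_beta intro!: continuous_intros continuous_cutoff_pair continuous_on_compose2[OF f])
      then have "continuous_on (cube x 1) (M \<beta>)"
        by (rule continuous_on_eq) (auto simp: M_def cube_def mollify_integral_cube[OF f h])
      moreover have "ball x 1 \<subseteq> cube x 1"
      proof
        fix y assume "y \<in> ball x 1"
        then have "norm (y - x) < 1" by (simp add: dist_norm norm_minus_commute)
        then show "y \<in> cube x 1" using infnorm_le_norm[of "y - x"] by (simp add: cube_def)
      qed
      then have "x \<in> interior (cube x 1)" by (meson centre_in_ball interior_maximal open_ball subsetD zero_less_one)
      ultimately show "isCont (M \<beta>) x" by (rule continuous_on_interior)
    qed
  next
    fix \<beta> :: "'n multiindex" and i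
    show "pdiff (M \<beta>) i (M (inc \<beta> i))"
      unfolding pdiff_def
    proof
      fix x :: "real ^ 'n"
      define e where "e = (axis i 1 :: real ^ 'n)"
      have en: "infnorm (x + t *\<^sub>R e - x) \<le> 1" if "t \<in> {-1<..<1}" for t
        using that by (auto simp: infnorm_le_iff e_def axis_def)
      have "((\<lambda>t. integral (cube x (2 * h + 1)) (\<lambda>y. f y * cutoff y h h \<beta> (x + t *\<^sub>R e))) has_field_derivative
          integral (cube x (2 * h + 1)) (\<lambda>y. f y * cutoff y h h (inc \<beta> i) (x + 0 *\<^sub>R e))) (at 0 within {-1<..<1})"
        unfolding cube_eq_cbox[of x "2 * h + 1"]
      proof (rule leibniz_rule_field_derivative)
        fix t :: real and y :: "real ^ 'n"
        show "((\<lambda>t. f y * cutoff y h h \<beta> (x + t *\<^sub>R e)) has_field_derivative f y * cutoff y h h (inc \<beta> i) (x + t *\<^sub>R e))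
          (at t within {-1<..<1})"
          unfolding e_def
          by (intro DERIV_cmult DERIV_subset[OF pdiff_line[OF jet_pdiff[OF jet_cutoff]]]) auto
      next
        fix t :: real
        show "(\<lambda>y. f y * cutoff y h h \<beta> (x + t *\<^sub>R e)) integrable_on cbox (x - (\<chi> i. 2 * h + 1)) (x + (\<chi> i. 2 * h + 1))"
          by (intro integrable_continuous continuous_intros continuous_cutoff_pair continuous_on_subset[OF f]) auto
      next
        show "continuous_on ({-1<..<1} \<times> cbox (x - (\<chi> i. 2 * h + 1)) (x + (\<chi> i. 2 * h + 1)))
            (\<lambda>(t, y). f y * cutoff y h h (inc \<beta> i) (x + t *\<^sub>R e))"
          unfolding split_beta
          by (intro continuous_intros continuous_cutoff_pair continuous_on_compose2[OF f]) auto
      qed auto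
      then have "((\<lambda>t. M \<beta> (x + t *\<^sub>R e)) has_field_derivative M (inc \<beta> i) x) (at 0 within {-1<..<1})"
      proof -
        have 1: "integral (cube x (2 * h + 1)) (\<lambda>y. f y * cutoff y h h \<beta> (x + t *\<^sub>R e)) = M \<beta> (x + t *\<^sub>R e)"
          if "t \<in> {-1<..<1}" for t
          unfolding M_def using that by (intro mollify_integral_cube[OF f h, symmetric] en)
        have 2: "integral (cube x (2 * h + 1)) (\<lambda>y. f y * cutoff y h h (inc \<beta> i) (x + 0 *\<^sub>R e)) = M (inc \<beta> i) x"
          unfolding M_def by (subst mollify_integral_cube[OF f h, of x x]) (simp_all add: infnorm_0)
        assume "((\<lambda>t. integral (cube x (2 * h + 1)) (\<lambda>y. f y * cutoff y h h \<beta> (x + t *\<^sub>R e))) has_real_derivative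
          integral (cube x (2 * h + 1)) (\<lambda>y. f y * cutoff y h h (inc \<beta> i) (x + 0 *\<^sub>R e))) (at 0 within {-1<..<1})"
        then show ?thesis
          unfolding 2 by (rule has_field_derivative_transform_within[where d = 1]) (auto simp: 1)
      qed
      then show "((\<lambda>t. M \<beta> (x + t *\<^sub>R axis i 1)) has_real_derivative M (inc \<beta> i) x) (at 0)"
        by (simp add: at_within_open[of _ "{-1<..<1}"] e_def)
    qed
  qed
  from jet_cmult[OF this, of "1 / moll_mass TYPE('n) h"] show ?thesis
    by (simp add: M_def mollify_def[abs_def])
qed

text \<open>The kernel is a probability density supported in a cube of radius \<open>2 * h\<close>.\<close>

lemma mollify_close:
  fixes f :: "real ^ 'n::finite \<Rightarrow> real"
  assumes f: "continuous_on UNIV f" and h: "h > 0"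
    and e: "\<And>y. y \<in> cube x (2 * h) \<Longrightarrow> \<bar>f y - f x\<bar> \<le> e"
  shows "\<bar>mollify f h zero_mi x - f x\<bar> \<le> e"
proof -
  let ?I = "moll_mass TYPE('n) h"
  have I: "?I > 0" by (rule moll_mass_pos[OF h])
  have sw: "cutoff y h h zero_mi x = cutoff x h h zero_mi y" for y :: "real ^ 'n"
    using cutoff_swap[of y h h zero_mi x] by simp
  have out: "cutoff x h h zero_mi y = 0" if "y \<notin> cube x (2 * h)" for y
    using that h by (intro cutoff_outside) (auto simp: cube_def)
  have i1: "integrable lborel (\<lambda>y. f y * cutoff x h h zero_mi y)"
    by (rule integrable_vanish_outside_cube[where a = x and r = "2 * h"])
      (use out in \<open>auto intro!: continuous_intros f jet_continuous[OF jet_cutoff]\<close>)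
  have i2: "integrable lborel (\<lambda>y. c * cutoff x h h zero_mi y)" for c
    by (intro integrable_mult_right cutoff_integrable[OF h])
  have "mollify f h zero_mi x - f x = (1 / ?I) * ((\<integral>y. f y * cutoff x h h zero_mi y \<partial>lborel) - (\<integral>y. f x * cutoff x h h zero_mi y \<partial>lborel))"
    unfolding mollify_def sw using I by (simp add: integral_cutoff algebra_simps)
  also have "\<dots> = (1 / ?I) * (\<integral>y. (f y - f x) * cutoff x h h zero_mi y \<partial>lborel)"
    using i1 i2 by (simp add: left_diff_distrib)
  finally have "\<bar>mollify f h zero_mi x - f x\<bar> = (1 / ?I) * \<bar>\<integral>y. (f y - f x) * cutoff x h h zero_mi y \<partial>lborel\<bar>"
    using I by (simp add: abs_mult)
  also have "\<dots> \<le> (1 / ?I) * (\<integral>y. e * cutoff x h h zero_mi y \<partial>lborel)"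
  proof (rule mult_left_mono)
    have "\<bar>\<integral>y. (f y - f x) * cutoff x h h zero_mi y \<partial>lborel\<bar> \<le> (\<integral>y. \<bar>(f y - f x) * cutoff x h h zero_mi y\<bar> \<partial>lborel)"
      by (rule integral_abs_bound)
    also have "\<dots> \<le> (\<integral>y. e * cutoff x h h zero_mi y \<partial>lborel)"
    proof (rule integral_mono)
      show "integrable lborel (\<lambda>y. \<bar>(f y - f x) * cutoff x h h zero_mi y\<bar>)"
        using i1 i2 by (intro integrable_abs) (simp add: left_diff_distrib)
      show "integrable lborel (\<lambda>y. e * cutoff x h h zero_mi y)" by (rule i2)
      fix y
      show "\<bar>(f y - f x) * cutoff x h h zero_mi y\<bar> \<le> e * cutoff x h h zero_mi y"
        using e[of y] out[of y] cutoff_range(1)[of h h x y] h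
        by (cases "y \<in> cube x (2 * h)") (auto simp: abs_mult intro!: mult_right_mono)
    qed
    finally show "\<bar>\<integral>y. (f y - f x) * cutoff x h h zero_mi y \<partial>lborel\<bar> \<le> (\<integral>y. e * cutoff x h h zero_mi y \<partial>lborel)" .
  qed (use I in auto)
  also have "\<dots> = e" using I by (simp add: integral_cutoff)
  finally show ?thesis .
qed

lemma mollify_uniformly_close:
  fixes f :: "real ^ 'n::finite \<Rightarrow> real"
  assumes f: "continuous_on UNIV f" and S: "bounded S" and e: "e > 0"
  shows "\<exists>h>0. \<forall>x\<in>S. \<bar>mollify f h zero_mi x - f x\<bar> \<le> e"
proof -
  obtain r where r: "r > 0" "S \<subseteq> cube 0 r" using bounded_subset_cube[OF S] .
  have "uniformly_continuous_on (cube 0 (r + 2)) f"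
    by (intro compact_uniformly_continuous continuous_on_subset[OF f]) auto
  then obtain d where d: "d > 0" "\<And>x y. x \<in> cube 0 (r + 2) \<Longrightarrow> y \<in> cube 0 (r + 2) \<Longrightarrow> dist y x < d \<Longrightarrow> dist (f y) (f x) < e"
    unfolding uniformly_continuous_on_def using e by metis
  define h where "h = min 1 (d / (4 * sqrt (CARD('n))))"
  have sq: "sqrt (real CARD('n)) > 0" by simp
  have h: "h > 0" "h \<le> 1" "2 * h * sqrt (CARD('n)) < d"
  proof -
    show "h > 0" "h \<le> 1" using d sq by (auto simp: h_def)
    have "h * (4 * sqrt (CARD('n))) \<le> d / (4 * sqrt (CARD('n))) * (4 * sqrt (CARD('n)))"
      unfolding h_def using sq by (intro mult_right_mono) auto
    then have "h * (4 * sqrt (CARD('n))) \<le> d" using sq by simp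
    then show "2 * h * sqrt (CARD('n)) < d" using d by simp
  qed
  have "\<bar>mollify f h zero_mi x - f x\<bar> \<le> e" if x: "x \<in> S" for x
  proof (rule mollify_close[OF f h(1)])
    fix y assume "y \<in> cube x (2 * h)"
    then have y: "infnorm (y - x) \<le> 2 * h" by (simp add: cube_def)
    have xr: "infnorm x \<le> r" using x r by (auto simp: cube_def)
    have "infnorm y \<le> infnorm x + infnorm (y - x)" using infnorm_triangle[of x "y - x"] by simp
    then have "y \<in> cube 0 (r + 2)" using xr y h by (simp add: cube_def)
    moreover have "x \<in> cube 0 (r + 2)" using xr by (simp add: cube_def)
    moreover have "dist y x < d"
    proof -
      have "norm (y - x) \<le> sqrt (CARD('n)) * infnorm (y - x)"
        using norm_le_infnorm[of "y - x"] by simp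
      also have "\<dots> \<le> sqrt (CARD('n)) * (2 * h)" using y by (intro mult_left_mono) auto
      also have "\<dots> < d" using h(3) by (simp add: mult_ac)
      finally show ?thesis by (simp add: dist_norm)
    qed
    ultimately show "\<bar>f y - f x\<bar> \<le> e" using d(2) by (fastforce simp: dist_real_def)
  qed
  then show ?thesis using h by blast
qed

text \<open>By definition of the weak derivative, with the kernel as test function, the derivative of the mollified
  function is the mollified weak derivative \<open>g\<close>.  Jensen's inequality for the probability density \<open>K x\<close> and
  Tonelli's theorem show that mollifying does not increase the square integral.\<close>

lemma mollify_energy_component:
  fixes f g :: "real ^ 'n::finite \<Rightarrow> real"
  assumes f: "continuous_on UNIV f" and h: "h > 0"
    and g: "has_weak_deriv UNIV \<beta> f g" and g2: "integrable lebesgue (\<lambda>x. (g x)\<^sup>2)"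
  shows "integrable lborel (\<lambda>x. (mollify f h \<beta> x)\<^sup>2)"
    and "(\<integral>x. (mollify f h \<beta> x)\<^sup>2 \<partial>lborel) \<le> (\<integral>x. (g x)\<^sup>2 \<partial>lebesgue)"
proof -
  let ?I = "moll_mass TYPE('n) h"
  have I: "?I > 0" by (rule moll_mass_pos[OF h])
  obtain k where k: "k \<in> borel_measurable lborel" "AE x in lborel. g x = k x"
    using completion_ex_borel_measurable_real[OF has_weak_deriv_measurable[OF g]] by blast
  have km [measurable]: "k \<in> borel_measurable borel" using k by simp
  have ae: "AE x in lebesgue. g x = k x" using AE_completion[OF k(2)] .
  have kL: "k \<in> borel_measurable lebesgue" using km by (simp add: measurable_completion)
  have gL: "g \<in> borel_measurable lebesgue" by (rule has_weak_deriv_measurable[OF g])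
  have "integrable lebesgue (\<lambda>x. (k x)\<^sup>2)"
    by (rule integrable_cong_AE_imp[OF g2]) (use ae kL in \<open>auto intro!: borel_measurable_power elim!: AE_mp\<close>)
  then have k2: "integrable lborel (\<lambda>x. (k x)\<^sup>2)"
    by (subst (asm) lebesgue_borel_integrable) auto
  have k2eq: "(\<integral>x. (g x)\<^sup>2 \<partial>lebesgue) = (\<integral>x. (k x)\<^sup>2 \<partial>lborel)"
  proof -
    have "(\<integral>x. (g x)\<^sup>2 \<partial>lebesgue) = (\<integral>x. (k x)\<^sup>2 \<partial>lebesgue)"
      by (rule integral_cong_AE) (use ae kL gL in \<open>auto intro!: borel_measurable_power elim!: AE_mp\<close>)
    then show ?thesis by (simp add: lebesgue_borel_integral)
  qed
  define K where "K x y = cutoff x h h zero_mi y / ?I" for x y :: "real ^ 'n"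
  have Kc: "continuous_on UNIV (\<lambda>z. K (fst z) (snd z))"
    unfolding K_def using I by (intro continuous_intros continuous_cutoff_pair) auto
  have Km [measurable]: "(\<lambda>z. K (fst z) (snd z)) \<in> borel_measurable (borel \<Otimes>\<^sub>M borel)"
    using borel_measurable_continuous_onI[OF Kc] by (simp add: borel_prod)
  have Kc': "continuous_on UNIV (\<lambda>z. K (snd z) (fst z))"
    unfolding K_def using I by (intro continuous_intros continuous_cutoff_pair) auto
  have Km' [measurable]: "(\<lambda>z. K (snd z) (fst z)) \<in> borel_measurable (borel \<Otimes>\<^sub>M borel)"
    using borel_measurable_continuous_onI[OF Kc'] by (simp add: borel_prod)
  have Km1 [measurable]: "K x \<in> borel_measurable borel" for x
    unfolding K_def[abs_def] using jet_borel[OF jet_cutoff, of x h h zero_mi] by simp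
  have K0: "K x y \<ge> 0" for x y using cutoff_range(1)[of h h x y] h I by (simp add: K_def)
  have KI: "K x y \<le> 1 / ?I" for x y using cutoff_range(2)[of h h x y] h I by (simp add: K_def divide_right_mono)
  have Ki: "integrable lborel (K x)" for x
    unfolding K_def[abs_def] by (intro Bochner_Integration.integrable_divide cutoff_integrable[OF h])
  have K1: "(\<integral>y. K x y \<partial>lborel) = 1" for x using I by (simp add: K_def integral_cutoff)
  have Ksw: "K x y = K y x" for x y using cutoff_swap[of x h h zero_mi y] by (simp add: K_def)
  have mol: "mollify f h \<beta> x = (\<integral>y. k y * K x y \<partial>lborel)" for x
  proof -
    have sw: "f y * cutoff y h h \<beta> x = (- 1) ^ mi_order \<beta> * (f y * cutoff x h h \<beta> y)" for y
      by (simp add: cutoff_swap[of y])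
    have "(\<integral>y. f y * cutoff x h h \<beta> y \<partial>lborel) = (\<integral>y. f y * cutoff x h h \<beta> y \<partial>lebesgue)"
      by (intro lebesgue_borel_integral[symmetric] borel_measurable_times borel_measurable_continuous_onI[OF f] jet_borel[OF jet_cutoff])
    also have "\<dots> = (- 1) ^ mi_order \<beta> * (\<integral>y. g y * cutoff x h h zero_mi y \<partial>lebesgue)"
      using g cutoff_test_function[of h h x] h unfolding has_weak_deriv_def set_lebesgue_UNIV by fastforce
    also have "(\<integral>y. g y * cutoff x h h zero_mi y \<partial>lebesgue) = (\<integral>y. k y * cutoff x h h zero_mi y \<partial>lebesgue)"
    proof (rule integral_cong_AE)
      have "cutoff x h h zero_mi \<in> borel_measurable lebesgue"
        using jet_borel[OF jet_cutoff, of x h h zero_mi] by (simp add: measurable_completion)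
      then show "(\<lambda>y. g y * cutoff x h h zero_mi y) \<in> borel_measurable lebesgue"
        "(\<lambda>y. k y * cutoff x h h zero_mi y) \<in> borel_measurable lebesgue"
        using gL kL by (auto intro!: borel_measurable_times)
      show "AE y in lebesgue. g y * cutoff x h h zero_mi y = k y * cutoff x h h zero_mi y"
        using ae by (rule AE_mp) auto
    qed
    also have "\<dots> = (\<integral>y. k y * cutoff x h h zero_mi y \<partial>lborel)"
      by (intro lebesgue_borel_integral borel_measurable_times km jet_borel[OF jet_cutoff])
    finally have e1: "(\<integral>y. f y * cutoff x h h \<beta> y \<partial>lborel)
        = (- 1) ^ mi_order \<beta> * (\<integral>y. k y * cutoff x h h zero_mi y \<partial>lborel)" .
    have "(\<integral>y. f y * cutoff y h h \<beta> x \<partial>lborel) = (- 1) ^ mi_order \<beta> * (\<integral>y. f y * cutoff x h h \<beta> y \<partial>lborel)"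
      unfolding sw by (rule integral_mult_right_zero)
    also have "\<dots> = (\<integral>y. k y * cutoff x h h zero_mi y \<partial>lborel)"
      unfolding e1 by (simp add: mult.assoc[symmetric] power_mult_distrib[symmetric])
    finally have "(\<integral>y. f y * cutoff y h h \<beta> x \<partial>lborel) = (\<integral>y. k y * cutoff x h h zero_mi y \<partial>lborel)" .
    then show ?thesis using I by (simp add: mollify_def K_def)
  qed
  have i2: "integrable lborel (\<lambda>y. (k y)\<^sup>2 * K x y)" for x
  proof (rule Bochner_Integration.integrable_bound)
    show "integrable lborel (\<lambda>y. (1 / ?I) * (k y)\<^sup>2)" using k2 by simp
    show "AE y in lborel. norm ((k y)\<^sup>2 * K x y) \<le> norm (1 / ?I * (k y)\<^sup>2)"
    proof (rule AE_I2)
      fix y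
      have "(k y)\<^sup>2 * K x y \<le> (k y)\<^sup>2 * (1 / ?I)" using KI by (intro mult_left_mono) auto
      then show "norm ((k y)\<^sup>2 * K x y) \<le> norm (1 / ?I * (k y)\<^sup>2)" using K0 I by (simp add: abs_mult)
    qed
  qed measurable
  have i1: "integrable lborel (\<lambda>y. k y * K x y)" for x
  proof (rule Bochner_Integration.integrable_bound)
    show "integrable lborel (\<lambda>y. (k y)\<^sup>2 * K x y + K x y)" using i2 Ki by simp
    show "AE y in lborel. norm (k y * K x y) \<le> norm ((k y)\<^sup>2 * K x y + K x y)"
    proof (rule AE_I2)
      fix y
      have "2 * \<bar>k y\<bar> \<le> (k y)\<^sup>2 + 1"
        using zero_le_power2[of "\<bar>k y\<bar> - 1"] by (simp add: power2_diff)
      then have "\<bar>k y\<bar> \<le> (k y)\<^sup>2 + 1" by (smt (verit) abs_ge_zero)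
      then have "\<bar>k y\<bar> * K x y \<le> ((k y)\<^sup>2 + 1) * K x y" using K0 by (rule mult_right_mono)
      then show "norm (k y * K x y) \<le> norm ((k y)\<^sup>2 * K x y + K x y)"
        using K0[of x y] by (simp add: abs_mult algebra_simps)
    qed
  qed measurable
  have jensen: "(mollify f h \<beta> x)\<^sup>2 \<le> (\<integral>y. (k y)\<^sup>2 * K x y \<partial>lborel)" for x
  proof -
    define c where "c = mollify f h \<beta> x"
    have "0 \<le> (\<integral>y. (k y - c)\<^sup>2 * K x y \<partial>lborel)" using K0 by (intro integral_nonneg_AE) auto
    also have "(\<lambda>y. (k y - c)\<^sup>2 * K x y) = (\<lambda>y. (k y)\<^sup>2 * K x y - 2 * c * (k y * K x y) + c\<^sup>2 * K x y)"
      by (auto simp: power2_diff algebra_simps)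
    also have "(\<integral>y. (k y)\<^sup>2 * K x y - 2 * c * (k y * K x y) + c\<^sup>2 * K x y \<partial>lborel)
        = (\<integral>y. (k y)\<^sup>2 * K x y \<partial>lborel) - 2 * c * c + c\<^sup>2 * 1"
      using i1 i2 Ki by (simp add: K1 c_def mol)
    finally show ?thesis by (simp add: c_def power2_eq_square)
  qed
  have mm: "mollify f h \<beta> \<in> borel_measurable borel" by (rule jet_borel[OF jet_mollify[OF f h]])
  have "(\<integral>\<^sup>+x. ennreal ((mollify f h \<beta> x)\<^sup>2) \<partial>lborel) \<le> (\<integral>\<^sup>+x. (\<integral>\<^sup>+y. ennreal ((k y)\<^sup>2) * ennreal (K x y) \<partial>lborel) \<partial>lborel)"
  proof (rule nn_integral_mono)
    fix x
    have "ennreal ((mollify f h \<beta> x)\<^sup>2) \<le> ennreal (\<integral>y. (k y)\<^sup>2 * K x y \<partial>lborel)"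
      by (rule ennreal_leI[OF jensen])
    also have "\<dots> = (\<integral>\<^sup>+y. ennreal ((k y)\<^sup>2 * K x y) \<partial>lborel)"
      using i2 K0 by (intro nn_integral_eq_integral[symmetric]) auto
    finally show "ennreal ((mollify f h \<beta> x)\<^sup>2) \<le> (\<integral>\<^sup>+y. ennreal ((k y)\<^sup>2) * ennreal (K x y) \<partial>lborel)"
      using K0 by (simp add: ennreal_mult)
  qed
  also have "\<dots> = (\<integral>\<^sup>+y. (\<integral>\<^sup>+x. ennreal ((k y)\<^sup>2) * ennreal (K x y) \<partial>lborel) \<partial>lborel)"
    by (rule lborel_pair.Fubini') measurable
  also have "\<dots> = (\<integral>\<^sup>+y. ennreal ((k y)\<^sup>2) \<partial>lborel)"
  proof (rule nn_integral_cong)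
    fix y
    have "(\<integral>\<^sup>+x. ennreal (K x y) \<partial>lborel) = ennreal (\<integral>x. K y x \<partial>lborel)"
      unfolding Ksw[of _ y] using Ki K0 by (intro nn_integral_eq_integral) auto
    then have "(\<integral>\<^sup>+x. ennreal (K x y) \<partial>lborel) = 1" by (simp add: K1)
    moreover have "(\<lambda>x. K x y) \<in> borel_measurable borel" unfolding Ksw[of _ y] by (rule Km1)
    ultimately show "(\<integral>\<^sup>+x. ennreal ((k y)\<^sup>2) * ennreal (K x y) \<partial>lborel) = ennreal ((k y)\<^sup>2)"
      by (subst nn_integral_cmult) auto
  qed
  also have "\<dots> = ennreal (\<integral>y. (k y)\<^sup>2 \<partial>lborel)"
    using k2 by (intro nn_integral_eq_integral) auto
  finally have le: "(\<integral>\<^sup>+x. ennreal ((mollify f h \<beta> x)\<^sup>2) \<partial>lborel) \<le> ennreal (\<integral>y. (k y)\<^sup>2 \<partial>lborel)" .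
  show int: "integrable lborel (\<lambda>x. (mollify f h \<beta> x)\<^sup>2)"
    by (rule integrableI_nonneg) (use mm le in \<open>auto simp: less_top[symmetric] top_unique\<close>)
  have "(\<integral>\<^sup>+x. ennreal ((mollify f h \<beta> x)\<^sup>2) \<partial>lborel) = ennreal (\<integral>x. (mollify f h \<beta> x)\<^sup>2 \<partial>lborel)"
    using int by (intro nn_integral_eq_integral) auto
  then show "(\<integral>x. (mollify f h \<beta> x)\<^sup>2 \<partial>lborel) \<le> (\<integral>x. (g x)\<^sup>2 \<partial>lebesgue)"
    using le unfolding k2eq by (simp add: ennreal_le_iff)
qed

lemma mollify_energy:
  fixes f :: "real ^ 'n::finite \<Rightarrow> real"
  assumes f: "f \<in> homog_sobolev m" and h: "h > 0"
  shows "finite_energy m (mollify f h)" and "energy m (mollify f h) \<le> (sobolev_seminorm m UNIV f)\<^sup>2"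
proof -
  have fc: "continuous_on UNIV f" using f by (simp add: homog_sobolev_def)
  note j = jet_mollify[OF fc h]
  have ex: "\<exists>g. has_weak_deriv UNIV \<beta> f g \<and> integrable lebesgue (\<lambda>x. (g x)\<^sup>2)" if "mi_order \<beta> = m" for \<beta>
    using f that by (auto simp: homog_sobolev_def)
  show fe: "finite_energy m (mollify f h)"
    unfolding finite_energy_iff[OF j] using ex mollify_energy_component(1)[OF fc h] by blast
  have "energy m (mollify f h) = (\<Sum>\<beta> | mi_order \<beta> = m. fact m / mi_fact \<beta> * (\<integral>x. (mollify f h \<beta> x)\<^sup>2 \<partial>lborel))"
    by (rule energy_eq_sum[OF j fe])
  also have "\<dots> \<le> (\<Sum>\<beta> | mi_order \<beta> = m. fact m / mi_fact \<beta> * (LINT x:UNIV|lebesgue. \<bar>weak_D UNIV \<beta> f x\<bar>\<^sup>2))"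
  proof (intro sum_mono mult_left_mono)
    fix \<beta> :: "'n multiindex" assume "\<beta> \<in> {\<beta>. mi_order \<beta> = m}"
    then obtain g where g: "has_weak_deriv UNIV \<beta> f g" "integrable lebesgue (\<lambda>x. (g x)\<^sup>2)" using ex by auto
    show "(\<integral>x. (mollify f h \<beta> x)\<^sup>2 \<partial>lborel) \<le> (LINT x:UNIV|lebesgue. \<bar>weak_D UNIV \<beta> f x\<bar>\<^sup>2)"
      unfolding weak_D_integral[OF g(1)] by (rule mollify_energy_component(2)[OF fc h g])
    show "0 \<le> fact m / mi_fact \<beta>" using mi_fact_pos[of \<beta>] by simp
  qed
  also have "\<dots> = (sobolev_seminorm m UNIV f)\<^sup>2"
    unfolding sobolev_seminorm_def
    by (subst real_sqrt_pow2) (auto intro!: sum_nonneg mult_nonneg_nonneg divide_nonneg_nonneg mi_fact_nonneg)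
  finally show "energy m (mollify f h) \<le> (sobolev_seminorm m UNIV f)\<^sup>2" .
qed

section \<open>Near-minimizers of the energy\<close>

text \<open>The smooth functions that are admissible for the Lagrange function at \<open>\<xi>\<close>.\<close>

definition lagrange_jet ::
  "nat \<Rightarrow> (real ^ 'n::finite) set \<Rightarrow> real ^ 'n \<Rightarrow> ('n multiindex \<Rightarrow> real ^ 'n \<Rightarrow> real) \<Rightarrow> bool" where
  "lagrange_jet m \<Xi> \<xi> U \<longleftrightarrow>
     jet U \<and> finite_energy m U \<and> U zero_mi \<xi> = 1 \<and> (\<forall>\<zeta>\<in>\<Xi> - {\<xi>}. U zero_mi \<zeta> = 0)"

lemma square_add_le:
  fixes a b t :: real
  assumes "t > 0"
  shows "(a + b)\<^sup>2 \<le> (1 + t) * a\<^sup>2 + (1 + 1 / t) * b\<^sup>2"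
proof -
  have "0 \<le> (t * a - b)\<^sup>2 / t" using assms by simp
  also have "\<dots> = t * a\<^sup>2 - 2 * a * b + b\<^sup>2 / t"
    using assms by (simp add: power2_eq_square field_simps)
  finally show ?thesis by (simp add: power2_eq_square algebra_simps)
qed

text \<open>The free parameter \<open>t\<close> keeps the factor in front of the main term arbitrarily close to one when \<open>V\<close> is a
  small perturbation.\<close>

lemma energy_add_le:
  assumes U: "jet U" "finite_energy m U" and V: "jet V" "finite_energy m V" and t: "t > 0"
  shows "finite_energy m (\<lambda>\<beta> x. U \<beta> x + V \<beta> x)"
    and "energy m (\<lambda>\<beta> x. U \<beta> x + V \<beta> x) \<le> (1 + t) * energy m U + (1 + 1 / t) * energy m V"
proof -
  have le: "edens m (\<lambda>\<beta> x. U \<beta> x + V \<beta> x) x \<le> (1 + t) * edens m U x + (1 + 1 / t) * edens m V x" for x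
  proof -
    have "edens m (\<lambda>\<beta> x. U \<beta> x + V \<beta> x) x
       \<le> (\<Sum>\<beta> | mi_order \<beta> = m. fact m / mi_fact \<beta> * ((1 + t) * (U \<beta> x)\<^sup>2 + (1 + 1 / t) * (V \<beta> x)\<^sup>2))"
      unfolding edens_def
      by (intro sum_mono mult_left_mono square_add_le t divide_nonneg_nonneg mi_fact_nonneg) auto
    also have "\<dots> = (1 + t) * edens m U x + (1 + 1 / t) * edens m V x"
      unfolding edens_def sum_distrib_left sum.distrib[symmetric]
      by (intro sum.cong refl) (simp only: distrib_left mult.left_commute)
    finally show ?thesis .
  qed
  have i: "integrable lborel (\<lambda>x. (1 + t) * edens m U x + (1 + 1 / t) * edens m V x)"
    using U V by (simp add: finite_energy_def)
  show fe: "finite_energy m (\<lambda>\<beta> x. U \<beta> x + V \<beta> x)"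
    unfolding finite_energy_def
  proof (rule Bochner_Integration.integrable_bound[OF i])
    show "edens m (\<lambda>\<beta> x. U \<beta> x + V \<beta> x) \<in> borel_measurable lborel"
      using edens_borel[OF jet_add[OF U(1) V(1)]] by simp
    show "AE x in lborel. norm (edens m (\<lambda>\<beta> x. U \<beta> x + V \<beta> x) x) \<le> norm ((1 + t) * edens m U x + (1 + 1 / t) * edens m V x)"
      using le t by (auto intro!: AE_I2)
  qed
  have "energy m (\<lambda>\<beta> x. U \<beta> x + V \<beta> x) \<le> (\<integral>x. (1 + t) * edens m U x + (1 + 1 / t) * edens m V x \<partial>lborel)"
    unfolding energy_def using fe i le by (intro integral_mono) (auto simp: finite_energy_def)
  also have "\<dots> = (1 + t) * energy m U + (1 + 1 / t) * energy m V"
    using U V unfolding energy_def finite_energy_def by simp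
  finally show "energy m (\<lambda>\<beta> x. U \<beta> x + V \<beta> x) \<le> (1 + t) * energy m U + (1 + 1 / t) * energy m V" .
qed

lemma finite_energy_vanish_outside_cube:
  fixes U :: "'n::finite multiindex \<Rightarrow> real ^ 'n \<Rightarrow> real"
  assumes U: "jet U" and U0: "\<And>x. x \<notin> cube a r \<Longrightarrow> U zero_mi x = 0"
  shows "finite_energy m U"
  unfolding finite_energy_def
proof (rule integrable_vanish_outside_cube[OF continuous_edens[OF U]])
  show "edens m U x = 0" if "x \<notin> cube a r" for x
    unfolding edens_def using jet_vanish_outside_cube[OF U U0 that] by simp
qed

text \<open>This lemma replaces the Lagrange function by a smooth function.  Mollifying \<open>chi\<close> does not increase its
  energy, but spoils its values at the centers by small amounts.  These finitely many errors are repaired by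
  multiples of fixed bumps, each one at its center and zero at the others; the energy of the correction is as
  small as one likes.  Since smooth admissible functions compete with \<open>chi\<close>, the result is minimal among them up
  to \<open>\<eta>\<close>.\<close>

lemma near_minimizer_exists:
  fixes \<Xi> \<Omega> :: "(real ^ 'n::finite) set"
  assumes chi: "is_lagrange_function m \<Xi> \<xi> chi" and fin: "finite \<Xi>" and \<xi>: "\<xi> \<in> \<Xi>"
    and \<Omega>: "bounded \<Omega>" "\<Xi> \<subseteq> \<Omega>" and \<eta>: "\<eta> > 0"
  obtains U where "lagrange_jet m \<Xi> \<xi> U" "\<And>x. x \<in> \<Omega> \<Longrightarrow> \<bar>U zero_mi x - chi x\<bar> \<le> \<eta>"
    "\<And>V. lagrange_jet m \<Xi> \<xi> V \<Longrightarrow> energy m U \<le> energy m V + \<eta>"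
proof -
  have adm: "lagrange_admissible m \<Xi> \<xi> chi" using chi by (simp add: is_lagrange_function_def)
  then have hs: "chi \<in> homog_sobolev m" by (simp add: lagrange_admissible_def)
  then have cc: "continuous_on UNIV chi" by (simp add: homog_sobolev_def)
  define E where "E = (sobolev_seminorm m UNIV chi)\<^sup>2"
  have E0: "E \<ge> 0" by (simp add: E_def)
  have Emin: "E \<le> energy m V" if "lagrange_jet m \<Xi> \<xi> V" for V
  proof -
    have V: "jet V" "finite_energy m V" using that by (auto simp: lagrange_jet_def)
    have "lagrange_admissible m \<Xi> \<xi> (V zero_mi)"
      using that jet_homog_sobolev(1)[OF V] by (simp add: lagrange_jet_def lagrange_admissible_def)
    then have "sobolev_seminorm m UNIV chi \<le> sobolev_seminorm m UNIV (V zero_mi)"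
      using chi by (simp add: is_lagrange_function_def)
    moreover have "0 \<le> sobolev_seminorm m UNIV chi"
      unfolding sobolev_seminorm_def
      by (auto intro!: sum_nonneg mult_nonneg_nonneg divide_nonneg_nonneg mi_fact_nonneg)
    ultimately have "E \<le> (sobolev_seminorm m UNIV (V zero_mi))\<^sup>2" unfolding E_def by (rule power_mono)
    then show ?thesis using jet_homog_sobolev(2)[OF V] by simp
  qed
  obtain s where s: "s > 0" "\<And>\<zeta> \<zeta>'. \<zeta> \<in> \<Xi> \<Longrightarrow> \<zeta>' \<in> \<Xi> \<Longrightarrow> \<zeta>' \<noteq> \<zeta> \<Longrightarrow> s + s \<le> infnorm (\<zeta>' - \<zeta>)"
  proof -
    define A where "A = insert 1 ((\<lambda>(a, b). infnorm (a - b)) ` {(a, b). a \<in> \<Xi> \<and> b \<in> \<Xi> \<and> a \<noteq> b})"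
    have "finite {(a, b). a \<in> \<Xi> \<and> b \<in> \<Xi> \<and> a \<noteq> b}"
      by (rule finite_subset[of _ "\<Xi> \<times> \<Xi>"]) (use fin in auto)
    then have A: "finite A" "A \<noteq> {}" by (auto simp: A_def)
    have "Min A \<in> A" using A by (rule Min_in)
    then have "Min A > 0" by (auto simp: A_def infnorm_pos_lt)
    moreover have "Min A \<le> infnorm (\<zeta>' - \<zeta>)" if "\<zeta> \<in> \<Xi>" "\<zeta>' \<in> \<Xi>" "\<zeta>' \<noteq> \<zeta>" for \<zeta> \<zeta>'
      using A that by (intro Min_le) (auto simp: A_def)
    ultimately show ?thesis using that[of "Min A / 2"] by simp
  qed
  define B where "B \<zeta> = cutoff \<zeta> s s" for \<zeta> :: "real ^ 'n"
  have Bj: "jet (B \<zeta>)" for \<zeta> unfolding B_def by (rule jet_cutoff)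
  have B1: "B \<zeta> zero_mi \<zeta> = 1" for \<zeta>
    using s unfolding B_def by (subst cutoff_inside) (auto simp: infnorm_0)
  have B0: "B \<zeta> zero_mi \<zeta>' = 0" if "\<zeta> \<in> \<Xi>" "\<zeta>' \<in> \<Xi>" "\<zeta>' \<noteq> \<zeta>" for \<zeta> \<zeta>'
    unfolding B_def using s that by (intro cutoff_outside) auto
  have Br: "\<bar>B \<zeta> zero_mi x\<bar> \<le> 1" for \<zeta> x
    using cutoff_range[of s s \<zeta> x] s by (simp add: B_def)
  obtain r where r: "r > 0" "\<Xi> \<subseteq> cube 0 r" using bounded_subset_cube[of \<Xi>] bounded_subset[OF \<Omega>] by blast
  have Bout: "B \<zeta> \<beta> x = 0" if "\<zeta> \<in> \<Xi>" "x \<notin> cube 0 (r + (s + s))" for \<zeta> \<beta> x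
  proof -
    have "infnorm x \<le> infnorm (x - \<zeta>) + infnorm \<zeta>" using infnorm_triangle[of "x - \<zeta>" \<zeta>] by simp
    moreover have "infnorm \<zeta> \<le> r" using that r by (auto simp: cube_def)
    ultimately show ?thesis unfolding B_def using that s by (intro cutoff_outside) (auto simp: cube_def)
  qed
  define D where "D x = (\<Sum>\<beta> | mi_order \<beta> = m. fact m / mi_fact \<beta> * (\<Sum>\<zeta>\<in>\<Xi>. \<bar>B \<zeta> \<beta> x\<bar>)\<^sup>2)" for x
  have Di: "integrable lborel D"
  proof (rule integrable_vanish_outside_cube[where a = 0 and r = "r + (s + s)"])
    show "continuous_on UNIV D" unfolding D_def by (intro continuous_intros jet_continuous[OF Bj])
    show "D x = 0" if "x \<notin> cube 0 (r + (s + s))" for x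
      unfolding D_def using Bout[OF _ that] by simp
  qed
  define M where "M = (\<integral>x. D x \<partial>lborel)"
  have D0: "D x \<ge> 0" for x
    unfolding D_def by (intro sum_nonneg mult_nonneg_nonneg divide_nonneg_nonneg mi_fact_nonneg) auto
  have M0: "M \<ge> 0" unfolding M_def using D0 by simp
  \<comment> \<open>The tolerance is split: \<open>t\<close> makes the factor \<open>1 + t\<close> cost at most \<open>\<eta> / 2\<close>, and the size \<open>e\<close> of the errors at the centers makes the correction cost at most \<open>\<eta> / 2\<close>.\<close>
  define t where "t = \<eta> / (2 * (E + 1))"
  have t: "t > 0" using \<eta> E0 by (simp add: t_def)
  define N where "N = real (card \<Xi>)"
  define e where "e = min (\<eta> / (N + 1)) (min 1 (\<eta> / (2 * ((1 + 1 / t) * M + 1))))"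
  have q: "(1 + 1 / t) * M + 1 > 0" using t M0 by (simp add: add_nonneg_pos)
  have e: "e > 0" "e * (N + 1) \<le> \<eta>" "(1 + 1 / t) * (e\<^sup>2 * M) \<le> \<eta> / 2"
  proof -
    show e0: "e > 0" using \<eta> q by (simp add: e_def N_def add_nonneg_pos)
    have "e * (N + 1) \<le> \<eta> / (N + 1) * (N + 1)" unfolding e_def N_def by (intro mult_right_mono) auto
    then show "e * (N + 1) \<le> \<eta>" by (simp add: N_def add_nonneg_pos)
    have "e \<le> 1" by (simp add: e_def)
    then have "e\<^sup>2 \<le> e" using e0 by (simp add: power2_eq_square mult_left_le)
    then have "(1 + 1 / t) * (e\<^sup>2 * M) \<le> (1 + 1 / t) * (e * M)"
      using t M0 by (intro mult_left_mono mult_right_mono) auto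
    also have "\<dots> \<le> e * ((1 + 1 / t) * M + 1)" using e0 by (simp add: algebra_simps)
    also have "\<dots> \<le> \<eta> / (2 * ((1 + 1 / t) * M + 1)) * ((1 + 1 / t) * M + 1)"
      unfolding e_def using q by (intro mult_right_mono) auto
    also have "\<dots> = \<eta> / 2"
    proof -
      have "\<eta> / (2 * Q) * Q = \<eta> / 2" if "Q > 0" for Q using that by simp
      from this[OF q] show ?thesis .
    qed
    finally show "(1 + 1 / t) * (e\<^sup>2 * M) \<le> \<eta> / 2" .
  qed
  obtain h where h: "h > 0" "\<And>x. x \<in> \<Omega> \<Longrightarrow> \<bar>mollify chi h zero_mi x - chi x\<bar> \<le> e"
    using mollify_uniformly_close[OF cc \<Omega>(1) e(1)] by blast
  define c where "c \<zeta> = chi \<zeta> - mollify chi h zero_mi \<zeta>" for \<zeta>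
  have c: "\<bar>c \<zeta>\<bar> \<le> e" if "\<zeta> \<in> \<Xi>" for \<zeta> using h(2)[of \<zeta>] that \<Omega> by (auto simp: c_def)
  define W where "W \<beta> x = (\<Sum>\<zeta>\<in>\<Xi>. c \<zeta> * B \<zeta> \<beta> x)" for \<beta> x
  have Wj: "jet W" unfolding W_def[abs_def] by (intro jet_sum jet_cmult Bj)
  have Wd: "edens m W x \<le> e\<^sup>2 * D x" for x
  proof -
    have "(W \<beta> x)\<^sup>2 \<le> e\<^sup>2 * (\<Sum>\<zeta>\<in>\<Xi>. \<bar>B \<zeta> \<beta> x\<bar>)\<^sup>2" for \<beta>
    proof -
      have "\<bar>W \<beta> x\<bar> \<le> (\<Sum>\<zeta>\<in>\<Xi>. \<bar>c \<zeta> * B \<zeta> \<beta> x\<bar>)" unfolding W_def by (rule sum_abs)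
      also have "\<dots> \<le> (\<Sum>\<zeta>\<in>\<Xi>. e * \<bar>B \<zeta> \<beta> x\<bar>)"
        using c by (intro sum_mono) (auto simp: abs_mult intro!: mult_right_mono)
      also have "\<dots> = e * (\<Sum>\<zeta>\<in>\<Xi>. \<bar>B \<zeta> \<beta> x\<bar>)" by (simp add: sum_distrib_left)
      finally have "\<bar>W \<beta> x\<bar>\<^sup>2 \<le> (e * (\<Sum>\<zeta>\<in>\<Xi>. \<bar>B \<zeta> \<beta> x\<bar>))\<^sup>2" by (intro power_mono) auto
      then show ?thesis by (simp add: power_mult_distrib)
    qed
    then have "edens m W x \<le> (\<Sum>\<beta> | mi_order \<beta> = m. fact m / mi_fact \<beta> * (e\<^sup>2 * (\<Sum>\<zeta>\<in>\<Xi>. \<bar>B \<zeta> \<beta> x\<bar>)\<^sup>2))"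
      unfolding edens_def by (intro sum_mono mult_left_mono divide_nonneg_nonneg mi_fact_nonneg) auto
    then show ?thesis unfolding D_def sum_distrib_left by (simp only: mult.left_commute)
  qed
  have Wf: "finite_energy m W"
  proof (rule finite_energy_vanish_outside_cube[OF Wj])
    show "W zero_mi x = 0" if "x \<notin> cube 0 (r + (s + s))" for x
      unfolding W_def using Bout[OF _ that] by simp
  qed
  have WE: "energy m W \<le> e\<^sup>2 * M"
    unfolding energy_def M_def using Wf Di Wd
    by (subst integral_mult_right_zero[symmetric], intro integral_mono) (auto simp: finite_energy_def)
  define U where "U \<beta> x = mollify chi h \<beta> x + W \<beta> x" for \<beta> x
  note mj = jet_mollify[OF cc h(1)] and me = mollify_energy[OF hs h(1)]
  have Uj: "jet U" unfolding U_def[abs_def] by (rule jet_add[OF mj Wj])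
  have Uf: "finite_energy m U" unfolding U_def[abs_def] by (rule energy_add_le(1)[OF mj me(1) Wj Wf t])
  have "energy m U \<le> (1 + t) * energy m (mollify chi h) + (1 + 1 / t) * energy m W"
    unfolding U_def[abs_def] by (rule energy_add_le(2)[OF mj me(1) Wj Wf t])
  also have "\<dots> \<le> (1 + t) * E + (1 + 1 / t) * (e\<^sup>2 * M)"
    using me(2) WE t unfolding E_def by (intro add_mono mult_left_mono) auto
  also have "\<dots> \<le> E + \<eta>"
  proof -
    have "t * E \<le> t * (E + 1)" using t by simp
    also have "\<dots> = \<eta> / 2" using E0 by (simp add: t_def field_simps)
    finally have "t * E \<le> \<eta> / 2" .
    moreover have "(1 + t) * E = E + t * E" by (simp add: distrib_right)
    ultimately show ?thesis using e(3) by linarith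
  qed
  finally have UE: "energy m U \<le> E + \<eta>" .
  have Uval: "U zero_mi \<zeta> = chi \<zeta>" if "\<zeta> \<in> \<Xi>" for \<zeta>
  proof -
    have "W zero_mi \<zeta> = (\<Sum>\<zeta>'\<in>\<Xi>. if \<zeta>' = \<zeta> then c \<zeta> else 0)"
      unfolding W_def using B0 B1 that by (intro sum.cong) auto
    also have "\<dots> = c \<zeta>" using fin that by simp
    finally show ?thesis by (simp add: U_def c_def)
  qed
  have "lagrange_jet m \<Xi> \<xi> U"
    unfolding lagrange_jet_def using Uj Uf Uval \<xi> adm by (auto simp: lagrange_admissible_def)
  moreover have "\<bar>U zero_mi x - chi x\<bar> \<le> \<eta>" if "x \<in> \<Omega>" for x
  proof -
    have "\<bar>W zero_mi x\<bar> \<le> (\<Sum>\<zeta>\<in>\<Xi>. \<bar>c \<zeta> * B \<zeta> zero_mi x\<bar>)" unfolding W_def by (rule sum_abs)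
    also have "\<dots> \<le> (\<Sum>\<zeta>\<in>\<Xi>. e * 1)"
      unfolding abs_mult using c Br e by (intro sum_mono mult_mono) auto
    finally have "\<bar>W zero_mi x\<bar> \<le> e * N" by (simp add: N_def mult.commute)
    then have "\<bar>U zero_mi x - chi x\<bar> \<le> e + e * N" using h(2)[OF that] by (simp add: U_def)
    also have "\<dots> \<le> \<eta>" using e(2) by (simp add: algebra_simps)
    finally show ?thesis .
  qed
  moreover have "energy m U \<le> energy m V + \<eta>" if "lagrange_jet m \<Xi> \<xi> V" for V
    using UE Emin[OF that] by simp
  ultimately show ?thesis using that by blast
qed

section \<open>Taylor polynomials\<close>

text \<open>The iterated derivative in direction \<open>v\<close>, written as a sum over sequences of indices.  The recursion
  avoids multinomial coefficients.\<close>

primrec dir_deriv ::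
  "('n::finite multiindex \<Rightarrow> real ^ 'n \<Rightarrow> real) \<Rightarrow> nat \<Rightarrow> 'n multiindex \<Rightarrow> real ^ 'n \<Rightarrow> real ^ 'n \<Rightarrow> real"
where
  "dir_deriv U 0 = (\<lambda>\<beta> z v. U \<beta> z)"
| "dir_deriv U (Suc k) = (\<lambda>\<beta> z v. \<Sum>i\<in>UNIV. v $ i * dir_deriv U k (inc \<beta> i) z v)"

text \<open>The chain rule along a line, from continuity of the partial derivatives: one coordinate is added
  at a time.\<close>

lemma jet_line_derivative_partial:
  fixes U :: "'n::finite multiindex \<Rightarrow> real ^ 'n \<Rightarrow> real"
  assumes U: "jet U" and A: "finite A"
  shows "((\<lambda>s. U \<beta> (z + (\<Sum>i\<in>A. (s * v $ i) *\<^sub>R axis i 1))) has_real_derivative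
     (\<Sum>i\<in>A. v $ i * U (inc \<beta> i) (z + (\<Sum>i\<in>A. (s * v $ i) *\<^sub>R axis i 1)))) (at s)"
  using A
proof (induction A arbitrary: z s rule: finite_induct)
  case empty
  then show ?case by simp
next
  case (insert j A)
  define P where "P s = (\<Sum>i\<in>A. (s * v $ i) *\<^sub>R axis i 1 :: real ^ 'n)" for s
  define f where "f s t = U \<beta> (z + P s + (t * v $ j) *\<^sub>R axis j 1)" for s t
  define g where "g s t = v $ j * U (inc \<beta> j) (z + P s + (t * v $ j) *\<^sub>R axis j 1)" for s t
  define D where "D = (\<Sum>i\<in>A. v $ i * U (inc \<beta> i) (z + P s + (s * v $ j) *\<^sub>R axis j 1))"
  have fx: "((\<lambda>s. f s s') has_derivative (*) (\<Sum>i\<in>A. v $ i * U (inc \<beta> i) (z + P s + (s' * v $ j) *\<^sub>R axis j 1))) (at s)" for s s'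
    using insert.IH[of "z + (s' * v $ j) *\<^sub>R axis j 1" s]
    by (simp add: f_def P_def has_field_derivative_def algebra_simps del: fun_upd_apply)
  have fy: "((\<lambda>t. f s t) has_real_derivative g s t) (at t)" for s t
  proof -
    have "((\<lambda>t. U \<beta> ((z + P s) + t *\<^sub>R axis j 1)) has_real_derivative U (inc \<beta> j) (z + P s + (v $ j * t) *\<^sub>R axis j 1)) (at (v $ j * t))"
      by (rule pdiff_line[OF jet_pdiff[OF U]])
    then have "((\<lambda>t. U \<beta> ((z + P s) + (v $ j * t) *\<^sub>R axis j 1)) has_real_derivative U (inc \<beta> j) (z + P s + (v $ j * t) *\<^sub>R axis j 1) * v $ j) (at t)"
      by (rule DERIV_chain2) (auto intro!: derivative_eq_intros)
    then show ?thesis by (simp add: f_def g_def mult.commute)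
  qed
  have gc: "continuous_on UNIV (\<lambda>(s, t). g s t)"
    unfolding g_def split_beta P_def
    by (intro continuous_intros continuous_on_compose2[OF jet_continuous[OF U, of UNIV]]) auto
  have "((\<lambda>(s, t). f s t) has_derivative (\<lambda>(ts, tt). D * ts + blinfun_apply (blinfun_mult_right (g s s)) tt)) (at (s, s) within UNIV \<times> UNIV)"
  proof (rule has_derivative_partialsI[where fy = "\<lambda>s t. blinfun_mult_right (g s t)"])
    show "((\<lambda>x. f x s) has_derivative (*) D) (at s)" unfolding D_def by (rule fx)
    show "(f x has_derivative blinfun_apply (blinfun_mult_right (g x y))) (at y)" for x y
      using fy[of x y] unfolding has_field_derivative_eq_has_derivative_blinfun by simp
    have "isCont (\<lambda>(s, t). g s t) (s, s)" using gc by (simp add: continuous_on_eq_continuous_at)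
    then have "isCont (\<lambda>x. blinfun_mult_right (case x of (s, t) \<Rightarrow> g s t)) (s, s)"
      by (rule bounded_linear.isCont[OF bounded_linear_blinfun_mult_right])
    then show "continuous (at (s, s) within UNIV \<times> UNIV) (\<lambda>(x, y). blinfun_mult_right (g x y))"
      by (simp add: split_beta')
  qed auto
  then have "((\<lambda>(s, t). f s t) has_derivative (\<lambda>(ts, tt). D * ts + g s s * tt)) (at (s, s))"
    by (simp add: blinfun_mult_right.rep_eq mult.commute)
  moreover have "((\<lambda>s. (s, s)) has_derivative (\<lambda>s. (s, s))) (at s)"
    by (intro derivative_intros)
  ultimately have "((\<lambda>s. (case (s, s) of (s, t) \<Rightarrow> f s t)) has_derivative (\<lambda>h. (case (h, h) of (ts, tt) \<Rightarrow> D * ts + g s s * tt))) (at s)"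
    by (rule has_derivative_compose[rotated])
  then have "((\<lambda>s. f s s) has_real_derivative (D + g s s)) (at s)"
    by (simp add: has_field_derivative_def distrib_right[symmetric]) 
  then show ?case
    using insert.hyps by (simp add: f_def g_def D_def P_def algebra_simps del: fun_upd_apply)
qed

lemma jet_line_derivative:
  fixes U :: "'n::finite multiindex \<Rightarrow> real ^ 'n \<Rightarrow> real"
  assumes U: "jet U"
  shows "((\<lambda>s. U \<beta> (y + s *\<^sub>R v)) has_real_derivative
     (\<Sum>i\<in>UNIV. v $ i * U (inc \<beta> i) (y + s *\<^sub>R v))) (at s)"
proof -
  have "(\<Sum>i\<in>UNIV. (s * v $ i) *\<^sub>R axis i 1) = s *\<^sub>R v" for s
    using basis_expansion[of "s *\<^sub>R v"] by (simp add: scalar_mult_eq_scaleR)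
  then show ?thesis using jet_line_derivative_partial[OF U, of UNIV \<beta> y v s] by simp
qed

lemma dir_deriv_line_derivative:
  fixes U :: "'n::finite multiindex \<Rightarrow> real ^ 'n \<Rightarrow> real"
  assumes U: "jet U"
  shows "((\<lambda>s. dir_deriv U k \<beta> (y + s *\<^sub>R v) v) has_real_derivative dir_deriv U (Suc k) \<beta> (y + s *\<^sub>R v) v) (at s)"
proof (induction k arbitrary: \<beta>)
  case 0
  then show ?case using jet_line_derivative[OF U] by simp
next
  case (Suc k)
  have "((\<lambda>s. \<Sum>i\<in>UNIV. v $ i * dir_deriv U k (inc \<beta> i) (y + s *\<^sub>R v) v) has_real_derivative
      (\<Sum>i\<in>UNIV. v $ i * dir_deriv U (Suc k) (inc \<beta> i) (y + s *\<^sub>R v) v)) (at s)"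
    by (intro DERIV_sum DERIV_cmult Suc.IH)
  then show ?case by simp
qed

lemma dir_deriv_bound:
  assumes "\<And>\<gamma>. mi_order \<gamma> = mi_order \<beta> + k \<Longrightarrow> \<bar>U \<gamma> z\<bar> \<le> M" and "M \<ge> 0"
  shows "\<bar>dir_deriv U k \<beta> z v\<bar> \<le> (\<Sum>i\<in>UNIV. \<bar>v $ i\<bar>) ^ k * M"
  using assms(1)
proof (induction k arbitrary: \<beta>)
  case 0
  then show ?case by simp
next
  case (Suc k)
  have IH: "\<bar>dir_deriv U k (inc \<beta> i) z v\<bar> \<le> (\<Sum>i\<in>UNIV. \<bar>v $ i\<bar>) ^ k * M" for i
    by (rule Suc.IH) (use Suc.prems in \<open>simp del: fun_upd_apply\<close>)
  have "\<bar>dir_deriv U (Suc k) \<beta> z v\<bar> \<le> (\<Sum>i\<in>UNIV. \<bar>v $ i * dir_deriv U k (inc \<beta> i) z v\<bar>)"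
    by (simp add: sum_abs)
  also have "\<dots> \<le> (\<Sum>i\<in>UNIV. \<bar>v $ i\<bar> * ((\<Sum>i\<in>UNIV. \<bar>v $ i\<bar>) ^ k * M))"
    unfolding abs_mult by (intro sum_mono mult_left_mono IH) auto
  also have "\<dots> = (\<Sum>i\<in>UNIV. \<bar>v $ i\<bar>) ^ Suc k * M"
    by (simp add: sum_distrib_right mult.assoc)
  finally show ?case .
qed

lemma continuous_dir_deriv:
  assumes U: "jet U" and f: "continuous_on S f" and g: "continuous_on S g"
  shows "continuous_on S (\<lambda>y. dir_deriv U k \<beta> (f y) (g y))"
proof (induction k arbitrary: \<beta>)
  case 0
  then show ?case using continuous_on_compose2[OF jet_continuous[OF U, of UNIV] f] by simp
next
  case (Suc k)
  then show ?case by (auto intro!: continuous_intros g)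
qed

lemma poly_space_add: "p \<in> poly_space l \<Longrightarrow> q \<in> poly_space l \<Longrightarrow> (\<lambda>x. p x + q x) \<in> poly_space l"
proof -
  assume "p \<in> poly_space l" "q \<in> poly_space l"
  then obtain c d where "\<And>x. p x = (\<Sum>\<beta> | mi_order \<beta> \<le> l. c \<beta> * monomial_fun \<beta> x)"
    "\<And>x. q x = (\<Sum>\<beta> | mi_order \<beta> \<le> l. d \<beta> * monomial_fun \<beta> x)"
    unfolding poly_space_def by blast
  then show ?thesis unfolding poly_space_def
    by (intro CollectI exI[of _ "\<lambda>\<beta>. c \<beta> + d \<beta>"]) (simp add: distrib_right sum.distrib)
qed

lemma poly_space_cmult: "p \<in> poly_space l \<Longrightarrow> (\<lambda>x. a * p x) \<in> poly_space l"
proof -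
  assume "p \<in> poly_space l"
  then obtain c where "\<And>x. p x = (\<Sum>\<beta> | mi_order \<beta> \<le> l. c \<beta> * monomial_fun \<beta> x)"
    unfolding poly_space_def by blast
  then show ?thesis unfolding poly_space_def
    by (intro CollectI exI[of _ "\<lambda>\<beta>. a * c \<beta>"]) (simp add: sum_distrib_left mult.assoc)
qed

lemma poly_space_zero: "(\<lambda>x. 0) \<in> poly_space l"
  unfolding poly_space_def by (intro CollectI exI[of _ "\<lambda>_. 0"]) simp

lemma poly_space_sum:
  "finite A \<Longrightarrow> (\<And>a. a \<in> A \<Longrightarrow> p a \<in> poly_space l) \<Longrightarrow> (\<lambda>x. \<Sum>a\<in>A. p a x) \<in> poly_space l"
  by (induction A rule: finite_induct) (auto intro: poly_space_add poly_space_zero)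

lemma poly_space_monomial: "mi_order \<beta> \<le> l \<Longrightarrow> monomial_fun \<beta> \<in> poly_space l"
  unfolding poly_space_def
proof (intro CollectI exI[of _ "\<lambda>\<gamma>. if \<gamma> = \<beta> then 1 else 0"] allI)
  fix x assume "mi_order \<beta> \<le> l"
  then show "monomial_fun \<beta> x = (\<Sum>\<gamma> | mi_order \<gamma> \<le> l. (if \<gamma> = \<beta> then 1 else 0) * monomial_fun \<gamma> x)"
    by (subst sum.mono_neutral_right[of _ "{\<beta>}"]) auto
qed

lemma poly_space_mono: "l \<le> l' \<Longrightarrow> poly_space l \<subseteq> poly_space l'"
proof
  fix p :: "real ^ 'a \<Rightarrow> real" assume l: "l \<le> l'" and "p \<in> poly_space l"
  then obtain c where c: "p = (\<lambda>x. \<Sum>\<beta> | mi_order \<beta> \<le> l. c \<beta> * monomial_fun \<beta> x)"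
    unfolding poly_space_def by blast
  show "p \<in> poly_space l'"
    unfolding c using l by (intro poly_space_sum poly_space_cmult poly_space_monomial) auto
qed

lemma poly_space_const: "(\<lambda>x. a) \<in> poly_space l"
proof -
  have "(\<lambda>x. a * monomial_fun zero_mi x) \<in> poly_space l"
    by (intro poly_space_cmult poly_space_monomial) simp
  then show ?thesis by (simp add: monomial_fun_def)
qed

lemma poly_space_mult_coord: "p \<in> poly_space l \<Longrightarrow> (\<lambda>x. x $ i * p x) \<in> poly_space (Suc l)"
proof -
  assume "p \<in> poly_space l"
  then obtain c where c: "p = (\<lambda>x. \<Sum>\<beta> | mi_order \<beta> \<le> l. c \<beta> * monomial_fun \<beta> x)"
    unfolding poly_space_def by blast
  have "x $ i * monomial_fun \<beta> x = monomial_fun (inc \<beta> i) x" for x \<beta>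
  proof -
    have "(\<Prod>j\<in>UNIV - {i}. (x $ j) ^ inc \<beta> i j) = (\<Prod>j\<in>UNIV - {i}. (x $ j) ^ \<beta> j)"
      by (intro prod.cong) auto
    then show ?thesis unfolding monomial_fun_def by (simp add: prod.remove[of UNIV i])
  qed
  then have "(\<lambda>x. x $ i * p x) = (\<lambda>x. \<Sum>\<beta> | mi_order \<beta> \<le> l. c \<beta> * monomial_fun (inc \<beta> i) x)"
    unfolding c sum_distrib_left by (auto simp: fun_eq_iff mult.left_commute)
  then show ?thesis by (auto intro!: poly_space_sum poly_space_cmult poly_space_monomial)
qed

text \<open>The terms of a Taylor expansion, as functions of the point, are polynomials in the sense of
  \<open>poly_space\<close>.\<close>

lemma poly_space_dir_deriv: "(\<lambda>x. dir_deriv U k \<beta> y (x - y)) \<in> poly_space k"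
proof (induction k arbitrary: \<beta>)
  case 0
  then show ?case using poly_space_const by simp
next
  case (Suc k)
  have "(\<lambda>x. x $ i * dir_deriv U k (inc \<beta> i) y (x - y) + (- (y $ i)) * dir_deriv U k (inc \<beta> i) y (x - y)) \<in> poly_space (Suc k)" for i
    by (intro poly_space_add poly_space_mult_coord poly_space_cmult Suc.IH subsetD[OF poly_space_mono[of k "Suc k"] Suc.IH]) auto
  moreover have "x $ i * dir_deriv U k (inc \<beta> i) y (x - y) + (- (y $ i)) * dir_deriv U k (inc \<beta> i) y (x - y)
     = (x - y) $ i * dir_deriv U k (inc \<beta> i) y (x - y)" for x i by (simp add: algebra_simps)
  ultimately have "(\<lambda>x. \<Sum>i\<in>UNIV. (x - y) $ i * dir_deriv U k (inc \<beta> i) y (x - y)) \<in> poly_space (Suc k)"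
    by (intro poly_space_sum) auto
  then show ?case by simp
qed

definition taylor_poly :: "nat \<Rightarrow> ('n::finite multiindex \<Rightarrow> real ^ 'n \<Rightarrow> real) \<Rightarrow> real ^ 'n \<Rightarrow> real ^ 'n \<Rightarrow> real" where
  "taylor_poly m U y x = (\<Sum>k<m. dir_deriv U k zero_mi y (x - y) / fact k)"

lemma taylor_poly_in_poly_space: "taylor_poly m U y \<in> poly_space m"
proof -
  have "(\<lambda>x. \<Sum>k<m. (1 / fact k) * dir_deriv U k zero_mi y (x - y)) \<in> poly_space m"
    by (intro poly_space_sum poly_space_cmult subsetD[OF poly_space_mono poly_space_dir_deriv]) auto
  then show ?thesis by (simp add: taylor_poly_def[abs_def])
qed

definition taylor_rem :: "nat \<Rightarrow> ('n::finite multiindex \<Rightarrow> real ^ 'n \<Rightarrow> real) \<Rightarrow> real ^ 'n \<Rightarrow> real ^ 'n \<Rightarrow> real" where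
  "taylor_rem m U y x = U zero_mi x - taylor_poly m U y x"

lemma continuous_taylor_rem:
  assumes "jet U" shows "continuous_on S (\<lambda>y. taylor_rem m U y x)"
  unfolding taylor_rem_def taylor_poly_def
  by (intro continuous_intros continuous_dir_deriv assms) auto

lemma taylor_rem_integral:
  fixes U :: "'n::finite multiindex \<Rightarrow> real ^ 'n \<Rightarrow> real"
  assumes U: "jet U" and m: "m > 0"
  shows "((\<lambda>s. (1 - s) ^ (m - 1) / fact (m - 1) * dir_deriv U m zero_mi (y + s *\<^sub>R (x - y)) (x - y))
     has_integral taylor_rem m U y x) {0..1}"
proof -
  let ?D = "\<lambda>k s. dir_deriv U k zero_mi (y + s *\<^sub>R (x - y)) (x - y)"
  have "((\<lambda>s. ((1 - s) ^ (m - 1) / fact (m - 1)) *\<^sub>R ?D m s) has_integral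
      ?D 0 1 - (\<Sum>k<m. ((1 - 0) ^ k / fact k) *\<^sub>R ?D k 0)) {0..1}"
    by (rule Taylor_has_integral[OF m refl])
      (simp_all add: has_real_derivative_iff_has_vector_derivative[symmetric]
        DERIV_subset[OF dir_deriv_line_derivative[OF U]] del: dir_deriv.simps)
  then show ?thesis by (simp add: taylor_rem_def taylor_poly_def)
qed

section \<open>The Sobolev estimate for a local polynomial reproduction\<close>

definition local_energy :: "nat \<Rightarrow> ('n::finite multiindex \<Rightarrow> real ^ 'n \<Rightarrow> real) \<Rightarrow> (real ^ 'n) set \<Rightarrow> real" where
  "local_energy m U A = (\<integral>x. indicator A x * edens m U x \<partial>lborel)"

lemma integrable_cube_continuous:
  fixes f :: "real ^ 'n::finite \<Rightarrow> real"
  assumes "continuous_on UNIV f" shows "integrable lborel (\<lambda>y. indicator (cube \<alpha> w) y * f y)"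
proof -
  have "integrable lborel (\<lambda>y. indicator (cube \<alpha> w) y *\<^sub>R f y)"
    by (intro borel_integrable_compact continuous_on_subset[OF assms]) auto
  then show ?thesis by simp
qed

lemma local_energy_nonneg [simp]: "local_energy m U A \<ge> 0"
  unfolding local_energy_def by (intro integral_nonneg_AE) auto

text \<open>For fixed \<open>x\<close> the map \<open>y \<mapsto> y + s (x - y)\<close> maps the cube into itself and multiplies volumes
  by \<open>(1 - s) ^ CARD('n)\<close>.\<close>

lemma nn_integral_scaled_cube:
  fixes g :: "real ^ 'n::finite \<Rightarrow> real"
  assumes x: "x \<in> cube \<alpha> w" and s: "0 \<le> s" "s < 1" and g: "g \<in> borel_measurable borel" and g0: "\<And>z. g z \<ge> 0"
  shows "ennreal ((1 - s) ^ CARD('n)) * (\<integral>\<^sup>+y. indicator (cube \<alpha> w) y * ennreal (g (y + s *\<^sub>R (x - y))) \<partial>lborel)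
    \<le> (\<integral>\<^sup>+z. indicator (cube \<alpha> w) z * ennreal (g z) \<partial>lborel)"
proof -
  define F where "F z = indicator (cube \<alpha> w) z * ennreal (g z)" for z
  have [measurable]: "g \<in> borel_measurable borel" by (rule g)
  have [measurable]: "F \<in> borel_measurable borel" unfolding F_def[abs_def] by measurable
  have "(\<integral>\<^sup>+z. F z \<partial>lborel) = (\<integral>\<^sup>+z. F z \<partial>density (distr lborel borel (\<lambda>y. s *\<^sub>R x + (1 - s) *\<^sub>R y)) (\<lambda>_. \<bar>1 - s\<bar> ^ DIM(real ^ 'n)))"
    using s by (subst lborel_affine[of "1 - s" "s *\<^sub>R x"]) auto
  also have "\<dots> = ennreal ((1 - s) ^ CARD('n)) * (\<integral>\<^sup>+y. F (s *\<^sub>R x + (1 - s) *\<^sub>R y) \<partial>lborel)"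
    using s by (subst nn_integral_density) (auto simp: nn_integral_distr nn_integral_cmult)
  finally have eq: "(\<integral>\<^sup>+z. F z \<partial>lborel) = ennreal ((1 - s) ^ CARD('n)) * (\<integral>\<^sup>+y. F (s *\<^sub>R x + (1 - s) *\<^sub>R y) \<partial>lborel)" .
  have "(\<integral>\<^sup>+y. indicator (cube \<alpha> w) y * ennreal (g (y + s *\<^sub>R (x - y))) \<partial>lborel) \<le> (\<integral>\<^sup>+y. F (s *\<^sub>R x + (1 - s) *\<^sub>R y) \<partial>lborel)"
  proof (rule nn_integral_mono)
    fix y
    have e: "y + s *\<^sub>R (x - y) = s *\<^sub>R x + (1 - s) *\<^sub>R y" by (simp add: algebra_simps)
    have "s *\<^sub>R x + (1 - s) *\<^sub>R y \<in> cube \<alpha> w" if "y \<in> cube \<alpha> w"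
      using convex_cube[of \<alpha> w] x that s unfolding convex_def by auto
    then show "indicator (cube \<alpha> w) y * ennreal (g (y + s *\<^sub>R (x - y))) \<le> F (s *\<^sub>R x + (1 - s) *\<^sub>R y)"
      unfolding e by (auto simp: F_def indicator_def)
  qed
  then show ?thesis unfolding eq[unfolded F_def[abs_def], symmetric] F_def[symmetric]
    using eq by (simp add: mult_left_mono)
qed

lemma nn_integral_one_minus_powr:
  assumes "a > 0"
  shows "(\<integral>\<^sup>+s. ennreal (indicator {0..<1} s * (1 - s) powr (a - 1)) \<partial>lborel) = ennreal (1 / a)"
proof -
  have "((\<lambda>x. x powr (a - 1)) has_integral (1 powr (a - 1 + 1) / (a - 1 + 1))) {0..1}"
    using assms by (intro has_integral_powr_from_0) auto
  then have "((\<lambda>x. x powr (a - 1)) has_integral (1 / a)) (cbox 0 1)" by simp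
  from has_integral_affinity[OF this, of "- 1" 1]
  have "((\<lambda>s. (1 - s) powr (a - 1)) has_integral (1 / a)) {0..1}"
    by (simp add: image_diff_atLeastAtMost image_affinity_atLeastAtMost)
  then have "((\<lambda>s. indicator {0..<1} s * (1 - s) powr (a - 1)) has_integral (1 / a)) {0..1}"
    by (rule has_integral_spike[where S = "{1}", rotated 2]) (auto simp: indicator_def)
  then have "((\<lambda>s. indicator {0..<1} s * (1 - s) powr (a - 1)) has_integral (1 / a)) UNIV"
    by (rule has_integral_on_superset) auto
  then show ?thesis
    by (intro nn_integral_has_integral_lborel) (auto intro!: mult_nonneg_nonneg)
qed

text \<open>The remainder is averaged over the base point \<open>y\<close>.  After exchanging the integrals over \<open>y\<close> and \<open>s\<close>, the
  previous lemma bounds the integral over \<open>y\<close> by the energy in the cube at the price of the factor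
  \<open>(1 - s) ^ - CARD('n)\<close>.  The square root of the energy density is first split by the inequality between
  arithmetic and geometric mean, with weights \<open>l * (1 - s) powr (- CARD('n) / 2)\<close> chosen such that both
  parts lead to the same integral of \<open>(1 - s) powr (\<mu> - 1)\<close>.  It converges because \<open>m\<close> exceeds half the
  dimension.\<close>

lemma taylor_rem_average:
  fixes U :: "'n::finite multiindex \<Rightarrow> real ^ 'n \<Rightarrow> real"
  assumes U: "jet U" and m: "real m > real CARD('n) / 2" and w: "w > 0"
    and x: "x \<in> cube \<alpha> w" and l: "l > 0"
  defines "\<mu> \<equiv> real m - real CARD('n) / 2"
  shows "(\<integral>y. indicator (cube \<alpha> w) y * \<bar>taylor_rem m U y x\<bar> \<partial>lborel)
     \<le> (2 * w * CARD('n)) ^ m / (2 * \<mu>) * (l * (2 * w) ^ CARD('n) + local_energy m U (cube \<alpha> w) / l)"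
proof -
  let ?Q = "cube \<alpha> w" and ?d = "CARD('n)"
  define E where "E = local_energy m U ?Q"
  define c where "c = (2 * w * ?d) ^ m"
  have c0: "c \<ge> 0" using w by (simp add: c_def)
  have \<mu>: "\<mu> > 0" using m by (simp add: \<mu>_def)
  have m0: "m > 0" using m by (cases m) auto
  have Em [measurable]: "edens m U \<in> borel_measurable borel" by (rule edens_borel[OF U])
  \<comment> \<open>The bound for the integrand of the remainder that arises from the inequality between the means.\<close>
  define h where "h s y = ennreal (c / 2 * l) * ennreal (indicator {0..<1} s * (1 - s) powr (\<mu> - 1))
     + ennreal (c / (2 * l)) * (ennreal (indicator {0..<1} s * (1 - s) powr (\<mu> - 1)) * (ennreal ((1 - s) ^ ?d) * ennreal (edens m U (y + s *\<^sub>R (x - y)))))"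
    for s and y :: "real ^ 'n"
  have hm: "(\<lambda>(y, s). indicator ?Q y * h s y) \<in> borel_measurable (borel \<Otimes>\<^sub>M borel)"
    unfolding h_def by measurable
  have pw: "ennreal \<bar>taylor_rem m U y x\<bar> \<le> (\<integral>\<^sup>+s. h s y \<partial>lborel)" if y: "y \<in> ?Q" for y
  proof -
    let ?f = "\<lambda>s. (1 - s) ^ (m - 1) / fact (m - 1) * dir_deriv U m zero_mi (y + s *\<^sub>R (x - y)) (x - y)"
    let ?g = "\<lambda>s. c * ((1 - s) ^ (m - 1) * sqrt (edens m U (y + s *\<^sub>R (x - y))))"
    have gc: "continuous_on {0..1} ?g"
      by (intro continuous_intros continuous_on_compose2[OF continuous_edens[OF U, of UNIV]]) auto
    have fg: "norm (?f s) \<le> ?g s" if s: "s \<in> {0..1}" for s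
    proof -
      let ?z = "y + s *\<^sub>R (x - y)"
      have "\<bar>dir_deriv U m zero_mi ?z (x - y)\<bar> \<le> (\<Sum>i\<in>UNIV. \<bar>(x - y) $ i\<bar>) ^ m * sqrt (edens m U ?z)"
      proof (rule dir_deriv_bound)
        fix \<gamma> :: "'n multiindex" assume "mi_order \<gamma> = mi_order zero_mi + m"
        then have "(U \<gamma> ?z)\<^sup>2 \<le> edens m U ?z" by (intro sq_le_edens) simp
        then show "\<bar>U \<gamma> ?z\<bar> \<le> sqrt (edens m U ?z)" by (metis real_sqrt_abs real_sqrt_le_iff)
      qed simp
      also have "\<dots> \<le> c * sqrt (edens m U ?z)"
      proof (intro mult_right_mono)
        have "\<bar>(x - y) $ i\<bar> \<le> 2 * w" for i
        proof -
          have "\<bar>(x - \<alpha>) $ i\<bar> \<le> w" "\<bar>(y - \<alpha>) $ i\<bar> \<le> w" using x y by (auto simp: cube_def infnorm_le_iff)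
          then show ?thesis by simp
        qed
        then have "(\<Sum>i\<in>UNIV. \<bar>(x - y) $ i\<bar>) \<le> of_nat ?d * (2 * w)" by (intro sum_bounded_above) auto
        then show "(\<Sum>i\<in>UNIV. \<bar>(x - y) $ i\<bar>) ^ m \<le> c"
          unfolding c_def by (intro power_mono) (auto simp: mult_ac intro: sum_nonneg)
      qed simp
      finally have *: "\<bar>dir_deriv U m zero_mi ?z (x - y)\<bar> \<le> c * sqrt (edens m U ?z)" .
      have "norm (?f s) = (1 - s) ^ (m - 1) / fact (m - 1) * \<bar>dir_deriv U m zero_mi ?z (x - y)\<bar>"
        using s by (simp add: abs_mult)
      also have "\<dots> \<le> (1 - s) ^ (m - 1) * (c * sqrt (edens m U ?z))"
        using s * by (intro mult_mono) (auto simp: divide_le_eq fact_ge_1 mult_le_cancel_left1)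
      finally show ?thesis by (simp add: mult_ac)
    qed
    have "norm (integral {0..1} ?f) \<le> integral {0..1} ?g"
      by (rule integral_norm_bound_integral[OF has_integral_integrable[OF taylor_rem_integral[OF U m0]]
            integrable_continuous_interval[OF gc] fg])
    then have "\<bar>taylor_rem m U y x\<bar> \<le> integral {0..1} ?g"
      unfolding integral_unique[OF taylor_rem_integral[OF U m0]] real_norm_def .
    also have "ennreal (integral {0..1} ?g) = (\<integral>\<^sup>+s. ennreal (indicator {0..1} s * ?g s) \<partial>lborel)"
    proof (rule nn_integral_has_integral_lborel[symmetric])
      have "(?g has_integral integral {0..1} ?g) {0..1}"
        using gc by (intro integrable_integral integrable_continuous_interval)
      then have "((\<lambda>s. indicator {0..1} s * ?g s) has_integral integral {0..1} ?g) {0..1}"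
        by (rule has_integral_eq[rotated]) auto
      then show "((\<lambda>s. indicator {0..1} s * ?g s) has_integral integral {0..1} ?g) UNIV"
        by (rule has_integral_on_superset) auto
    qed (use c0 in \<open>auto intro!: mult_nonneg_nonneg simp: indicator_def\<close>)
    finally have "ennreal \<bar>taylor_rem m U y x\<bar> \<le> (\<integral>\<^sup>+s. ennreal (indicator {0..1} s * ?g s) \<partial>lborel)"
      by (simp add: ennreal_leI)
    also have "\<dots> = (\<integral>\<^sup>+s. ennreal (indicator {0..<1} s * ?g s) \<partial>lborel)"
    proof (rule nn_integral_cong_AE)
      show "AE s in lborel. ennreal (indicator {0..1} s * ?g s) = ennreal (indicator {0..<1} s * ?g s)"
        using AE_lborel_singleton[of 1] by eventually_elim (auto simp: indicator_def)
    qed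
    also have "\<dots> \<le> (\<integral>\<^sup>+s. h s y \<partial>lborel)"
    proof (rule nn_integral_mono)
      fix s :: real
      show "ennreal (indicator {0..<1} s * ?g s) \<le> h s y"
      proof (cases "s \<in> {0..<1}")
        case True
        define r where "r = 1 - s"
        have r: "r > 0" using True by (simp add: r_def)
        define e where "e = edens m U (y + s *\<^sub>R (x - y))"
        have e0: "e \<ge> 0" by (simp add: e_def)
        have r1: "r powr (\<mu> - 1) * r ^ ?d = r powr (real m - 1 + real ?d / 2)"
          using r by (simp add: powr_realpow[symmetric] powr_add[symmetric] \<mu>_def add.commute)
        have r2: "r ^ (m - 1) = r powr (real m - 1)"
          using r m0 by (simp add: powr_realpow[symmetric] of_nat_diff)
        define A where "A = r powr (- real ?d / 2)"
        have A: "A > 0" using r by (simp add: A_def)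
        have rA: "r powr (\<mu> - 1) = r powr (real m - 1) * A" "r powr (real m - 1 + real ?d / 2) = r powr (real m - 1) / A"
          using r by (simp_all add: A_def \<mu>_def powr_add[symmetric] powr_diff[symmetric] powr_minus_divide[symmetric] algebra_simps)
        have "2 * sqrt e \<le> l * A + e / (A * l)"
        proof -
          have "0 \<le> (l * A - sqrt e)\<^sup>2 / (A * l)" using A l by simp
          also have "\<dots> = l * A - 2 * sqrt e + e / (A * l)"
            using A l e0 by (simp add: power2_diff field_simps power2_eq_square)
          finally show ?thesis by simp
        qed
        then have "r powr (real m - 1) * (2 * sqrt e) \<le> r powr (real m - 1) * (l * A + e / (A * l))"
          by (intro mult_left_mono) auto
        then have "2 * (r ^ (m - 1) * sqrt e) \<le> l * r powr (\<mu> - 1) + r powr (\<mu> - 1) * (r ^ ?d * e) / l"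
        proof -
          have "r powr (\<mu> - 1) * (r ^ ?d * e) = (r powr (\<mu> - 1) * r ^ ?d) * e" by simp
          also have "\<dots> = r powr (real m - 1) / A * e" unfolding r1 rA(2) ..
          finally have t: "r powr (\<mu> - 1) * (r ^ ?d * e) = r powr (real m - 1) / A * e" .
          assume "r powr (real m - 1) * (2 * sqrt e) \<le> r powr (real m - 1) * (l * A + e / (A * l))"
          then show ?thesis unfolding t unfolding r2 rA(1) by (simp add: algebra_simps)
        qed
        then have "c / 2 * (2 * (r ^ (m - 1) * sqrt e)) \<le> c / 2 * (l * r powr (\<mu> - 1) + r powr (\<mu> - 1) * (r ^ ?d * e) / l)"
          using c0 by (intro mult_left_mono) auto
        then have "c * (r ^ (m - 1) * sqrt e) \<le> (c / 2 * l) * r powr (\<mu> - 1) + (c / (2 * l)) * (r powr (\<mu> - 1) * (r ^ ?d * e))"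
          using l by (simp add: field_simps)
        then have "ennreal (c * (r ^ (m - 1) * sqrt e)) \<le>
            ennreal (c / 2 * l) * ennreal (r powr (\<mu> - 1)) + ennreal (c / (2 * l)) * (ennreal (r powr (\<mu> - 1)) * (ennreal (r ^ ?d) * ennreal e))"
          using c0 l r e0 by (simp add: ennreal_mult[symmetric] ennreal_plus[symmetric] del: ennreal_plus)
        then show ?thesis
          using True by (simp add: h_def r_def e_def)
      qed (simp add: h_def)
    qed
    finally show ?thesis .
  qed
  have int: "integrable lborel (\<lambda>y. indicator ?Q y * \<bar>taylor_rem m U y x\<bar>)"
    by (intro integrable_cube_continuous continuous_intros continuous_taylor_rem U)
  have Enn: "(\<integral>\<^sup>+z. indicator ?Q z * ennreal (edens m U z) \<partial>lborel) = ennreal E"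
  proof -
    have "(\<integral>\<^sup>+z. ennreal (indicator ?Q z * edens m U z) \<partial>lborel) = ennreal E"
      unfolding E_def local_energy_def
      by (intro nn_integral_eq_integral integrable_cube_continuous continuous_edens U) auto
    then show ?thesis by (simp add: ennreal_mult' ennreal_indicator)
  qed
  have E0: "E \<ge> 0" by (simp add: E_def)
  have "ennreal (\<integral>y. indicator ?Q y * \<bar>taylor_rem m U y x\<bar> \<partial>lborel) = (\<integral>\<^sup>+y. ennreal (indicator ?Q y * \<bar>taylor_rem m U y x\<bar>) \<partial>lborel)"
    using int by (intro nn_integral_eq_integral[symmetric]) auto
  also have "\<dots> \<le> (\<integral>\<^sup>+y. (\<integral>\<^sup>+s. indicator ?Q y * h s y \<partial>lborel) \<partial>lborel)"
  proof (rule nn_integral_mono)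
    fix y
    have "(\<lambda>s. h s y) \<in> borel_measurable borel" unfolding h_def by measurable
    then have "(\<integral>\<^sup>+s. indicator ?Q y * h s y \<partial>lborel) = indicator ?Q y * (\<integral>\<^sup>+s. h s y \<partial>lborel)"
      by (intro nn_integral_cmult) simp
    then show "ennreal (indicator ?Q y * \<bar>taylor_rem m U y x\<bar>) \<le> (\<integral>\<^sup>+s. indicator ?Q y * h s y \<partial>lborel)"
      using pw[of y] by (cases "y \<in> ?Q") auto
  qed
  also have "\<dots> = (\<integral>\<^sup>+s. (\<integral>\<^sup>+y. indicator ?Q y * h s y \<partial>lborel) \<partial>lborel)"
    by (rule lborel_pair.Fubini') (use hm in simp)
  also have "\<dots> \<le> (\<integral>\<^sup>+s. ennreal (c / 2 * (l * (2 * w) ^ ?d + E / l)) * ennreal (indicator {0..<1} s * (1 - s) powr (\<mu> - 1)) \<partial>lborel)"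
  proof (rule nn_integral_mono)
    fix s :: real
    define P where "P = ennreal (indicator {0..<1} s * (1 - s) powr (\<mu> - 1))"
    have [measurable]: "(\<lambda>y. edens m U (y + s *\<^sub>R (x - y))) \<in> borel_measurable borel" by measurable
    let ?J = "\<integral>\<^sup>+y. indicator ?Q y * ennreal (edens m U (y + s *\<^sub>R (x - y))) \<partial>lborel"
    have "(\<integral>\<^sup>+y. indicator ?Q y * h s y \<partial>lborel)
        = (\<integral>\<^sup>+y. (ennreal (c / 2 * l) * P) * indicator ?Q y
             + (ennreal (c / (2 * l)) * P * ennreal ((1 - s) ^ ?d)) * (indicator ?Q y * ennreal (edens m U (y + s *\<^sub>R (x - y)))) \<partial>lborel)"
      unfolding h_def P_def by (intro nn_integral_cong) (simp add: distrib_left mult_ac)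
    also have "\<dots> = (ennreal (c / 2 * l) * P) * ennreal ((2 * w) ^ ?d) + (ennreal (c / (2 * l)) * P * ennreal ((1 - s) ^ ?d)) * ?J"
      using w by (subst nn_integral_add) (auto simp: nn_integral_cmult emeasure_cube)
    also have "\<dots> \<le> ennreal (c / 2 * l) * P * ennreal ((2 * w) ^ ?d) + ennreal (c / (2 * l)) * P * ennreal E"
    proof (cases "s \<in> {0..<1}")
      case True
      then have "ennreal ((1 - s) ^ ?d) * ?J \<le> ennreal E"
        using nn_integral_scaled_cube[OF x, of s "edens m U"] unfolding Enn by auto
      then show ?thesis unfolding mult.assoc by (intro add_left_mono mult_left_mono) auto
    qed (simp add: P_def)
    also have "\<dots> = ennreal (c / 2 * (l * (2 * w) ^ ?d + E / l)) * P"
    proof -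
      have "ennreal (c / 2 * l) * ennreal ((2 * w) ^ ?d) + ennreal (c / (2 * l)) * ennreal E = ennreal (c / 2 * (l * (2 * w) ^ ?d + E / l))"
        using c0 l w E0 by (simp add: ennreal_mult[symmetric] ennreal_plus[symmetric] algebra_simps del: ennreal_plus)
      moreover have "a * P * v + b * P * u = (a * v + b * u) * P" for a b u v :: ennreal
        by (simp only: distrib_left mult_ac)
      ultimately show ?thesis by simp
    qed
    finally show "(\<integral>\<^sup>+y. indicator ?Q y * h s y \<partial>lborel) \<le> ennreal (c / 2 * (l * (2 * w) ^ ?d + E / l)) * ennreal (indicator {0..<1} s * (1 - s) powr (\<mu> - 1))"
      unfolding P_def .
  qed
  also have "\<dots> = ennreal (c / 2 * (l * (2 * w) ^ ?d + E / l)) * ennreal (1 / \<mu>)"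
    by (subst nn_integral_cmult) (auto simp: nn_integral_one_minus_powr[OF \<mu>])
  also have "\<dots> = ennreal (c / (2 * \<mu>) * (l * (2 * w) ^ ?d + E / l))"
    using c0 l w E0 \<mu> by (simp add: ennreal_mult[symmetric])
  finally show ?thesis
    using c0 l w E0 \<mu> by (subst (asm) ennreal_le_iff) (auto simp: c_def E_def)
qed

text \<open>A local polynomial reproduction at \<open>\<alpha>\<close> annihilates the error of the Taylor polynomial of \<open>U\<close> at any base
  point \<open>y\<close>, so the left-hand side may be computed from the remainders.  Averaging over \<open>y\<close> bounds it by the
  local energy; the parameter \<open>l\<close> is then chosen to balance the two terms.\<close>

lemma sobolev_reproduction:
  assumes m: "real m > real CARD('n::finite) / 2"
  obtains C where "C > 0"
    and "\<And>(U :: 'n multiindex \<Rightarrow> real ^ 'n \<Rightarrow> real) \<alpha> w S a K.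
     jet U \<Longrightarrow> w > 0 \<Longrightarrow> finite S \<Longrightarrow> \<forall>\<xi>\<in>S. a \<xi> \<noteq> 0 \<longrightarrow> \<xi> \<in> cube \<alpha> w \<Longrightarrow>
     \<forall>p\<in>poly_space m. (\<Sum>\<xi>\<in>S. a \<xi> * p \<xi>) = p \<alpha> \<Longrightarrow> (\<Sum>\<xi>\<in>S. \<bar>a \<xi>\<bar>) \<le> K \<Longrightarrow>
     (U zero_mi \<alpha> - (\<Sum>\<xi>\<in>S. a \<xi> * U zero_mi \<xi>))\<^sup>2
        \<le> C * (1 + K)\<^sup>2 * (w ^ (2 * m) / w ^ CARD('n)) * local_energy m U (cube \<alpha> w)"
proof -
  let ?d = "CARD('n)"
  define \<mu> where "\<mu> = real m - real ?d / 2"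
  have \<mu>: "\<mu> > 0" using m by (simp add: \<mu>_def)
  define C where "C = (2 * ?d) ^ (2 * m) / (\<mu>\<^sup>2 * 2 ^ ?d)"
  have C: "C > 0" using \<mu> by (simp add: C_def)
  have main: "(U zero_mi \<alpha> - (\<Sum>\<xi>\<in>S. a \<xi> * U zero_mi \<xi>))\<^sup>2
        \<le> C * (1 + K)\<^sup>2 * (w ^ (2 * m) / w ^ ?d) * local_energy m U (cube \<alpha> w)"
    if U: "jet U" and w: "w > 0" and S: "finite S" and supp: "\<forall>\<xi>\<in>S. a \<xi> \<noteq> 0 \<longrightarrow> \<xi> \<in> cube \<alpha> w"
      and rep: "\<forall>p\<in>poly_space m. (\<Sum>\<xi>\<in>S. a \<xi> * p \<xi>) = p \<alpha>" and K: "(\<Sum>\<xi>\<in>S. \<bar>a \<xi>\<bar>) \<le> K"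
    for U :: "'n multiindex \<Rightarrow> real ^ 'n \<Rightarrow> real" and \<alpha> w S a K
  proof -
    let ?Q = "cube \<alpha> w"
    define X where "X = \<bar>U zero_mi \<alpha> - (\<Sum>\<xi>\<in>S. a \<xi> * U zero_mi \<xi>)\<bar>"
    define E where "E = local_energy m U ?Q"
    define V where "V = (2 * w) ^ ?d"
    have V: "V > 0" using w by (simp add: V_def)
    have E0: "E \<ge> 0" by (simp add: E_def)
    have K0: "K \<ge> 0" using K sum_nonneg[of S "\<lambda>\<xi>. \<bar>a \<xi>\<bar>"] by linarith
    define c where "c = (1 + K) * ((2 * w * ?d) ^ m / (2 * \<mu>))"
    have c0: "c \<ge> 0" using K0 w \<mu> by (simp add: c_def)
    have bound: "X \<le> c * (l + (E / V) / l)" if l: "l > 0" for l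
    proof -
      define B where "B = (2 * w * ?d) ^ m / (2 * \<mu>) * (l * V + E / l)"
      have B: "(\<integral>y. indicator ?Q y * \<bar>taylor_rem m U y x\<bar> \<partial>lborel) \<le> B" if "x \<in> ?Q" for x
        unfolding B_def V_def E_def \<mu>_def by (rule taylor_rem_average[OF U m w that l])
      have B0: "B \<ge> 0" unfolding B_def using w \<mu> l V E0 by simp
      have int: "integrable lborel (\<lambda>y. indicator ?Q y * \<bar>taylor_rem m U y x\<bar>)" for x
        by (intro integrable_cube_continuous continuous_intros continuous_taylor_rem U)
      have pw: "X \<le> \<bar>taylor_rem m U y \<alpha>\<bar> + (\<Sum>\<xi>\<in>S. \<bar>a \<xi>\<bar> * \<bar>taylor_rem m U y \<xi>\<bar>)" for y
      proof -
        have "taylor_rem m U y \<alpha> - (\<Sum>\<xi>\<in>S. a \<xi> * taylor_rem m U y \<xi>)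
          = U zero_mi \<alpha> - (\<Sum>\<xi>\<in>S. a \<xi> * U zero_mi \<xi>)"
          using bspec[OF rep taylor_poly_in_poly_space[of m U y]]
          by (simp add: taylor_rem_def right_diff_distrib sum_subtractf)
        then have "X = \<bar>taylor_rem m U y \<alpha> - (\<Sum>\<xi>\<in>S. a \<xi> * taylor_rem m U y \<xi>)\<bar>" by (simp add: X_def)
        also have "\<dots> \<le> \<bar>taylor_rem m U y \<alpha>\<bar> + \<bar>\<Sum>\<xi>\<in>S. a \<xi> * taylor_rem m U y \<xi>\<bar>" by simp
        also have "\<bar>\<Sum>\<xi>\<in>S. a \<xi> * taylor_rem m U y \<xi>\<bar> \<le> (\<Sum>\<xi>\<in>S. \<bar>a \<xi>\<bar> * \<bar>taylor_rem m U y \<xi>\<bar>)"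
          unfolding abs_mult[symmetric] by (rule sum_abs)
        finally show ?thesis by simp
      qed
      have "X * V = (\<integral>y. indicator ?Q y * X \<partial>lborel)"
        using w by (simp add: measure_cube V_def)
      also have "\<dots> \<le> (\<integral>y. indicator ?Q y * \<bar>taylor_rem m U y \<alpha>\<bar> + (\<Sum>\<xi>\<in>S. \<bar>a \<xi>\<bar> * (indicator ?Q y * \<bar>taylor_rem m U y \<xi>\<bar>)) \<partial>lborel)"
      proof (rule integral_mono)
        show "integrable lborel (\<lambda>y. indicator ?Q y * X)" by (rule integrable_cube_continuous) simp
        show "integrable lborel (\<lambda>y. indicator ?Q y * \<bar>taylor_rem m U y \<alpha>\<bar> + (\<Sum>\<xi>\<in>S. \<bar>a \<xi>\<bar> * (indicator ?Q y * \<bar>taylor_rem m U y \<xi>\<bar>)))"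
          by (intro Bochner_Integration.integrable_add Bochner_Integration.integrable_sum integrable_mult_right int)
        show "indicator ?Q y * X \<le> indicator ?Q y * \<bar>taylor_rem m U y \<alpha>\<bar> + (\<Sum>\<xi>\<in>S. \<bar>a \<xi>\<bar> * (indicator ?Q y * \<bar>taylor_rem m U y \<xi>\<bar>))" for y
          using pw[of y] by (cases "y \<in> ?Q") auto
      qed
      also have "\<dots> = (\<integral>y. indicator ?Q y * \<bar>taylor_rem m U y \<alpha>\<bar> \<partial>lborel) + (\<Sum>\<xi>\<in>S. \<bar>a \<xi>\<bar> * (\<integral>y. indicator ?Q y * \<bar>taylor_rem m U y \<xi>\<bar> \<partial>lborel))"
        by (subst Bochner_Integration.integral_add)
          (auto intro!: Bochner_Integration.integrable_sum integrable_mult_right int simp: Bochner_Integration.integral_sum int)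
      also have "\<dots> \<le> B + (\<Sum>\<xi>\<in>S. \<bar>a \<xi>\<bar> * B)"
      proof (intro add_mono sum_mono)
        show "(\<integral>y. indicator ?Q y * \<bar>taylor_rem m U y \<alpha>\<bar> \<partial>lborel) \<le> B" using w by (intro B center_in_cube) simp
        fix \<xi> assume "\<xi> \<in> S"
        then show "\<bar>a \<xi>\<bar> * (\<integral>y. indicator ?Q y * \<bar>taylor_rem m U y \<xi>\<bar> \<partial>lborel) \<le> \<bar>a \<xi>\<bar> * B"
          using supp by (cases "a \<xi> = 0") (auto intro!: mult_left_mono B)
      qed
      also have "\<dots> \<le> (1 + K) * B"
        using K B0 mult_right_mono[OF K B0] by (simp add: sum_distrib_right distrib_right)
      finally have "X * V \<le> c * (l * V + E / l)" by (simp add: c_def B_def mult.assoc)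
      then have "X \<le> c * (l * V + E / l) / V" using V by (simp add: pos_le_divide_eq)
      also have "\<dots> = c * (l + (E / V) / l)" using V l by (simp add: field_simps)
      finally show ?thesis .
    qed
    have "X\<^sup>2 \<le> 4 * c\<^sup>2 * (E / V)"
    proof (cases "E = 0")
      case True
      have "X \<le> c * l" if "l > 0" for l using bound[OF that] True by simp
      then have "X \<le> 0 + e" if "e > 0" for e
      proof -
        have "X \<le> c * (e / (c + 1))" using \<open>\<And>l. l > 0 \<Longrightarrow> X \<le> c * l\<close>[of "e / (c + 1)"] c0 that by simp
        also have "\<dots> \<le> e" using c0 that by (simp add: field_simps)
        finally show ?thesis by simp
      qed
      then have "X \<le> 0" by (rule field_le_epsilon)
      moreover have "X \<ge> 0" by (simp add: X_def)
      ultimately show ?thesis using True by simp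
    next
      case False
      then have b: "E / V > 0" using E0 V by simp
      have "X \<le> c * (sqrt (E / V) + (E / V) / sqrt (E / V))" using b by (intro bound) simp
      also have "\<dots> = 2 * c * sqrt (E / V)"
        unfolding real_div_sqrt[OF less_imp_le[OF b]] by simp
      finally have "X \<le> 2 * c * sqrt (E / V)" .
      then have "X\<^sup>2 \<le> (2 * c * sqrt (E / V))\<^sup>2" by (intro power_mono) (simp_all add: X_def)
      also have "\<dots> = 4 * c\<^sup>2 * (E / V)" using b by (simp add: power_mult_distrib)
      finally show ?thesis .
    qed
    also have "4 * c\<^sup>2 * (E / V) = C * (1 + K)\<^sup>2 * (w ^ (2 * m) / w ^ ?d) * E"
    proof -
      define p q v g where "p = (2 * real ?d) ^ m" and "q = w ^ m" and "v = w ^ ?d" and "g = (2 :: real) ^ ?d"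
      have "(2 * w * ?d) ^ m = p * q" by (simp add: p_def q_def power_mult_distrib)
      moreover have "w ^ (2 * m) = q\<^sup>2" "(2 * real ?d) ^ (2 * m) = p\<^sup>2"
        by (simp_all add: p_def q_def power_even_eq)
      moreover have "V = g * v" by (simp add: V_def g_def v_def power_mult_distrib)
      moreover have "v > 0" "g > 0" using w by (simp_all add: v_def g_def)
      ultimately show ?thesis
        unfolding c_def C_def g_def[symmetric] v_def[symmetric]
        using \<mu> by (simp add: power_mult_distrib power_divide mult_ac)
    qed
    finally show ?thesis by (simp add: X_def E_def)
  qed
  show ?thesis by (rule that[OF C main])
qed

section \<open>Interpolation of intermediate derivatives\<close>

text \<open>If every term of a sequence is controlled by its neighbours, with an arbitrarily small constant for
  the successor, then it is controlled by the initial term and the successor.  The small constant absorbs the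
  occurrence of the term itself that the induction hypothesis produces.\<close>

lemma interpolation_sequence_step:
  fixes Cf :: "real \<Rightarrow> nat \<Rightarrow> real"
  assumes Cf: "\<And>\<delta> k. \<delta> > 0 \<Longrightarrow> Cf \<delta> k \<ge> 0" and d: "\<delta> > 0"
  shows "\<exists>A\<ge>0. \<forall>b. (\<forall>k. b k \<ge> 0) \<and> (\<forall>k. \<forall>\<delta>>0. b (Suc k) \<le> \<delta> * b (Suc (Suc k)) + Cf \<delta> k * b k)
     \<longrightarrow> b k \<le> A * b 0 + \<delta> * b (Suc k)"
  using d
proof (induction k arbitrary: \<delta>)
  case 0
  then show ?case by (intro exI[of _ 1]) auto
next
  case (Suc k)
  \<comment> \<open>Half of \<open>\<delta>\<close> remains for the successor, since absorbing half of \<open>b (Suc k)\<close> doubles all constants.\<close>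
  define C where "C = Cf (\<delta> / 2) k"
  have C: "C \<ge> 0" unfolding C_def using Cf Suc.prems by simp
  obtain A where A: "A \<ge> 0" "\<And>b. (\<forall>k. b k \<ge> 0) \<Longrightarrow> (\<forall>k. \<forall>\<delta>>0. b (Suc k) \<le> \<delta> * b (Suc (Suc k)) + Cf \<delta> k * b k)
     \<Longrightarrow> b k \<le> A * b 0 + 1 / (2 * (C + 1)) * b (Suc k)"
    using Suc.IH[of "1 / (2 * (C + 1))"] C by (auto simp: add_nonneg_pos)
  show ?case
  proof (intro exI[of _ "2 * C * A"] conjI allI impI)
    show "0 \<le> 2 * C * A" using C A by simp
    fix b :: "nat \<Rightarrow> real"
    assume b: "(\<forall>k. b k \<ge> 0) \<and> (\<forall>k. \<forall>\<delta>>0. b (Suc k) \<le> \<delta> * b (Suc (Suc k)) + Cf \<delta> k * b k)"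
    have "b (Suc k) \<le> \<delta> / 2 * b (Suc (Suc k)) + C * b k" 
      unfolding C_def using conjunct2[OF b, rule_format, of "\<delta> / 2" k] Suc.prems by simp
    also have "C * b k \<le> C * (A * b 0 + 1 / (2 * (C + 1)) * b (Suc k))"
      using A(2)[of b] b C by (intro mult_left_mono) auto
    also have "\<dots> = C * A * b 0 + (C / (2 * (C + 1))) * b (Suc k)" by (simp add: algebra_simps)
    also have "(C / (2 * (C + 1))) * b (Suc k) \<le> 1 / 2 * b (Suc k)"
      using C b by (intro mult_right_mono) (auto simp: field_simps)
    finally show "b (Suc k) \<le> 2 * C * A * b 0 + \<delta> * b (Suc (Suc k))" by simp
  qed
qed

lemma interpolation_sequence:
  fixes Cf :: "real \<Rightarrow> nat \<Rightarrow> real"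
  assumes Cf: "\<And>\<delta> k. \<delta> > 0 \<Longrightarrow> Cf \<delta> k \<ge> 0"
  shows "\<exists>A\<ge>0. \<forall>b. (\<forall>k. b k \<ge> 0) \<and> (\<forall>k. \<forall>\<delta>>0. b (Suc k) \<le> \<delta> * b (Suc (Suc k)) + Cf \<delta> k * b k)
     \<longrightarrow> (\<forall>k\<le>m. b k \<le> A * (b 0 + b m))"
proof -
  let ?H = "\<lambda>b. (\<forall>k. b k \<ge> (0::real)) \<and> (\<forall>k. \<forall>\<delta>>0. b (Suc k) \<le> \<delta> * b (Suc (Suc k)) + Cf \<delta> k * b k)"
  have one: "\<exists>A\<ge>0. \<forall>b. ?H b \<longrightarrow> b k \<le> A * (b 0 + b m)" if "k \<le> m" for k
    using that
  proof (induction k rule: inc_induct)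
    case base
    show ?case by (intro exI[of _ 1]) auto
  next
    case (step k)
    obtain A where A: "A \<ge> 0" "\<And>b. ?H b \<Longrightarrow> b (Suc k) \<le> A * (b 0 + b m)" using step.IH by blast
    obtain A' where A': "A' \<ge> 0" "\<And>b. ?H b \<Longrightarrow> b k \<le> A' * b 0 + 1 * b (Suc k)"
      using interpolation_sequence_step[where Cf = Cf and \<delta> = 1 and k = k] Cf by auto
    show ?case
    proof (intro exI[of _ "A' + A"] conjI allI impI)
      show "0 \<le> A' + A" using A A' by simp
      fix b assume b: "?H b"
      have "A' * b 0 \<le> A' * (b 0 + b m)" using A'(1) b by (intro mult_left_mono) auto
      then show "b k \<le> (A' + A) * (b 0 + b m)" using A(2)[OF b] A'(2)[OF b] by (simp add: distrib_right)
    qed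
  qed
  have "\<forall>k. \<exists>A. k \<le> m \<longrightarrow> A \<ge> 0 \<and> (\<forall>b. ?H b \<longrightarrow> b k \<le> A * (b 0 + b m))" using one by blast
  then obtain A where A: "\<And>k. k \<le> m \<Longrightarrow> A k \<ge> 0" "\<And>k b. k \<le> m \<Longrightarrow> ?H b \<Longrightarrow> b k \<le> A k * (b 0 + b m)" by metis
  show ?thesis
  proof (intro exI[of _ "\<Sum>k\<le>m. A k"] conjI allI impI)
    show "0 \<le> (\<Sum>k\<le>m. A k)" using A(1) by (intro sum_nonneg) auto
    fix b k assume b: "?H b" and k: "k \<le> m"
    have "A k \<le> (\<Sum>k\<le>m. A k)" using A(1) k by (intro member_le_sum) auto
    then have "A k * (b 0 + b m) \<le> (\<Sum>k\<le>m. A k) * (b 0 + b m)" using b by (intro mult_right_mono) auto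
    then show "b k \<le> (\<Sum>k\<le>m. A k) * (b 0 + b m)" using A(2)[OF k b] by simp
  qed
qed

text \<open>A weight is a compactly supported function with values in the unit interval whose first derivatives,
  recorded in \<open>dv\<close>, have size \<open>M / w\<close>.\<close>

definition weight_fun ::
  "real \<Rightarrow> real \<Rightarrow> (real ^ 'n::finite \<Rightarrow> real) \<Rightarrow> ('n \<Rightarrow> real ^ 'n \<Rightarrow> real) \<Rightarrow> bool" where
  "weight_fun M w v dv \<longleftrightarrow> continuous_on UNIV v \<and> (\<forall>i. continuous_on UNIV (dv i)) \<and> (\<forall>i. pdiff v i (dv i))
     \<and> (\<forall>x. 0 \<le> v x \<and> v x \<le> 1) \<and> (\<forall>i x. \<bar>dv i x\<bar> \<le> M / w)
     \<and> (\<exists>a r. \<forall>x. x \<notin> cube a r \<longrightarrow> v x = 0 \<and> (\<forall>i. dv i x = 0))"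

text \<open>The pointwise estimate behind the next lemma.  The exponents of \<open>v\<close> grow by two with the order of
  the derivative.  So the power of \<open>v\<close> that is lost when the weight is differentiated is still available in the
  term of lowest order.\<close>

lemma weighted_young:
  fixes f f1 f2 v dv w M \<delta> :: real
  assumes v: "0 \<le> v" and dv: "\<bar>dv\<bar> \<le> M / w" and w: "w > 0" and \<delta>: "\<delta> > 0"
    and n: "odd n"
  shows "- (f * (real (Suc n) * v ^ n * dv * f1 + v ^ Suc n * f2)) \<le> 1 / 2 * (v ^ Suc n * f1\<^sup>2) + \<delta> * w\<^sup>2 / 2 * (v ^ (n + 3) * f2\<^sup>2)
     + (1 / (2 * \<delta>) + (real (Suc n))\<^sup>2 * M\<^sup>2 / 2) * (1 / w\<^sup>2) * (v ^ (n - 1) * f\<^sup>2)"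
proof -
  obtain j where j: "n = 2 * j + 1" using n by (auto elim: oddE)
  define p where "p = v ^ j"
  have p: "p \<ge> 0" using v by (simp add: p_def)
  have e: "v ^ n = p\<^sup>2 * v" "v ^ Suc n = (p * v)\<^sup>2" "v ^ (n + 3) = (p * v\<^sup>2)\<^sup>2" "v ^ (n - 1) = p\<^sup>2"
    by (simp_all add: j p_def power_add power_mult power2_eq_square power_mult_distrib algebra_simps eval_nat_numeral)
  define N where "N = real (Suc n)"
  have 1: "- (f * (N * (p\<^sup>2 * v) * dv * f1)) \<le> 1 / 2 * ((p * v)\<^sup>2 * f1\<^sup>2) + N\<^sup>2 * M\<^sup>2 / 2 * (1 / w\<^sup>2) * (p\<^sup>2 * f\<^sup>2)"
  proof -
    have "0 \<le> (p * v * f1 + N * dv * p * f)\<^sup>2" by simp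
    then have "- (f * (N * (p\<^sup>2 * v) * dv * f1)) \<le> 1 / 2 * ((p * v)\<^sup>2 * f1\<^sup>2) + N\<^sup>2 * dv\<^sup>2 / 2 * (p\<^sup>2 * f\<^sup>2)"
      by (simp add: power2_eq_square algebra_simps)
    also have "dv\<^sup>2 \<le> M\<^sup>2 / w\<^sup>2"
      using power_mono[OF dv, of 2] by (simp add: power_divide)
    then have "N\<^sup>2 * dv\<^sup>2 / 2 * (p\<^sup>2 * f\<^sup>2) \<le> N\<^sup>2 * (M\<^sup>2 / w\<^sup>2) / 2 * (p\<^sup>2 * f\<^sup>2)"
      by (intro mult_right_mono divide_right_mono mult_left_mono) auto
    finally show ?thesis by simp
  qed
  have 2: "- (f * ((p * v)\<^sup>2 * f2)) \<le> \<delta> * w\<^sup>2 / 2 * ((p * v\<^sup>2)\<^sup>2 * f2\<^sup>2) + 1 / (2 * \<delta>) * (1 / w\<^sup>2) * (p\<^sup>2 * f\<^sup>2)"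
  proof -
    have "0 \<le> (\<delta> * w\<^sup>2 * (p * v\<^sup>2) * f2 + p * f)\<^sup>2 / (2 * \<delta> * w\<^sup>2)" using w \<delta> by simp
    also have "\<dots> = \<delta> * w\<^sup>2 / 2 * ((p * v\<^sup>2)\<^sup>2 * f2\<^sup>2) + f * ((p * v)\<^sup>2 * f2) + 1 / (2 * \<delta>) * (1 / w\<^sup>2) * (p\<^sup>2 * f\<^sup>2)"
      using w \<delta> by (simp add: power2_eq_square field_simps)
    finally show ?thesis by simp
  qed
  show ?thesis
    unfolding e N_def[symmetric] using 1 2 by (simp add: algebra_simps)
qed

text \<open>Integrating \<open>f1 * f1\<close> by parts against the weight moves one derivative to the other factor.  The term
  \<open>f1\<close> that reappears on the right carries the factor one half and is absorbed.\<close>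

lemma weighted_interpolation:
  fixes f f1 f2 :: "real ^ 'n::finite \<Rightarrow> real"
  assumes W: "weight_fun M w v dv" and w: "w > 0" and \<delta>: "\<delta> > 0"
    and f: "pdiff f i f1" "pdiff f1 i f2"
    and c: "continuous_on UNIV f" "continuous_on UNIV f1" "continuous_on UNIV f2"
  shows "(\<integral>x. v x ^ (2 * k + 4) * (f1 x)\<^sup>2 \<partial>lborel) \<le> \<delta> * w\<^sup>2 * (\<integral>x. v x ^ (2 * k + 6) * (f2 x)\<^sup>2 \<partial>lborel)
     + (1 / \<delta> + (real (2 * k + 4))\<^sup>2 * M\<^sup>2) * (1 / w\<^sup>2) * (\<integral>x. v x ^ (2 * k + 2) * (f x)\<^sup>2 \<partial>lborel)"
proof -
  define n where "n = 2 * k + 3"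
  have n: "odd n" "Suc n = 2 * k + 4" "n + 3 = 2 * k + 6" "n - 1 = 2 * k + 2" by (auto simp: n_def)
  obtain a r where out: "\<And>x. x \<notin> cube a r \<Longrightarrow> v x = 0 \<and> (\<forall>i. dv i x = 0)"
    using W unfolding weight_fun_def by blast
  have vc: "continuous_on UNIV v" "\<And>i. continuous_on UNIV (dv i)" "\<And>i. pdiff v i (dv i)"
    and vb: "\<And>x. 0 \<le> v x" "\<And>i x. \<bar>dv i x\<bar> \<le> M / w"
    using W unfolding weight_fun_def by auto
  define g where "g x = v x ^ Suc n * f1 x" for x
  define g' where "g' x = (real (Suc n) * v x ^ n * dv i x) * f1 x + v x ^ Suc n * f2 x" for x
  have int: "integrable lborel (\<lambda>x. v x ^ j * (h x)\<^sup>2)" if "continuous_on UNIV h" "j > 0" for h j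
    by (rule integrable_vanish_outside_cube[where a = a and r = r])
      (use that out in \<open>auto intro!: continuous_intros vc\<close>)
  have g: "pdiff g i g'"
    unfolding g_def[abs_def] g'_def[abs_def] by (intro pdiff_mult pdiff_power vc f)
  have gc: "continuous_on UNIV g" "continuous_on UNIV g'"
    unfolding g_def[abs_def] g'_def[abs_def] by (intro continuous_intros vc c)+
  have g0: "g x = 0" "g' x = 0" if "x \<notin> cube a r" for x
    using out[OF that] n(1) by (auto simp: g_def g'_def odd_pos)
  let ?A = "\<integral>x. v x ^ Suc n * (f1 x)\<^sup>2 \<partial>lborel" and ?B = "\<integral>x. v x ^ (n + 3) * (f2 x)\<^sup>2 \<partial>lborel"
    and ?D = "\<integral>x. v x ^ (n - 1) * (f x)\<^sup>2 \<partial>lborel"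
  let ?c = "(1 / (2 * \<delta>) + (real (Suc n))\<^sup>2 * M\<^sup>2 / 2) * (1 / w\<^sup>2)"
  have "(\<integral>x. f1 x * g x \<partial>lborel) = - (\<integral>x. f x * g' x \<partial>lborel)"
    by (rule integration_by_parts[OF f(1) g c(1,2) gc g0])
  then have "?A = (\<integral>x. - (f x * g' x) \<partial>lborel)"
    by (simp add: g_def power2_eq_square mult_ac)
  also have "\<dots> \<le> (\<integral>x. 1 / 2 * (v x ^ Suc n * (f1 x)\<^sup>2) + \<delta> * w\<^sup>2 / 2 * (v x ^ (n + 3) * (f2 x)\<^sup>2) + ?c * (v x ^ (n - 1) * (f x)\<^sup>2) \<partial>lborel)"
  proof (rule integral_mono)
    show "integrable lborel (\<lambda>x. - (f x * g' x))"
      by (rule integrable_vanish_outside_cube[where a = a and r = r])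
        (use g0 in \<open>auto intro!: continuous_intros c gc\<close>)
    show "integrable lborel (\<lambda>x. 1 / 2 * (v x ^ Suc n * (f1 x)\<^sup>2) + \<delta> * w\<^sup>2 / 2 * (v x ^ (n + 3) * (f2 x)\<^sup>2) + ?c * (v x ^ (n - 1) * (f x)\<^sup>2))"
      by (intro Bochner_Integration.integrable_add integrable_mult_right int c) (auto simp: n_def)
    show "- (f x * g' x) \<le> 1 / 2 * (v x ^ Suc n * (f1 x)\<^sup>2) + \<delta> * w\<^sup>2 / 2 * (v x ^ (n + 3) * (f2 x)\<^sup>2) + ?c * (v x ^ (n - 1) * (f x)\<^sup>2)" for x
      unfolding g'_def by (rule weighted_young[OF vb(1) vb(2) w \<delta> n(1)])
  qed
  also have "\<dots> = 1 / 2 * ?A + \<delta> * w\<^sup>2 / 2 * ?B + ?c * ?D"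
  proof -
    have i: "integrable lborel (\<lambda>x. 1 / 2 * (v x ^ Suc n * (f1 x)\<^sup>2))" "integrable lborel (\<lambda>x. \<delta> * w\<^sup>2 / 2 * (v x ^ (n + 3) * (f2 x)\<^sup>2))"
      "integrable lborel (\<lambda>x. ?c * (v x ^ (n - 1) * (f x)\<^sup>2))"
      by (intro integrable_mult_right int c; simp add: n_def)+
    show ?thesis
      unfolding Bochner_Integration.integral_add[OF Bochner_Integration.integrable_add[OF i(1,2)] i(3)]
        Bochner_Integration.integral_add[OF i(1,2)] integral_mult_right_zero ..
  qed
  finally have "?A \<le> 1 / 2 * ?A + \<delta> * w\<^sup>2 / 2 * ?B + ?c * ?D" .
  moreover have "a \<le> p * b + 2 * c * d" if "a \<le> 1 / 2 * a + p / 2 * b + c * d" for a b c d p :: real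
    using that by (simp add: field_simps)
  ultimately have "?A \<le> \<delta> * w\<^sup>2 * ?B + 2 * ?c * ?D" by blast
  also have "2 * ?c = (1 / \<delta> + (real (Suc n))\<^sup>2 * M\<^sup>2) * (1 / w\<^sup>2)"
  proof -
    have "2 * (1 / (2 * \<delta>) + X / 2) = 1 / \<delta> + X" for X by (simp add: distrib_left)
    then show ?thesis by (simp only: mult.assoc[symmetric])
  qed
  finally show ?thesis unfolding n .
qed

text \<open>At scale \<open>w\<close> all derivatives of order up to \<open>m\<close> are bounded by those of order \<open>0\<close> and \<open>m\<close>: the
  sequence \<open>b\<close> of scaled and weighted integrals satisfies the hypothesis of the abstract interpolation
  lemma.\<close>

lemma weighted_interpolation_all:
  fixes M :: real and m :: nat
  obtains A where "A \<ge> 0"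
    and "\<And>w v dv (U :: 'n::finite multiindex \<Rightarrow> real ^ 'n \<Rightarrow> real) \<gamma>.
    w > 0 \<Longrightarrow> weight_fun M w v dv \<Longrightarrow> jet U \<Longrightarrow> mi_order \<gamma> \<le> m \<Longrightarrow>
    (1 / w) ^ (2 * (m - mi_order \<gamma>)) * (\<integral>x. v x ^ (2 * mi_order \<gamma> + 2) * (U \<gamma> x)\<^sup>2 \<partial>lborel)
      \<le> A * ((1 / w) ^ (2 * m) * (\<integral>x. (v x)\<^sup>2 * (U zero_mi x)\<^sup>2 \<partial>lborel)
           + (\<Sum>\<beta> | mi_order \<beta> = m. \<integral>x. v x ^ (2 * m + 2) * (U \<beta> x)\<^sup>2 \<partial>lborel))"
proof -
  define n where "n k = real (card {\<gamma> :: 'n multiindex. mi_order \<gamma> = k})" for k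
  define Cf where "Cf \<delta> k = n (Suc k) * (1 / (\<delta> / (n (Suc k) + 1)) + (real (2 * k + 4))\<^sup>2 * M\<^sup>2)" for \<delta> k
  have n0: "n k \<ge> 0" for k by (simp add: n_def)
  have "\<exists>A\<ge>0. \<forall>b. (\<forall>k. b k \<ge> 0) \<and> (\<forall>k. \<forall>\<delta>>0. b (Suc k) \<le> \<delta> * b (Suc (Suc k)) + Cf \<delta> k * b k)
     \<longrightarrow> (\<forall>k\<le>m. b k \<le> A * (b 0 + b m))"
    by (rule interpolation_sequence) (auto simp: Cf_def n0 intro!: mult_nonneg_nonneg add_nonneg_nonneg divide_nonneg_nonneg)
  then obtain A where A: "A \<ge> 0" and Ab: "\<And>b k. (\<And>k. b k \<ge> 0) \<Longrightarrow> (\<And>k \<delta>. \<delta> > 0 \<Longrightarrow> b (Suc k) \<le> \<delta> * b (Suc (Suc k)) + Cf \<delta> k * b k)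
     \<Longrightarrow> k \<le> m \<Longrightarrow> b k \<le> A * (b 0 + b m)" by blast
  have main: "(1 / w) ^ (2 * (m - mi_order \<gamma>)) * (\<integral>x. v x ^ (2 * mi_order \<gamma> + 2) * (U \<gamma> x)\<^sup>2 \<partial>lborel)
      \<le> A * ((1 / w) ^ (2 * m) * (\<integral>x. (v x)\<^sup>2 * (U zero_mi x)\<^sup>2 \<partial>lborel)
           + (\<Sum>\<beta> | mi_order \<beta> = m. \<integral>x. v x ^ (2 * m + 2) * (U \<beta> x)\<^sup>2 \<partial>lborel))"
    if w: "w > 0" and W: "weight_fun M w v dv" and U: "jet U" and \<gamma>: "mi_order \<gamma> \<le> m"
    for w v dv and U :: "'n multiindex \<Rightarrow> real ^ 'n \<Rightarrow> real" and \<gamma>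
  proof -
    have v0: "v x \<ge> 0" for x using W by (auto simp: weight_fun_def)
    define I where "I \<gamma> = (\<integral>x. v x ^ (2 * mi_order \<gamma> + 2) * (U \<gamma> x)\<^sup>2 \<partial>lborel)" for \<gamma>
    have I0: "I \<gamma> \<ge> 0" for \<gamma> unfolding I_def using v0 by (intro integral_nonneg_AE) auto
    define b where "b k = w ^ (2 * k) * (\<Sum>\<gamma> | mi_order \<gamma> = k. I \<gamma>)" for k
    have b0: "b k \<ge> 0" for k unfolding b_def using w I0 by (intro mult_nonneg_nonneg sum_nonneg) auto
    have Ib: "w ^ (2 * mi_order \<gamma>) * I \<gamma> \<le> b (mi_order \<gamma>)" for \<gamma>
      unfolding b_def using w I0 by (intro mult_left_mono member_le_sum) auto
    have step: "b (Suc k) \<le> \<delta> * b (Suc (Suc k)) + Cf \<delta> k * b k" if \<delta>: "\<delta> > 0" for k \<delta>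
    proof -
      define \<delta>' where "\<delta>' = \<delta> / (n (Suc k) + 1)"
      have \<delta>': "\<delta>' > 0" using \<delta> n0[of "Suc k"] by (simp add: \<delta>'_def)
      define c where "c = 1 / \<delta>' + (real (2 * k + 4))\<^sup>2 * M\<^sup>2"
      have c0: "c \<ge> 0" using \<delta>' by (simp add: c_def)
      have each: "w ^ (2 * Suc k) * I \<gamma> \<le> \<delta>' * b (Suc (Suc k)) + c * b k" if \<gamma>: "mi_order \<gamma> = Suc k" for \<gamma>
      proof -
        obtain \<gamma>' i where g: "\<gamma> = inc \<gamma>' i" "mi_order \<gamma>' = k" using \<gamma> by (auto elim: mi_order_Suc_obtain)
        have e: "2 * mi_order \<gamma> + 2 = 2 * k + 4" "2 * mi_order (inc \<gamma> i) + 2 = 2 * k + 6" "2 * mi_order \<gamma>' + 2 = 2 * k + 2"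
          using \<gamma> g(2) by auto
        have "I \<gamma> \<le> \<delta>' * w\<^sup>2 * I (inc \<gamma> i) + c * (1 / w\<^sup>2) * I \<gamma>'"
          unfolding I_def e c_def
        proof (rule weighted_interpolation[OF W w \<delta>', of _ i])
          show "pdiff (U \<gamma>') i (U \<gamma>)" unfolding g(1) by (rule jet_pdiff[OF U])
          show "pdiff (U \<gamma>) i (U (inc \<gamma> i))" by (rule jet_pdiff[OF U])
        qed (rule jet_continuous[OF U])+
        then have "w ^ (2 * Suc k) * I \<gamma> \<le> w ^ (2 * Suc k) * (\<delta>' * w\<^sup>2 * I (inc \<gamma> i) + c * (1 / w\<^sup>2) * I \<gamma>')"
          using w by (intro mult_left_mono) auto
        also have "\<dots> = \<delta>' * (w ^ (2 * Suc (Suc k)) * I (inc \<gamma> i)) + c * (w ^ (2 * k) * I \<gamma>')"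
          using w by (simp add: field_simps power2_eq_square del: fun_upd_apply)
        also have "\<dots> \<le> \<delta>' * b (Suc (Suc k)) + c * b k"
          using Ib[of "inc \<gamma> i"] Ib[of \<gamma>'] \<gamma> g(2) \<delta>' c0 by (intro add_mono mult_left_mono) auto
        finally show ?thesis .
      qed
      have "b (Suc k) = (\<Sum>\<gamma> | mi_order \<gamma> = Suc k. w ^ (2 * Suc k) * I \<gamma>)" by (simp add: b_def sum_distrib_left)
      also have "\<dots> \<le> of_nat (card {\<gamma> :: 'n multiindex. mi_order \<gamma> = Suc k}) * (\<delta>' * b (Suc (Suc k)) + c * b k)"
        by (rule sum_bounded_above) (use each in auto)
      also have "\<dots> = n (Suc k) * \<delta>' * b (Suc (Suc k)) + n (Suc k) * c * b k"
        by (simp add: n_def algebra_simps)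
      also have "n (Suc k) * \<delta>' * b (Suc (Suc k)) \<le> \<delta> * b (Suc (Suc k))"
        using n0[of "Suc k"] \<delta> b0 by (intro mult_right_mono) (auto simp: \<delta>'_def field_simps)
      finally show ?thesis by (simp add: Cf_def c_def \<delta>'_def)
    qed
    have "b (mi_order \<gamma>) \<le> A * (b 0 + b m)" by (rule Ab[OF b0 step \<gamma>])
    then have "w ^ (2 * mi_order \<gamma>) * I \<gamma> \<le> A * (b 0 + b m)" using Ib[of \<gamma>] by simp
    then have "(1 / w) ^ (2 * m) * (w ^ (2 * mi_order \<gamma>) * I \<gamma>) \<le> (1 / w) ^ (2 * m) * (A * (b 0 + b m))"
      using w by (intro mult_left_mono) auto
    also have "(1 / w) ^ (2 * m) * (w ^ (2 * mi_order \<gamma>) * I \<gamma>) = (1 / w) ^ (2 * (m - mi_order \<gamma>)) * I \<gamma>"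
    proof -
      have "2 * m = 2 * (m - mi_order \<gamma>) + 2 * mi_order \<gamma>" using \<gamma> by simp
      then have "(1 / w) ^ (2 * m) = (1 / w) ^ (2 * (m - mi_order \<gamma>)) * (1 / w) ^ (2 * mi_order \<gamma>)"
        by (metis power_add)
      then show ?thesis using w by (simp add: power_one_over)
    qed
    also have "(1 / w) ^ (2 * m) * (A * (b 0 + b m)) = A * ((1 / w) ^ (2 * m) * I zero_mi + (\<Sum>\<beta> | mi_order \<beta> = m. I \<beta>))"
    proof -
      have "{\<gamma> :: 'n multiindex. mi_order \<gamma> = 0} = {zero_mi}" by (auto simp: mi_order_eq_0_iff)
      then have "b 0 = I zero_mi" by (simp add: b_def)
      moreover have "(1 / w) ^ (2 * m) * b m = (\<Sum>\<beta> | mi_order \<beta> = m. I \<beta>)"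
        using w by (simp add: b_def power_one_over)
      ultimately show ?thesis by (simp add: algebra_simps)
    qed
    finally show ?thesis by (simp add: I_def power2_eq_square)
  qed
  show ?thesis by (rule that[OF A main])
qed

lemma infnorm_borel [measurable]: "(infnorm :: real ^ 'n::finite \<Rightarrow> real) \<in> borel_measurable borel"
  by (intro borel_measurable_continuous_onI continuous_intros)

section \<open>Energy decay across one annulus\<close>

text \<open>The Leibniz formula and the inequality of Cauchy and Schwarz.\<close>

lemma edens_mult_jet_le:
  assumes "B \<ge> 0"
  obtains C where "C \<ge> 0"
    and "\<And>(T :: 'n::finite multiindex \<Rightarrow> real ^ 'n \<Rightarrow> real) U x w.
    w > 0 \<Longrightarrow> \<forall>\<beta>. mi_order \<beta> \<le> m \<longrightarrow> \<bar>T \<beta> x\<bar> \<le> B * (1 / w) ^ mi_order \<beta> \<Longrightarrow>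
    edens m (mult_jet T U) x \<le> C * (\<Sum>\<gamma> | mi_order \<gamma> \<le> m. (1 / w) ^ (2 * (m - mi_order \<gamma>)) * (U \<gamma> x)\<^sup>2)"
proof -
  define c where "c \<beta> = (\<Sum>\<gamma>\<in>mi_below \<beta>. (mi_choose \<beta> \<gamma> * B)\<^sup>2)" for \<beta> :: "'n multiindex"
  have c0: "c \<beta> \<ge> 0" for \<beta> by (simp add: c_def sum_nonneg)
  define C where "C = (\<Sum>\<beta> :: 'n multiindex | mi_order \<beta> = m. fact m / mi_fact \<beta> * c \<beta>)"
  have C: "C \<ge> 0" unfolding C_def using c0 by (intro sum_nonneg mult_nonneg_nonneg divide_nonneg_nonneg mi_fact_nonneg) auto
  have main: "edens m (mult_jet T U) x \<le> C * (\<Sum>\<gamma> | mi_order \<gamma> \<le> m. (1 / w) ^ (2 * (m - mi_order \<gamma>)) * (U \<gamma> x)\<^sup>2)"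
    if w: "w > 0" and T: "\<forall>\<beta>. mi_order \<beta> \<le> m \<longrightarrow> \<bar>T \<beta> x\<bar> \<le> B * (1 / w) ^ mi_order \<beta>"
    for T U :: "'n multiindex \<Rightarrow> real ^ 'n \<Rightarrow> real" and x w
  proof -
    let ?S = "\<Sum>\<gamma> | mi_order \<gamma> \<le> m. (1 / w) ^ (2 * (m - mi_order \<gamma>)) * (U \<gamma> x)\<^sup>2"
    have sq: "(mult_jet T U \<beta> x)\<^sup>2 \<le> c \<beta> * ?S" if \<beta>: "mi_order \<beta> = m" for \<beta>
    proof -
      \<comment> \<open>Reindexed by \<open>\<gamma> \<mapsto> \<beta> - \<gamma>\<close>, the squares of these numbers are the summands on the right-hand side.\<close>
      define y where "y \<gamma> = (1 / w) ^ mi_order \<gamma> * \<bar>U (mi_diff \<beta> \<gamma>) x\<bar>" for \<gamma>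
      have "\<bar>mult_jet T U \<beta> x\<bar> \<le> (\<Sum>\<gamma>\<in>mi_below \<beta>. \<bar>mi_choose \<beta> \<gamma> * (T \<gamma> x * U (mi_diff \<beta> \<gamma>) x)\<bar>)"
        unfolding mult_jet_def by (rule sum_abs)
      also have "\<dots> \<le> (\<Sum>\<gamma>\<in>mi_below \<beta>. (mi_choose \<beta> \<gamma> * B) * y \<gamma>)"
      proof (rule sum_mono)
        fix \<gamma> assume "\<gamma> \<in> mi_below \<beta>"
        then have "mi_order \<gamma> \<le> m" using mi_order_mono \<beta> by blast
        then have "\<bar>T \<gamma> x\<bar> * \<bar>U (mi_diff \<beta> \<gamma>) x\<bar> \<le> B * (1 / w) ^ mi_order \<gamma> * \<bar>U (mi_diff \<beta> \<gamma>) x\<bar>"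
          by (intro mult_right_mono T[rule_format]) auto
        then have "mi_choose \<beta> \<gamma> * (\<bar>T \<gamma> x\<bar> * \<bar>U (mi_diff \<beta> \<gamma>) x\<bar>) \<le> mi_choose \<beta> \<gamma> * (B * (1 / w) ^ mi_order \<gamma> * \<bar>U (mi_diff \<beta> \<gamma>) x\<bar>)"
          by (intro mult_left_mono) auto
        then show "\<bar>mi_choose \<beta> \<gamma> * (T \<gamma> x * U (mi_diff \<beta> \<gamma>) x)\<bar> \<le> (mi_choose \<beta> \<gamma> * B) * y \<gamma>"
          by (simp add: abs_mult y_def mult.assoc)
      qed
      finally have "(mult_jet T U \<beta> x)\<^sup>2 \<le> (\<Sum>\<gamma>\<in>mi_below \<beta>. (mi_choose \<beta> \<gamma> * B) * y \<gamma>)\<^sup>2"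
        using power_mono[of "\<bar>mult_jet T U \<beta> x\<bar>" _ 2] by simp
      also have "\<dots> \<le> c \<beta> * (\<Sum>\<gamma>\<in>mi_below \<beta>. (y \<gamma>)\<^sup>2)"
        unfolding c_def by (rule Cauchy_Schwarz_ineq_sum)
      also have "(\<Sum>\<gamma>\<in>mi_below \<beta>. (y \<gamma>)\<^sup>2) = (\<Sum>\<gamma>\<in>mi_diff \<beta> ` mi_below \<beta>. (1 / w) ^ (2 * (m - mi_order \<gamma>)) * (U \<gamma> x)\<^sup>2)"
      proof (subst sum.reindex)
        show "inj_on (mi_diff \<beta>) (mi_below \<beta>)"
        proof (rule inj_onI)
          fix p q assume p: "p \<in> mi_below \<beta>" "q \<in> mi_below \<beta>" "mi_diff \<beta> p = mi_diff \<beta> q"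
          show "p = q"
          proof
            fix i
            have "\<beta> i - p i = \<beta> i - q i" using p(3) by (auto simp: mi_diff_def dest: fun_cong)
            moreover have "p i \<le> \<beta> i" "q i \<le> \<beta> i" using p by auto
            ultimately show "p i = q i" by linarith
          qed
        qed
        show "(\<Sum>\<gamma>\<in>mi_below \<beta>. (y \<gamma>)\<^sup>2) = sum ((\<lambda>\<gamma>. (1 / w) ^ (2 * (m - mi_order \<gamma>)) * (U \<gamma> x)\<^sup>2) \<circ> mi_diff \<beta>) (mi_below \<beta>)"
        proof (rule sum.cong[OF refl])
          fix \<gamma> assume g: "\<gamma> \<in> mi_below \<beta>"
          then have "m - mi_order (mi_diff \<beta> \<gamma>) = mi_order \<gamma>"
            using mi_order_diff[OF g] mi_order_mono[OF g] \<beta> by simp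
          then show "(y \<gamma>)\<^sup>2 = ((\<lambda>\<gamma>. (1 / w) ^ (2 * (m - mi_order \<gamma>)) * (U \<gamma> x)\<^sup>2) \<circ> mi_diff \<beta>) \<gamma>"
            by (simp add: y_def power_mult_distrib power_even_eq)
        qed
      qed
      also have "\<dots> \<le> ?S"
      proof (rule sum_mono2)
        show "mi_diff \<beta> ` mi_below \<beta> \<subseteq> {\<gamma>. mi_order \<gamma> \<le> m}"
          using mi_order_diff[of _ \<beta>] \<beta> by auto
      qed (use w in auto)
      finally show ?thesis using c0[of \<beta>] by (simp add: mult_left_mono)
    qed
    have "edens m (mult_jet T U) x \<le> (\<Sum>\<beta> | mi_order \<beta> = m. fact m / mi_fact \<beta> * (c \<beta> * ?S))"
      unfolding edens_def using sq by (intro sum_mono mult_left_mono divide_nonneg_nonneg mi_fact_nonneg) auto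
    also have "\<dots> = C * ?S" by (simp add: C_def sum_distrib_right mult.assoc)
    finally show ?thesis .
  qed
  show ?thesis by (rule that[OF C main])
qed

text \<open>The Sobolev estimate for the reproduction belonging to a local density parameter.  The width \<open>w\<close> may
  exceed \<open>\<rho> \<alpha>\<close>, which allows one scale to be used on a whole annulus.\<close>

lemma density_estimate:
  assumes m: "real m > real CARD('n::finite) / 2"
  obtains C where "C > 0"
    and "\<And>(U :: 'n multiindex \<Rightarrow> real ^ 'n \<Rightarrow> real) \<Omega> \<Xi> l \<rho> \<alpha> w.
     jet U \<Longrightarrow> finite \<Xi> \<Longrightarrow> l \<ge> m \<Longrightarrow> local_density \<Omega> \<Xi> l K \<rho> \<Longrightarrow> \<alpha> \<in> \<Omega> \<Longrightarrow> \<rho> \<alpha> \<le> w \<Longrightarrow>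
     (\<exists>a. (\<forall>\<xi>\<in>\<Xi>. a \<xi> \<noteq> 0 \<longrightarrow> \<xi> \<in> cube \<alpha> w) \<and> (\<Sum>\<xi>\<in>\<Xi>. \<bar>a \<xi>\<bar>) \<le> K \<and>
       (U zero_mi \<alpha> - (\<Sum>\<xi>\<in>\<Xi>. a \<xi> * U zero_mi \<xi>))\<^sup>2 \<le> C * (w ^ (2 * m) / w ^ CARD('n)) * local_energy m U (cube \<alpha> w))"
proof -
  obtain C where C: "C > 0" and CC: "\<And>(U :: 'n multiindex \<Rightarrow> real ^ 'n \<Rightarrow> real) \<alpha> w S a K.
     jet U \<Longrightarrow> w > 0 \<Longrightarrow> finite S \<Longrightarrow> \<forall>\<xi>\<in>S. a \<xi> \<noteq> 0 \<longrightarrow> \<xi> \<in> cube \<alpha> w \<Longrightarrow>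
     \<forall>p\<in>poly_space m. (\<Sum>\<xi>\<in>S. a \<xi> * p \<xi>) = p \<alpha> \<Longrightarrow> (\<Sum>\<xi>\<in>S. \<bar>a \<xi>\<bar>) \<le> K \<Longrightarrow>
     (U zero_mi \<alpha> - (\<Sum>\<xi>\<in>S. a \<xi> * U zero_mi \<xi>))\<^sup>2
        \<le> C * (1 + K)\<^sup>2 * (w ^ (2 * m) / w ^ CARD('n)) * local_energy m U (cube \<alpha> w)"
  proof (rule sobolev_reproduction[OF m], goal_cases)
    case 1
    show ?case by (rule 1(1)[OF 1(2) 1(3)])
  qed
  have main: "\<exists>a. (\<forall>\<xi>\<in>\<Xi>. a \<xi> \<noteq> 0 \<longrightarrow> \<xi> \<in> cube \<alpha> w) \<and> (\<Sum>\<xi>\<in>\<Xi>. \<bar>a \<xi>\<bar>) \<le> K \<and>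
       (U zero_mi \<alpha> - (\<Sum>\<xi>\<in>\<Xi>. a \<xi> * U zero_mi \<xi>))\<^sup>2 \<le> (C * (1 + \<bar>K\<bar>)\<^sup>2) * (w ^ (2 * m) / w ^ CARD('n)) * local_energy m U (cube \<alpha> w)"
    if U: "jet U" and fin: "finite \<Xi>" and l: "l \<ge> m" and ld: "local_density \<Omega> \<Xi> l K \<rho>" and \<alpha>: "\<alpha> \<in> \<Omega>" "\<rho> \<alpha> \<le> w"
    for U :: "'n multiindex \<Rightarrow> real ^ 'n \<Rightarrow> real" and \<Omega> \<Xi> l \<rho> \<alpha> w
  proof -
    obtain a where a0: "\<forall>\<xi>\<in>\<Xi>. \<forall>\<alpha>\<in>\<Omega>. norm (\<xi> - \<alpha>) > \<rho> \<alpha> \<longrightarrow> a \<xi> \<alpha> = 0"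
      and ap: "\<forall>p\<in>poly_space l. \<forall>\<alpha>\<in>\<Omega>. (\<Sum>\<xi>\<in>\<Xi>. a \<xi> \<alpha> * p \<xi>) = p \<alpha>"
      and aK: "\<forall>\<alpha>\<in>\<Omega>. (\<Sum>\<xi>\<in>\<Xi>. \<bar>a \<xi> \<alpha>\<bar>) < K" and \<rho>0: "\<forall>\<alpha>\<in>\<Omega>. 0 < \<rho> \<alpha>"
      using ld unfolding local_density_def by blast
    have w: "w > 0" using \<rho>0 \<alpha> by force
    have 1: "\<forall>\<xi>\<in>\<Xi>. a \<xi> \<alpha> \<noteq> 0 \<longrightarrow> \<xi> \<in> cube \<alpha> w"
    proof (intro ballI impI)
      fix \<xi> assume "\<xi> \<in> \<Xi>" "a \<xi> \<alpha> \<noteq> 0"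
      then have "norm (\<xi> - \<alpha>) \<le> \<rho> \<alpha>" using a0 \<alpha> by force
      then show "\<xi> \<in> cube \<alpha> w" using infnorm_le_norm[of "\<xi> - \<alpha>"] \<alpha>(2) by (simp add: cube_def)
    qed
    have 2: "(\<Sum>\<xi>\<in>\<Xi>. \<bar>a \<xi> \<alpha>\<bar>) \<le> K" using aK \<alpha> by force
    have K0: "K \<ge> 0" using 2 sum_nonneg[of \<Xi> "\<lambda>\<xi>. \<bar>a \<xi> \<alpha>\<bar>"] by linarith
    have 3: "\<forall>p\<in>poly_space m. (\<Sum>\<xi>\<in>\<Xi>. a \<xi> \<alpha> * p \<xi>) = p \<alpha>"
      using ap \<alpha> poly_space_mono[OF l] by blast
    have eK: "\<bar>K\<bar> = K" using K0 by simp
    from CC[OF U w fin, of "\<lambda>\<xi>. a \<xi> \<alpha>", OF 1 3 2] 1 2 show ?thesis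
      unfolding eK by (intro exI[of _ "\<lambda>\<xi>. a \<xi> \<alpha>"] conjI)
  qed
  have C': "C * (1 + \<bar>K\<bar>)\<^sup>2 > 0" using C by simp
  show ?thesis by (rule that[OF C' main])
qed

definition near_minimizer ::
  "nat \<Rightarrow> (real ^ 'n::finite) set \<Rightarrow> real ^ 'n \<Rightarrow> real \<Rightarrow> ('n multiindex \<Rightarrow> real ^ 'n \<Rightarrow> real) \<Rightarrow> bool" where
  "near_minimizer m \<Xi> \<xi> \<eta> U \<longleftrightarrow> lagrange_jet m \<Xi> \<xi> U \<and>
     (\<forall>V. lagrange_jet m \<Xi> \<xi> V \<longrightarrow> energy m U \<le> energy m V + \<eta>)"

text \<open>The energy outside the open cube of radius \<open>R\<close> about \<open>\<xi>\<close>; its decay in \<open>R\<close> is the heart of the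
  matter.\<close>

definition tail_energy :: "nat \<Rightarrow> ('n::finite multiindex \<Rightarrow> real ^ 'n \<Rightarrow> real) \<Rightarrow> real ^ 'n \<Rightarrow> real \<Rightarrow> real" where
  "tail_energy m U \<xi> R = local_energy m U {z. infnorm (z - \<xi>) \<ge> R}"

lemma annulus_measurable [measurable]:
  "{z :: real ^ 'n::finite. infnorm (z - \<xi>) \<ge> R} \<in> sets borel"
  "{z :: real ^ 'n::finite. infnorm (z - \<xi>) < R} \<in> sets borel"
  "{z :: real ^ 'n::finite. R \<le> infnorm (z - \<xi>) \<and> infnorm (z - \<xi>) < R'} \<in> sets borel"
  "{z :: real ^ 'n::finite. R < infnorm (z - \<xi>) \<and> infnorm (z - \<xi>) < R'} \<in> sets borel"
  "{z :: real ^ 'n::finite. R \<le> infnorm (z - \<xi>) \<and> infnorm (z - \<xi>) \<le> R'} \<in> sets borel"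
  by measurable

lemma finite_energy_indicator:
  assumes "finite_energy m U" and "A \<in> sets borel"
  shows "integrable lborel (\<lambda>x. indicator A x * edens m U x)"
  using integrable_mult_indicator[of A lborel "edens m U"] assms by (simp add: finite_energy_def)

lemma tail_energy_diff:
  fixes U :: "'n::finite multiindex \<Rightarrow> real ^ 'n \<Rightarrow> real"
  assumes U: "finite_energy m U" and R: "R \<le> R'"
  shows "tail_energy m U \<xi> R - tail_energy m U \<xi> R' = local_energy m U {z. R \<le> infnorm (z - \<xi>) \<and> infnorm (z - \<xi>) < R'}"
proof -
  have "tail_energy m U \<xi> R - tail_energy m U \<xi> R'
     = (\<integral>x. indicator {z. infnorm (z - \<xi>) \<ge> R} x * edens m U x - indicator {z. infnorm (z - \<xi>) \<ge> R'} x * edens m U x \<partial>lborel)"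
    unfolding tail_energy_def local_energy_def
    by (intro Bochner_Integration.integral_diff[symmetric] finite_energy_indicator U) measurable
  also have "\<dots> = local_energy m U {z. R \<le> infnorm (z - \<xi>) \<and> infnorm (z - \<xi>) < R'}"
    unfolding local_energy_def using R by (intro Bochner_Integration.integral_cong) (auto simp: indicator_def)
  finally show ?thesis .
qed

lemma tail_energy_antimono:
  assumes "finite_energy m U" "R \<le> R'"
  shows "tail_energy m U \<xi> R' \<le> tail_energy m U \<xi> R"
proof -
  have "0 \<le> tail_energy m U \<xi> R - tail_energy m U \<xi> R'"
    unfolding tail_energy_diff[OF assms] by simp
  then show ?thesis by simp
qed

lemma tail_energy_le_energy:
  assumes "finite_energy m U"
  shows "tail_energy m U \<xi> R \<le> energy m U"
  unfolding tail_energy_def local_energy_def energy_def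
  using assms by (intro integral_mono finite_energy_indicator) (auto simp: finite_energy_def indicator_def)

lemma tail_energy_nonneg [simp]: "tail_energy m U \<xi> R \<ge> 0"
  by (simp add: tail_energy_def)

lemma mult_jet_const_1:
  assumes "\<And>\<gamma>. T \<gamma> x = (if \<gamma> = zero_mi then 1 else 0)"
  shows "mult_jet T U \<beta> x = U \<beta> x"
proof -
  have "mult_jet T U \<beta> x = (\<Sum>\<gamma>\<in>{zero_mi}. mi_choose \<beta> \<gamma> * (T \<gamma> x * U (mi_diff \<beta> \<gamma>) x))"
    unfolding mult_jet_def using assms by (intro sum.mono_neutral_right) auto
  then show ?thesis using assms by (simp add: mi_choose_def mi_diff_def)
qed

lemma mult_jet_0:
  assumes "\<And>\<gamma>. T \<gamma> x = 0"
  shows "mult_jet T U \<beta> x = 0"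
  unfolding mult_jet_def using assms by simp

text \<open>The difference of two cutoffs is a weight that is one on the annulus where the competitor in the decay
  step is cut off, with room of width \<open>w\<close> on both sides.\<close>

lemma annulus_weight:
  obtains M where "M \<ge> 0" and "\<And>(\<xi> :: real ^ 'n::finite) R w. R \<ge> 0 \<Longrightarrow> w > 0 \<Longrightarrow> (\<exists>v dv. weight_fun M w v dv \<and>
     (\<forall>x. R + 2 * w \<le> infnorm (x - \<xi>) \<and> infnorm (x - \<xi>) \<le> R + 3 * w \<longrightarrow> v x = 1) \<and>
     (\<forall>x. v x \<noteq> 0 \<longrightarrow> R + w < infnorm (x - \<xi>) \<and> infnorm (x - \<xi>) < R + 4 * w))"
proof -
  obtain B where B: "B \<ge> 1" and Bc: "\<And>(a :: real ^ 'n) R w \<beta> x. w > 0 \<Longrightarrow> mi_order \<beta> \<le> 1 \<Longrightarrow>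
     \<bar>cutoff a R w \<beta> x\<bar> \<le> B * (1 / w) ^ mi_order \<beta>"
  proof (rule cutoff_bounded[where 'n = 'n and m = 1], goal_cases)
    case 1
    show ?case by (rule 1(1)[OF 1(2) 1(3)])
  qed
  show ?thesis
  proof (rule that[of "2 * B"])
    show "0 \<le> 2 * B" using B by simp
    fix \<xi> :: "real ^ 'n" and R w :: real
    assume R: "R \<ge> 0" and w: "w > 0"
    define J where "J \<beta> x = cutoff \<xi> (R + 3 * w) w \<beta> x - cutoff \<xi> (R + w) w \<beta> x" for \<beta> x
    have J: "jet J" unfolding J_def[abs_def] by (intro jet_diff jet_cutoff)
    have out: "J \<beta> x = 0" if "infnorm (x - \<xi>) \<ge> R + 4 * w \<or> infnorm (x - \<xi>) \<le> R + w" for \<beta> x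
      using that R w cutoff_inside[of "R + w" w x \<xi> \<beta>] cutoff_inside[of "R + 3 * w" w x \<xi> \<beta>]
        cutoff_outside[of "R + 3 * w" w x \<xi> \<beta>] cutoff_outside[of "R + w" w x \<xi> \<beta>]
      by (auto simp: J_def)
    have rng: "0 \<le> J zero_mi x \<and> J zero_mi x \<le> 1" for x
    proof (cases "infnorm (x - \<xi>) \<le> R + 3 * w")
      case True
      then have "cutoff \<xi> (R + 3 * w) w zero_mi x = 1" using R w by (subst cutoff_inside) auto
      then show ?thesis using cutoff_range[of "R + w" w \<xi> x] R w by (simp add: J_def)
    next
      case False
      then have "cutoff \<xi> (R + w) w zero_mi x = 0" using R w by (intro cutoff_outside) auto
      then show ?thesis using cutoff_range[of "R + 3 * w" w \<xi> x] R w by (simp add: J_def)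
    qed
    have bd: "\<bar>J (inc zero_mi i) x\<bar> \<le> 2 * B / w" for i x
    proof -
      have o: "mi_order (inc zero_mi i) = 1" using mi_order_inc[of zero_mi i] by (simp del: mi_order_inc)
      have "\<bar>J (inc zero_mi i) x\<bar> \<le> \<bar>cutoff \<xi> (R + 3 * w) w (inc zero_mi i) x\<bar> + \<bar>cutoff \<xi> (R + w) w (inc zero_mi i) x\<bar>"
        unfolding J_def by (rule abs_triangle_ineq4)
      also have "\<dots> \<le> B * (1 / w) ^ mi_order (inc zero_mi i) + B * (1 / w) ^ mi_order (inc zero_mi i)"
        by (intro add_mono Bc w) (simp_all only: o)
      also have "\<dots> = 2 * B / w" unfolding o by simp
      finally show ?thesis .
    qed
    have "weight_fun (2 * B) w (J zero_mi) (\<lambda>i. J (inc zero_mi i))"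
      unfolding weight_fun_def
    proof (intro conjI allI)
      show "\<exists>a r. \<forall>x. x \<notin> cube a r \<longrightarrow> J zero_mi x = 0 \<and> (\<forall>i. J (inc zero_mi i) x = 0)"
      proof (intro exI[of _ \<xi>] exI[of _ "R + 4 * w"] allI impI)
        fix x assume "x \<notin> cube \<xi> (R + 4 * w)"
        then have "infnorm (x - \<xi>) \<ge> R + 4 * w \<or> infnorm (x - \<xi>) \<le> R + w" by (auto simp: cube_def)
        from out[OF this] show "J zero_mi x = 0 \<and> (\<forall>i. J (inc zero_mi i) x = 0)" by blast
      qed
    qed (use rng bd in \<open>auto intro: jet_continuous[OF J] jet_pdiff[OF J] simp del: fun_upd_apply\<close>)
    moreover have "J zero_mi x = 1" if "R + 2 * w \<le> infnorm (x - \<xi>) \<and> infnorm (x - \<xi>) \<le> R + 3 * w" for x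
      using that R w cutoff_inside[of "R + 3 * w" w x \<xi> zero_mi] cutoff_outside[of "R + w" w x \<xi> zero_mi]
      by (auto simp: J_def)
    moreover have "R + w < infnorm (x - \<xi>) \<and> infnorm (x - \<xi>) < R + 4 * w" if "J zero_mi x \<noteq> 0" for x
      using out[of x zero_mi] that by force
    ultimately show "\<exists>v dv. weight_fun (2 * B) w v dv \<and>
     (\<forall>x. R + 2 * w \<le> infnorm (x - \<xi>) \<and> infnorm (x - \<xi>) \<le> R + 3 * w \<longrightarrow> v x = 1) \<and>
     (\<forall>x. v x \<noteq> 0 \<longrightarrow> R + w < infnorm (x - \<xi>) \<and> infnorm (x - \<xi>) < R + 4 * w)" by blast
  qed
qed

text \<open>The pointwise estimate at \<open>\<alpha>\<close> involves the energy in the cube of radius \<open>w\<close> about \<open>\<alpha>\<close>.  Integrating it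
  over \<open>\<alpha>\<close> counts the energy at each point \<open>z\<close> once for every \<open>\<alpha>\<close> within distance \<open>w\<close>, that is with the volume
  \<open>(2 * w) ^ CARD('n)\<close>.\<close>

lemma annulus_zeroth_order:
  fixes U :: "'n::finite multiindex \<Rightarrow> real ^ 'n \<Rightarrow> real"
  assumes U: "jet U" "finite_energy m U" and w: "w > 0" and C: "C \<ge> 0"
    and est: "\<And>\<alpha>. R + w < infnorm (\<alpha> - \<xi>) \<Longrightarrow> infnorm (\<alpha> - \<xi>) < R + 4 * w \<Longrightarrow>
       (U zero_mi \<alpha>)\<^sup>2 \<le> C * (w ^ (2 * m) / w ^ CARD('n)) * local_energy m U (cube \<alpha> w)"
  shows "(\<integral>\<alpha>. indicator {z. R + w < infnorm (z - \<xi>) \<and> infnorm (z - \<xi>) < R + 4 * w} \<alpha> * (U zero_mi \<alpha>)\<^sup>2 \<partial>lborel)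
     \<le> C * 2 ^ CARD('n) * w ^ (2 * m) * (tail_energy m U \<xi> R - tail_energy m U \<xi> (R + 5 * w))"
proof -
  let ?S = "{z :: real ^ 'n. R + w < infnorm (z - \<xi>) \<and> infnorm (z - \<xi>) < R + 4 * w}"
  let ?S' = "{z :: real ^ 'n. R \<le> infnorm (z - \<xi>) \<and> infnorm (z - \<xi>) < R + 5 * w}"
  define c where "c = C * (w ^ (2 * m) / w ^ CARD('n))"
  have c: "c \<ge> 0" using C w by (simp add: c_def)
  have [measurable]: "edens m U \<in> borel_measurable borel" "U zero_mi \<in> borel_measurable borel"
    using U by (auto intro: edens_borel jet_borel)
  define D where "D = local_energy m U ?S'"
  have D: "D \<ge> 0" by (simp add: D_def)
  have "(\<integral>\<^sup>+\<alpha>. ennreal (indicator ?S \<alpha> * (U zero_mi \<alpha>)\<^sup>2) \<partial>lborel)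
     \<le> (\<integral>\<^sup>+\<alpha>. (\<integral>\<^sup>+z. ennreal c * (indicator ?S \<alpha> * (indicator {p. infnorm (snd p - fst p) \<le> w} (\<alpha>, z) * ennreal (edens m U z))) \<partial>lborel) \<partial>lborel)"
  proof (rule nn_integral_mono)
    fix \<alpha>
    show "ennreal (indicator ?S \<alpha> * (U zero_mi \<alpha>)\<^sup>2)
      \<le> (\<integral>\<^sup>+z. ennreal c * (indicator ?S \<alpha> * (indicator {p. infnorm (snd p - fst p) \<le> w} (\<alpha>, z) * ennreal (edens m U z))) \<partial>lborel)"
    proof (cases "\<alpha> \<in> ?S")
      case True
      then have "ennreal ((U zero_mi \<alpha>)\<^sup>2) \<le> ennreal (c * local_energy m U (cube \<alpha> w))"
        using est unfolding c_def by (intro ennreal_leI) auto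
      also have "\<dots> = ennreal c * ennreal (local_energy m U (cube \<alpha> w))" using c by (simp add: ennreal_mult)
      also have "ennreal (local_energy m U (cube \<alpha> w)) = (\<integral>\<^sup>+z. ennreal (indicator (cube \<alpha> w) z * edens m U z) \<partial>lborel)"
        unfolding local_energy_def by (intro nn_integral_eq_integral[symmetric] finite_energy_indicator U) auto
      also have "\<dots> = (\<integral>\<^sup>+z. indicator {p. infnorm (snd p - fst p) \<le> w} (\<alpha>, z) * ennreal (edens m U z) \<partial>lborel)"
        by (intro nn_integral_cong) (auto simp: cube_def indicator_def)
      also have "ennreal c * \<dots> = (\<integral>\<^sup>+z. ennreal c * (indicator {p. infnorm (snd p - fst p) \<le> w} (\<alpha>, z) * ennreal (edens m U z)) \<partial>lborel)"
        by (rule nn_integral_cmult[symmetric]) measurable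
      finally show ?thesis using True by simp
    qed simp
  qed
  also have "\<dots> = (\<integral>\<^sup>+z. (\<integral>\<^sup>+\<alpha>. ennreal c * (indicator ?S \<alpha> * (indicator {p. infnorm (snd p - fst p) \<le> w} (\<alpha>, z) * ennreal (edens m U z))) \<partial>lborel) \<partial>lborel)"
    by (rule lborel_pair.Fubini') measurable
  also have "\<dots> \<le> (\<integral>\<^sup>+z. ennreal (c * (2 * w) ^ CARD('n)) * ennreal (indicator ?S' z * edens m U z) \<partial>lborel)"
  proof (rule nn_integral_mono)
    fix z
    have "(\<integral>\<^sup>+\<alpha>. ennreal c * (indicator ?S \<alpha> * (indicator {p. infnorm (snd p - fst p) \<le> w} (\<alpha>, z) * ennreal (edens m U z))) \<partial>lborel)
       \<le> (\<integral>\<^sup>+\<alpha>. (ennreal c * ennreal (indicator ?S' z * edens m U z)) * indicator (cube z w) \<alpha> \<partial>lborel)"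
    proof (rule nn_integral_mono)
      fix \<alpha>
      have "z \<in> ?S' \<and> \<alpha> \<in> cube z w" if "\<alpha> \<in> ?S" "infnorm (z - \<alpha>) \<le> w"
      proof -
        have "infnorm (z - \<xi>) \<le> infnorm (z - \<alpha>) + infnorm (\<alpha> - \<xi>)"
          "infnorm (\<alpha> - \<xi>) \<le> infnorm (\<alpha> - z) + infnorm (z - \<xi>)"
          using infnorm_triangle[of "z - \<alpha>" "\<alpha> - \<xi>"] infnorm_triangle[of "\<alpha> - z" "z - \<xi>"] by simp_all
        then show ?thesis using that by (auto simp: cube_def infnorm_sub[of \<alpha> z])
      qed
      then show "ennreal c * (indicator ?S \<alpha> * (indicator {p. infnorm (snd p - fst p) \<le> w} (\<alpha>, z) * ennreal (edens m U z)))
        \<le> (ennreal c * ennreal (indicator ?S' z * edens m U z)) * indicator (cube z w) \<alpha>"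
        by (cases "\<alpha> \<in> ?S \<and> infnorm (z - \<alpha>) \<le> w") auto
    qed
    also have "\<dots> = (ennreal c * ennreal (indicator ?S' z * edens m U z)) * ennreal ((2 * w) ^ CARD('n))"
      using w by (subst nn_integral_cmult_indicator) (auto simp: emeasure_cube)
    also have "\<dots> = ennreal (c * (2 * w) ^ CARD('n)) * ennreal (indicator ?S' z * edens m U z)"
      using c w by (simp add: ennreal_mult mult_ac)
    finally show "(\<integral>\<^sup>+\<alpha>. ennreal c * (indicator ?S \<alpha> * (indicator {p. infnorm (snd p - fst p) \<le> w} (\<alpha>, z) * ennreal (edens m U z))) \<partial>lborel)
       \<le> ennreal (c * (2 * w) ^ CARD('n)) * ennreal (indicator ?S' z * edens m U z)" .
  qed
  also have "\<dots> = ennreal (c * (2 * w) ^ CARD('n)) * (\<integral>\<^sup>+z. ennreal (indicator ?S' z * edens m U z) \<partial>lborel)"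
    by (rule nn_integral_cmult) measurable
  also have "(\<integral>\<^sup>+z. ennreal (indicator ?S' z * edens m U z) \<partial>lborel) = ennreal D"
    unfolding D_def local_energy_def by (intro nn_integral_eq_integral finite_energy_indicator U) auto
  also have "ennreal (c * (2 * w) ^ CARD('n)) * ennreal D = ennreal (c * (2 * w) ^ CARD('n) * D)"
    using c w D by (simp add: ennreal_mult)
  finally have le: "(\<integral>\<^sup>+\<alpha>. ennreal (indicator ?S \<alpha> * (U zero_mi \<alpha>)\<^sup>2) \<partial>lborel) \<le> ennreal (c * (2 * w) ^ CARD('n) * D)" .
  have "(\<integral>\<alpha>. indicator ?S \<alpha> * (U zero_mi \<alpha>)\<^sup>2 \<partial>lborel) \<le> c * (2 * w) ^ CARD('n) * D"
    using le c w D by (intro integral_real_bounded) (auto simp: ennreal_mult)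
  also have "c * (2 * w) ^ CARD('n) = C * 2 ^ CARD('n) * w ^ (2 * m)"
    using w by (simp add: c_def power_mult_distrib)
  also have "D = tail_energy m U \<xi> R - tail_energy m U \<xi> (R + 5 * w)"
    unfolding D_def using w by (intro tail_energy_diff[symmetric] U) auto
  finally show ?thesis .
qed

lemma sum_sq_le_edens: "(\<Sum>\<beta> | mi_order \<beta> = m. (U \<beta> x)\<^sup>2) \<le> edens m U x"
  unfolding edens_def
proof (rule sum_mono)
  fix \<beta> :: "'a multiindex" assume "\<beta> \<in> {\<beta>. mi_order \<beta> = m}"
  then show "(U \<beta> x)\<^sup>2 \<le> fact m / mi_fact \<beta> * (U \<beta> x)\<^sup>2"
    using energy_coeff_ge1[of \<beta> m] mult_right_mono[of 1 "fact m / mi_fact \<beta>" "(U \<beta> x)\<^sup>2"] by simp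
qed

text \<open>Cut \<open>U\<close> off by a function that is one up to distance \<open>R + 2 * w\<close> from \<open>\<xi>\<close> and zero beyond
  \<open>R + 3 * w\<close>.  The product still has the values of a Lagrange function at the centers, so by near-minimality
  the energy of \<open>U\<close> beyond \<open>R + 2 * w\<close> is at most the energy of the product in the annulus in between, up to
  \<open>\<eta>\<close>.  That energy involves all derivatives of \<open>U\<close> of order up to \<open>m\<close>, scaled by powers of \<open>w\<close>.
  Interpolation reduces them to orders \<open>0\<close> and \<open>m\<close>.  Near the annulus the reproduction uses centers within
  distance \<open>w\<close> only, at which \<open>U\<close> vanishes, so order \<open>0\<close> is controlled by order \<open>m\<close> as well.\<close>

lemma decay_step:
  assumes m: "real m > real CARD('n::finite) / 2"
  obtains C where "C \<ge> 0"
    and "\<And>(U :: 'n multiindex \<Rightarrow> real ^ 'n \<Rightarrow> real) \<Omega> \<Xi> l \<rho> \<xi> \<eta> R w.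
     near_minimizer m \<Xi> \<xi> \<eta> U \<Longrightarrow> finite \<Xi> \<Longrightarrow> l \<ge> m \<Longrightarrow> local_density \<Omega> \<Xi> l K \<rho> \<Longrightarrow> R \<ge> 0 \<Longrightarrow> w > 0 \<Longrightarrow>
     cube \<xi> (R + 5 * w) \<subseteq> \<Omega> \<Longrightarrow> (\<forall>\<alpha>\<in>cube \<xi> (R + 5 * w). \<rho> \<alpha> \<le> w) \<Longrightarrow>
     tail_energy m U \<xi> (R + 5 * w) \<le> C * (tail_energy m U \<xi> R - tail_energy m U \<xi> (R + 5 * w)) + \<eta>"
proof -
  let ?d = "CARD('n)"
  obtain Cz where Cz: "Cz > 0" and est: "\<And>(U :: 'n multiindex \<Rightarrow> real ^ 'n \<Rightarrow> real) \<Omega> \<Xi> l \<rho> \<alpha> w.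
     jet U \<Longrightarrow> finite \<Xi> \<Longrightarrow> l \<ge> m \<Longrightarrow> local_density \<Omega> \<Xi> l K \<rho> \<Longrightarrow> \<alpha> \<in> \<Omega> \<Longrightarrow> \<rho> \<alpha> \<le> w \<Longrightarrow>
     (\<exists>a. (\<forall>\<xi>\<in>\<Xi>. a \<xi> \<noteq> 0 \<longrightarrow> \<xi> \<in> cube \<alpha> w) \<and> (\<Sum>\<xi>\<in>\<Xi>. \<bar>a \<xi>\<bar>) \<le> K \<and>
       (U zero_mi \<alpha> - (\<Sum>\<xi>\<in>\<Xi>. a \<xi> * U zero_mi \<xi>))\<^sup>2 \<le> Cz * (w ^ (2 * m) / w ^ ?d) * local_energy m U (cube \<alpha> w))"
  proof (rule density_estimate[OF m, of K], goal_cases)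
    case 1
    show ?case by (rule 1(1)[OF 1(2) 1(3)])
  qed
  obtain M where M: "M \<ge> 0" and wt: "\<And>(\<xi> :: real ^ 'n) R w. R \<ge> 0 \<Longrightarrow> w > 0 \<Longrightarrow> (\<exists>v dv. weight_fun M w v dv \<and>
     (\<forall>x. R + 2 * w \<le> infnorm (x - \<xi>) \<and> infnorm (x - \<xi>) \<le> R + 3 * w \<longrightarrow> v x = 1) \<and>
     (\<forall>x. v x \<noteq> 0 \<longrightarrow> R + w < infnorm (x - \<xi>) \<and> infnorm (x - \<xi>) < R + 4 * w))"
  proof (rule annulus_weight[where 'n = 'n], goal_cases)
    case 1
    show ?case by (rule 1(1)[OF 1(2) 1(3)])
  qed
  obtain B where B: "B \<ge> 1" and Bc: "\<And>(a :: real ^ 'n) R w \<beta> x. w > 0 \<Longrightarrow> mi_order \<beta> \<le> m \<Longrightarrow>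
     \<bar>cutoff a R w \<beta> x\<bar> \<le> B * (1 / w) ^ mi_order \<beta>"
  proof (rule cutoff_bounded[where 'n = 'n and m = m], goal_cases)
    case 1
    show ?case by (rule 1(1)[OF 1(2) 1(3)])
  qed
  obtain C1 where C1: "C1 \<ge> 0" and mj: "\<And>(T :: 'n multiindex \<Rightarrow> real ^ 'n \<Rightarrow> real) U x w.
    w > 0 \<Longrightarrow> \<forall>\<beta>. mi_order \<beta> \<le> m \<longrightarrow> \<bar>T \<beta> x\<bar> \<le> B * (1 / w) ^ mi_order \<beta> \<Longrightarrow>
    edens m (mult_jet T U) x \<le> C1 * (\<Sum>\<gamma> | mi_order \<gamma> \<le> m. (1 / w) ^ (2 * (m - mi_order \<gamma>)) * (U \<gamma> x)\<^sup>2)"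
  proof (rule edens_mult_jet_le[where 'n = 'n and B = B and m = m], goal_cases)
    case 1
    show ?case using B by simp
  next
    case 2
    show ?case by (rule 2(1)[OF 2(2) 2(3)])
  qed
  obtain A where A: "A \<ge> 0" and ip: "\<And>w v dv (U :: 'n multiindex \<Rightarrow> real ^ 'n \<Rightarrow> real) \<gamma>.
    w > 0 \<Longrightarrow> weight_fun M w v dv \<Longrightarrow> jet U \<Longrightarrow> mi_order \<gamma> \<le> m \<Longrightarrow>
    (1 / w) ^ (2 * (m - mi_order \<gamma>)) * (\<integral>x. v x ^ (2 * mi_order \<gamma> + 2) * (U \<gamma> x)\<^sup>2 \<partial>lborel)
      \<le> A * ((1 / w) ^ (2 * m) * (\<integral>x. (v x)\<^sup>2 * (U zero_mi x)\<^sup>2 \<partial>lborel)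
           + (\<Sum>\<beta> | mi_order \<beta> = m. \<integral>x. v x ^ (2 * m + 2) * (U \<beta> x)\<^sup>2 \<partial>lborel))"
  proof (rule weighted_interpolation_all[where 'n = 'n and m = m and M = M], goal_cases)
    case 1
    show ?case by (rule 1(1)[OF 1(2) 1(3)])
  qed
  define N where "N = real (card {\<gamma> :: 'n multiindex. mi_order \<gamma> \<le> m})"
  define C where "C = C1 * (N * (A * (Cz * 2 ^ ?d + 1)))"
  have C: "C \<ge> 0" using C1 A Cz by (simp add: C_def N_def)
  have main: "tail_energy m U \<xi> (R + 5 * w) \<le> C * (tail_energy m U \<xi> R - tail_energy m U \<xi> (R + 5 * w)) + \<eta>"
    if nm: "near_minimizer m \<Xi> \<xi> \<eta> U" and fin: "finite \<Xi>" and l: "l \<ge> m" and ld: "local_density \<Omega> \<Xi> l K \<rho>"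
      and R: "R \<ge> 0" and w: "w > 0" and sub: "cube \<xi> (R + 5 * w) \<subseteq> \<Omega>"
      and \<rho>w: "\<forall>\<alpha>\<in>cube \<xi> (R + 5 * w). \<rho> \<alpha> \<le> w"
    for U :: "'n multiindex \<Rightarrow> real ^ 'n \<Rightarrow> real" and \<Omega> \<Xi> l \<rho> \<xi> \<eta> R w
  proof -
    have lj: "lagrange_jet m \<Xi> \<xi> U" using nm by (simp add: near_minimizer_def)
    then have U: "jet U" "finite_energy m U" and U\<xi>: "U zero_mi \<xi> = 1" and U0: "\<And>\<zeta>. \<zeta> \<in> \<Xi> \<Longrightarrow> \<zeta> \<noteq> \<xi> \<Longrightarrow> U zero_mi \<zeta> = 0"
      by (auto simp: lagrange_jet_def)
    define \<Delta> where "\<Delta> = tail_energy m U \<xi> R - tail_energy m U \<xi> (R + 5 * w)"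
    have \<Delta>: "\<Delta> = local_energy m U {z. R \<le> infnorm (z - \<xi>) \<and> infnorm (z - \<xi>) < R + 5 * w}"
      unfolding \<Delta>_def using w by (intro tail_energy_diff U) auto
    have \<Delta>0: "\<Delta> \<ge> 0" by (simp add: \<Delta>)
    obtain v dv where W: "weight_fun M w v dv"
      and v1: "\<And>x. R + 2 * w \<le> infnorm (x - \<xi>) \<Longrightarrow> infnorm (x - \<xi>) \<le> R + 3 * w \<Longrightarrow> v x = 1"
      and vs: "\<And>x. v x \<noteq> 0 \<Longrightarrow> R + w < infnorm (x - \<xi>) \<and> infnorm (x - \<xi>) < R + 4 * w"
      using wt[OF R w, of \<xi>] by blast
    have vc: "continuous_on UNIV v" and vr: "\<And>x. 0 \<le> v x" "\<And>x. v x \<le> 1"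
      using W by (auto simp: weight_fun_def)
    have vint: "integrable lborel (\<lambda>x. v x ^ j * (U \<gamma> x)\<^sup>2)" if "j > 0" for j \<gamma>
    proof (rule integrable_vanish_outside_cube)
      show "continuous_on UNIV (\<lambda>x. v x ^ j * (U \<gamma> x)\<^sup>2)" by (intro continuous_intros vc jet_continuous[OF U(1)])
      show "v x ^ j * (U \<gamma> x)\<^sup>2 = 0" if "x \<notin> cube \<xi> (R + 4 * w)" for x
        using vs[of x] that \<open>j > 0\<close> by (cases "v x = 0") (auto simp: cube_def)
    qed
    let ?S = "{z :: real ^ 'n. R + w < infnorm (z - \<xi>) \<and> infnorm (z - \<xi>) < R + 4 * w}"
    have zero: "(\<integral>\<alpha>. indicator ?S \<alpha> * (U zero_mi \<alpha>)\<^sup>2 \<partial>lborel) \<le> Cz * 2 ^ ?d * w ^ (2 * m) * \<Delta>"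
      unfolding \<Delta>_def
    proof (rule annulus_zeroth_order[OF U w])
      show "0 \<le> Cz" using Cz by simp
      fix \<alpha> assume \<alpha>: "R + w < infnorm (\<alpha> - \<xi>)" "infnorm (\<alpha> - \<xi>) < R + 4 * w"
      then have \<alpha>c: "\<alpha> \<in> cube \<xi> (R + 5 * w)" using w by (simp add: cube_def)
      then obtain a where a: "\<forall>\<xi>\<in>\<Xi>. a \<xi> \<noteq> 0 \<longrightarrow> \<xi> \<in> cube \<alpha> w"
        "(U zero_mi \<alpha> - (\<Sum>\<xi>\<in>\<Xi>. a \<xi> * U zero_mi \<xi>))\<^sup>2 \<le> Cz * (w ^ (2 * m) / w ^ ?d) * local_energy m U (cube \<alpha> w)"
        using est[OF U(1) fin l ld, of \<alpha> w] sub \<rho>w by blast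
      \<comment> \<open>The center \<open>\<xi>\<close>, where \<open>U\<close> is one, is too far away from \<open>\<alpha>\<close> to enter the reproduction.\<close>
      have "a \<zeta> * U zero_mi \<zeta> = 0" if "\<zeta> \<in> \<Xi>" for \<zeta>
      proof (cases "\<zeta> = \<xi>")
        case True
        have "\<xi> \<notin> cube \<alpha> w" using \<alpha>(1) R by (simp add: cube_def infnorm_sub[of \<xi> \<alpha>])
        then show ?thesis using a(1) that True by auto
      qed (use U0 that in simp)
      then have "(\<Sum>\<xi>\<in>\<Xi>. a \<xi> * U zero_mi \<xi>) = 0" by (intro sum.neutral) auto
      then show "(U zero_mi \<alpha>)\<^sup>2 \<le> Cz * (w ^ (2 * m) / w ^ ?d) * local_energy m U (cube \<alpha> w)"
        using a(2) by simp
    qed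
    have v0: "(\<integral>x. (v x)\<^sup>2 * (U zero_mi x)\<^sup>2 \<partial>lborel) \<le> Cz * 2 ^ ?d * w ^ (2 * m) * \<Delta>"
    proof (rule order.trans[OF integral_mono zero])
      show "integrable lborel (\<lambda>x. (v x)\<^sup>2 * (U zero_mi x)\<^sup>2)" by (rule vint) simp
      have "integrable lborel (\<lambda>x. indicator ?S x *\<^sub>R (indicator (cube \<xi> (R + 4 * w)) x * (U zero_mi x)\<^sup>2))"
        by (intro integrable_mult_indicator integrable_cube_continuous continuous_intros jet_continuous[OF U(1)]) auto
      moreover have "(\<lambda>x. indicator ?S x *\<^sub>R (indicator (cube \<xi> (R + 4 * w)) x * (U zero_mi x)\<^sup>2)) = (\<lambda>x. indicator ?S x * (U zero_mi x)\<^sup>2)"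
        by (auto simp: fun_eq_iff indicator_def cube_def)
      ultimately show "integrable lborel (\<lambda>x. indicator ?S x * (U zero_mi x)\<^sup>2)" by simp
      show "(v x)\<^sup>2 * (U zero_mi x)\<^sup>2 \<le> indicator ?S x * (U zero_mi x)\<^sup>2" for x
        using vs[of x] vr[of x] by (cases "v x = 0") (auto simp: power_le_one mult_left_le_one_le)
    qed
    have vm: "(\<Sum>\<beta> | mi_order \<beta> = m. \<integral>x. v x ^ (2 * m + 2) * (U \<beta> x)\<^sup>2 \<partial>lborel) \<le> \<Delta>"
    proof -
      have "(\<Sum>\<beta> | mi_order \<beta> = m. \<integral>x. v x ^ (2 * m + 2) * (U \<beta> x)\<^sup>2 \<partial>lborel)
         = (\<integral>x. (\<Sum>\<beta> | mi_order \<beta> = m. v x ^ (2 * m + 2) * (U \<beta> x)\<^sup>2) \<partial>lborel)"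
        by (intro Bochner_Integration.integral_sum[symmetric] vint) simp
      also have "\<dots> \<le> \<Delta>"
        unfolding \<Delta> local_energy_def
      proof (rule integral_mono)
        show "integrable lborel (\<lambda>x. \<Sum>\<beta> | mi_order \<beta> = m. v x ^ (2 * m + 2) * (U \<beta> x)\<^sup>2)"
          by (intro Bochner_Integration.integrable_sum vint) simp
        show "integrable lborel (\<lambda>x. indicator {z. R \<le> infnorm (z - \<xi>) \<and> infnorm (z - \<xi>) < R + 5 * w} x * edens m U x)"
          by (intro finite_energy_indicator U) measurable
        fix x
        show "(\<Sum>\<beta> | mi_order \<beta> = m. v x ^ (2 * m + 2) * (U \<beta> x)\<^sup>2)
           \<le> indicator {z. R \<le> infnorm (z - \<xi>) \<and> infnorm (z - \<xi>) < R + 5 * w} x * edens m U x"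
        proof (cases "v x = 0")
          case False
          have "(\<Sum>\<beta> | mi_order \<beta> = m. v x ^ (2 * m + 2) * (U \<beta> x)\<^sup>2) \<le> (\<Sum>\<beta> | mi_order \<beta> = m. (U \<beta> x)\<^sup>2)"
            using vr[of x] by (intro sum_mono mult_left_le_one_le) (auto simp: power_le_one simp del: power_Suc power_add)
          also have "\<dots> \<le> edens m U x" by (rule sum_sq_le_edens)
          finally show ?thesis using vs[OF False] R w by simp
        qed simp
      qed
      finally show ?thesis .
    qed
    have each: "(1 / w) ^ (2 * (m - mi_order \<gamma>)) * (\<integral>x. v x ^ (2 * mi_order \<gamma> + 2) * (U \<gamma> x)\<^sup>2 \<partial>lborel) \<le> A * ((Cz * 2 ^ ?d + 1) * \<Delta>)"
      if "mi_order \<gamma> \<le> m" for \<gamma>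
    proof -
      have "(1 / w) ^ (2 * m) * (\<integral>x. (v x)\<^sup>2 * (U zero_mi x)\<^sup>2 \<partial>lborel) \<le> (1 / w) ^ (2 * m) * (Cz * 2 ^ ?d * w ^ (2 * m) * \<Delta>)"
        using w by (intro mult_left_mono v0) auto
      also have "\<dots> = Cz * 2 ^ ?d * \<Delta>" using w by (simp add: power_one_over)
      finally have "(1 / w) ^ (2 * m) * (\<integral>x. (v x)\<^sup>2 * (U zero_mi x)\<^sup>2 \<partial>lborel)
           + (\<Sum>\<beta> | mi_order \<beta> = m. \<integral>x. v x ^ (2 * m + 2) * (U \<beta> x)\<^sup>2 \<partial>lborel) \<le> (Cz * 2 ^ ?d + 1) * \<Delta>"
        using vm by (simp add: distrib_right)
      then show ?thesis by (intro order.trans[OF ip[OF w W U(1) that]] mult_left_mono A)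
    qed
    \<comment> \<open>On the annulus where \<open>T\<close> drops from one to zero, the weight \<open>v\<close> is one.\<close>
    define T where "T = cutoff \<xi> (R + 2 * w) w"
    define V where "V = mult_jet T U"
    have Vj: "jet V" unfolding V_def T_def by (intro jet_mult jet_cutoff U)
    have T1: "T \<gamma> x = (if \<gamma> = zero_mi then 1 else 0)" if "infnorm (x - \<xi>) \<le> R + 2 * w" for \<gamma> x
      unfolding T_def using that R w by (intro cutoff_inside) auto
    have T0: "T \<gamma> x = 0" if "infnorm (x - \<xi>) \<ge> R + 3 * w" for \<gamma> x
      unfolding T_def using that R w by (intro cutoff_outside) auto
    have Vin: "V \<beta> x = U \<beta> x" if "infnorm (x - \<xi>) \<le> R + 2 * w" for \<beta> x
      unfolding V_def using T1[OF that] by (rule mult_jet_const_1)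
    have Vout: "V \<beta> x = 0" if "infnorm (x - \<xi>) \<ge> R + 3 * w" for \<beta> x
      unfolding V_def using T0[OF that] by (rule mult_jet_0)
    have Vf: "finite_energy m V"
      by (rule finite_energy_vanish_outside_cube[OF Vj, where a = \<xi> and r = "R + 3 * w"]) (use Vout in \<open>auto simp: cube_def\<close>)
    have "lagrange_jet m \<Xi> \<xi> V"
      unfolding lagrange_jet_def
    proof (intro conjI ballI Vj Vf)
      show "V zero_mi \<xi> = 1" using Vin[of \<xi> zero_mi] U\<xi> R w by (simp add: infnorm_0)
      show "V zero_mi \<zeta> = 0" if "\<zeta> \<in> \<Xi> - {\<xi>}" for \<zeta>
        using U0[of \<zeta>] that by (simp add: V_def mult_jet_zero)
    qed
    then have EUV: "energy m U \<le> energy m V + \<eta>" using nm by (simp add: near_minimizer_def)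
    let ?I = "{z :: real ^ 'n. infnorm (z - \<xi>) < R + 2 * w}"
    let ?T = "{z :: real ^ 'n. infnorm (z - \<xi>) \<ge> R + 2 * w}"
    let ?A = "{z :: real ^ 'n. R + 2 * w \<le> infnorm (z - \<xi>) \<and> infnorm (z - \<xi>) \<le> R + 3 * w}"
    have sp: "energy m G = local_energy m G ?I + local_energy m G ?T" if "finite_energy m G" for G :: "'n multiindex \<Rightarrow> real ^ 'n \<Rightarrow> real"
    proof -
      have "local_energy m G ?I + local_energy m G ?T = (\<integral>x. indicator ?I x * edens m G x + indicator ?T x * edens m G x \<partial>lborel)"
        unfolding local_energy_def by (intro Bochner_Integration.integral_add[symmetric] finite_energy_indicator that) measurable
      also have "\<dots> = energy m G" unfolding energy_def by (intro Bochner_Integration.integral_cong) (auto simp: indicator_def)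
      finally show ?thesis by simp
    qed
    have VI: "local_energy m V ?I = local_energy m U ?I"
      unfolding local_energy_def by (intro Bochner_Integration.integral_cong) (auto simp: indicator_def edens_def Vin)
    have VT: "local_energy m V ?T = local_energy m V ?A"
      unfolding local_energy_def by (intro Bochner_Integration.integral_cong) (auto simp: indicator_def edens_def Vout)
    have tail: "tail_energy m U \<xi> (R + 2 * w) \<le> local_energy m V ?A + \<eta>"
      using EUV sp[OF U(2)] sp[OF Vf] VI VT by (simp add: tail_energy_def)
    have "local_energy m V ?A \<le> (\<integral>x. C1 * (\<Sum>\<gamma> | mi_order \<gamma> \<le> m. (1 / w) ^ (2 * (m - mi_order \<gamma>)) * (v x ^ (2 * mi_order \<gamma> + 2) * (U \<gamma> x)\<^sup>2)) \<partial>lborel)"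
      unfolding local_energy_def
    proof (rule integral_mono)
      show "integrable lborel (\<lambda>x. indicator ?A x * edens m V x)" by (intro finite_energy_indicator Vf) measurable
      show "integrable lborel (\<lambda>x. C1 * (\<Sum>\<gamma> | mi_order \<gamma> \<le> m. (1 / w) ^ (2 * (m - mi_order \<gamma>)) * (v x ^ (2 * mi_order \<gamma> + 2) * (U \<gamma> x)\<^sup>2)))"
        by (intro integrable_mult_right Bochner_Integration.integrable_sum vint) simp
      fix x
      show "indicator ?A x * edens m V x \<le> C1 * (\<Sum>\<gamma> | mi_order \<gamma> \<le> m. (1 / w) ^ (2 * (m - mi_order \<gamma>)) * (v x ^ (2 * mi_order \<gamma> + 2) * (U \<gamma> x)\<^sup>2))"
      proof (cases "x \<in> ?A")
        case True
        then have "v x = 1" using v1 by auto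
        moreover have "edens m V x \<le> C1 * (\<Sum>\<gamma> | mi_order \<gamma> \<le> m. (1 / w) ^ (2 * (m - mi_order \<gamma>)) * (U \<gamma> x)\<^sup>2)"
          unfolding V_def by (rule mj[OF w]) (use Bc[OF w] in \<open>auto simp: T_def\<close>)
        ultimately show ?thesis using True by simp
      next
        case False
        have "0 \<le> (\<Sum>\<gamma> :: 'n multiindex | mi_order \<gamma> \<le> m. (1 / w) ^ (2 * (m - mi_order \<gamma>)) * (v x ^ (2 * mi_order \<gamma> + 2) * (U \<gamma> x)\<^sup>2))"
          using vr w by (intro sum_nonneg mult_nonneg_nonneg) auto
        then show ?thesis using C1 False by simp
      qed
    qed
    also have "\<dots> = C1 * (\<Sum>\<gamma> | mi_order \<gamma> \<le> m. (1 / w) ^ (2 * (m - mi_order \<gamma>)) * (\<integral>x. v x ^ (2 * mi_order \<gamma> + 2) * (U \<gamma> x)\<^sup>2 \<partial>lborel))"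
      unfolding integral_mult_right_zero
      by (subst Bochner_Integration.integral_sum) (auto intro!: integrable_mult_right vint simp del: power_Suc power_add)
    also have "\<dots> \<le> C1 * (of_nat (card {\<gamma> :: 'n multiindex. mi_order \<gamma> \<le> m}) * (A * ((Cz * 2 ^ ?d + 1) * \<Delta>)))"
      using each by (intro mult_left_mono C1 sum_bounded_above) auto
    also have "\<dots> = C * \<Delta>" by (simp add: C_def N_def)
    finally have "local_energy m V ?A \<le> C * \<Delta>" .
    moreover have "tail_energy m U \<xi> (R + 5 * w) \<le> tail_energy m U \<xi> (R + 2 * w)"
      using w by (intro tail_energy_antimono U) auto
    ultimately show ?thesis using tail unfolding \<Delta>_def by linarith
  qed
  show ?thesis by (rule that[OF C main])
qed

section \<open>Decay of the tail energy\<close>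

text \<open>Slow growth makes the local density parameter small compared with the distance from \<open>\<xi>\<close>: by
  choice of \<open>A\<close> the ratio is as small as one likes once the distance exceeds \<open>A * \<rho> \<xi>\<close>.\<close>

lemma slow_growth_cube:
  fixes \<xi> :: "real ^ 'n::finite"
  assumes sg: "slow_growth \<Omega> \<epsilon> \<rho>" and \<epsilon>: "0 < \<epsilon>" "\<epsilon> < 1" and \<xi>: "\<xi> \<in> \<Omega>" and r: "\<rho> \<xi> > 0"
    and \<alpha>: "\<alpha> \<in> \<Omega>" "\<alpha> \<in> cube \<xi> (2 * R)" and R: "R \<ge> A * \<rho> \<xi>" and A: "A \<ge> 1"
  shows "\<rho> \<alpha> \<le> R * (1 + 2 * sqrt CARD('n)) * A powr (- \<epsilon>)"
proof -
  define r where "r = \<rho> \<xi>"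
  have r0: "r > 0" using r by (simp add: r_def)
  define t where "t = R / r"
  have t: "t \<ge> A" using R r0 by (simp add: t_def r_def le_divide_eq)
  have t1: "t \<ge> 1" using t A by simp
  define s where "s = sqrt (real CARD('n))"
  have s: "s \<ge> 0" by (simp add: s_def)
  have "norm (\<xi> - \<alpha>) \<le> s * infnorm (\<xi> - \<alpha>)" using norm_le_infnorm[of "\<xi> - \<alpha>"] by (simp add: s_def)
  also have "\<dots> \<le> s * (2 * R)"
    using \<alpha>(2) s by (intro mult_left_mono) (auto simp: cube_def infnorm_sub[of \<xi> \<alpha>])
  finally have "norm (\<xi> - \<alpha>) / r \<le> 2 * s * t" using r0 by (simp add: t_def divide_right_mono field_simps)
  then have le: "1 + norm (\<xi> - \<alpha>) / r \<le> (1 + 2 * s) * t" using t1 by (simp add: distrib_right)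
  have "\<rho> \<alpha> \<le> r * (1 + norm (\<xi> - \<alpha>) / r) powr (1 - \<epsilon>)"
    using sg \<xi> \<alpha>(1) by (simp add: slow_growth_def r_def)
  also have "\<dots> \<le> r * ((1 + 2 * s) * t) powr (1 - \<epsilon>)"
    using le r0 \<epsilon> by (intro mult_left_mono powr_mono2) auto
  also have "((1 + 2 * s) * t) powr (1 - \<epsilon>) = (1 + 2 * s) powr (1 - \<epsilon>) * t powr (1 - \<epsilon>)"
    by (rule powr_mult)
  also have "(1 + 2 * s) powr (1 - \<epsilon>) * t powr (1 - \<epsilon>) \<le> (1 + 2 * s) * (t * A powr (- \<epsilon>))"
  proof (rule mult_mono)
    show "(1 + 2 * s) powr (1 - \<epsilon>) \<le> 1 + 2 * s"
      using powr_mono[of "1 - \<epsilon>" 1 "1 + 2 * s"] \<epsilon> s by simp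
    have "t powr (1 - \<epsilon>) = t * t powr (- \<epsilon>)"
      using t1 powr_add[of t 1 "- \<epsilon>"] by simp
    also have "t powr (- \<epsilon>) \<le> A powr (- \<epsilon>)" using t A \<epsilon> by (intro powr_mono2') auto
    finally show "t powr (1 - \<epsilon>) \<le> t * A powr (- \<epsilon>)" using t1 by simp
  qed (use s in auto)
  also have "r * ((1 + 2 * s) * (t * A powr (- \<epsilon>))) = R * (1 + 2 * s) * A powr (- \<epsilon>)"
    using r0 by (simp add: t_def)
  finally show ?thesis using r0 by (simp add: s_def)
qed

lemma geometric_steps:
  fixes G :: "real \<Rightarrow> real"
  assumes step: "\<And>j. j < N \<Longrightarrow> G (R + real (Suc j) * h) \<le> \<theta> * G (R + real j * h)" and \<theta>: "\<theta> \<ge> 0"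
  shows "j \<le> N \<Longrightarrow> G (R + real j * h) \<le> \<theta> ^ j * G R"
proof (induction j)
  case (Suc j)
  have "G (R + real (Suc j) * h) \<le> \<theta> * G (R + real j * h)" using Suc.prems by (intro step) simp
  also have "\<dots> \<le> \<theta> * (\<theta> ^ j * G R)" using Suc \<theta> by (intro mult_left_mono) auto
  finally show ?case by (simp add: mult.assoc)
qed simp

lemma dyadic_scale:
  fixes z :: real
  assumes "z \<ge> 1"
  obtains j :: nat where "2 ^ j \<le> z" "z < 2 ^ Suc j"
proof -
  have "\<exists>n. z < 2 ^ n" by (rule real_arch_pow) simp
  then obtain n where n: "z < 2 ^ n" "\<And>k. k < n \<Longrightarrow> \<not> z < 2 ^ k"
    using exists_least_iff[of "\<lambda>n. z < 2 ^ n"] by blast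
  then have "n \<noteq> 0" using assms by (cases n) auto
  then obtain j where "n = Suc j" by (cases n) auto
  then show ?thesis using n(1) n(2)[of j] that[of j] by (simp add: not_less)
qed

text \<open>The decay step says that the excess of the tail energy over \<open>\<eta>\<close> is multiplied by \<open>\<theta> < 1\<close> whenever the
  radius grows by \<open>5 * w\<close>.  Far from \<open>\<xi>\<close>, between \<open>R\<close> and \<open>2 * R\<close>, there is room for \<open>N\<close> such steps with
  \<open>w = R / (5 * N)\<close>, because slow growth keeps the local density parameter below this \<open>w\<close>.  Hence doubling
  the radius gains \<open>\<theta> ^ N \<le> (1 / 2) ^ J\<close>, which is polynomial decay of order \<open>J\<close>.\<close>

lemma tail_energy_decay:
  fixes J :: nat
  assumes m: "real m > real CARD('n::finite) / 2" and \<epsilon>: "0 < \<epsilon>" "\<epsilon> < 1"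
  obtains C where "C \<ge> 0"
    and "\<And>(U :: 'n multiindex \<Rightarrow> real ^ 'n \<Rightarrow> real) \<Omega> \<Xi> l \<rho> \<xi> \<eta> R.
     near_minimizer m \<Xi> \<xi> \<eta> U \<Longrightarrow> \<eta> > 0 \<Longrightarrow> finite \<Xi> \<Longrightarrow> l \<ge> m \<Longrightarrow> local_density \<Omega> \<Xi> l K \<rho> \<Longrightarrow>
     slow_growth \<Omega> \<epsilon> \<rho> \<Longrightarrow> \<xi> \<in> \<Omega> \<Longrightarrow> R \<ge> 0 \<Longrightarrow> cube \<xi> R \<subseteq> \<Omega> \<Longrightarrow>
     tail_energy m U \<xi> R \<le> C * energy m U / (1 + R / \<rho> \<xi>) ^ J + \<eta>"
proof (rule decay_step[OF m, where K = K], goal_cases)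
  case (1 C)
  note C = 1(2) and step = 1(3)
  define \<theta> where "\<theta> = C / (1 + C)"
  have \<theta>: "0 \<le> \<theta>" "\<theta> < 1" using C by (auto simp: \<theta>_def)
  have "(\<lambda>n. \<theta> ^ n) \<longlonglongrightarrow> 0" using \<theta> by (intro LIMSEQ_power_zero) auto
  then have "\<forall>\<^sub>F n in sequentially. \<theta> ^ n < (1 / 2) ^ J" by (rule order_tendstoD) simp
  then obtain N0 where "\<And>n. n \<ge> N0 \<Longrightarrow> \<theta> ^ n < (1 / 2) ^ J" by (auto simp: eventually_sequentially)
  then obtain N where N: "N \<ge> 1" "\<theta> ^ N \<le> (1 / 2) ^ J"
    by (metis less_imp_le max.cobounded1 max.cobounded2)
  define s where "s = sqrt (real CARD('n))"
  have s: "s \<ge> 0" by (simp add: s_def)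
  \<comment> \<open>Beyond distance \<open>A * \<rho> \<xi>\<close> slow growth gives \<open>\<rho> \<le> R / (5 * N)\<close> on the cube of radius \<open>2 * R\<close>.\<close>
  define A where "A = (5 * N * (1 + 2 * s)) powr (1 / \<epsilon>)"
  have b1: "5 * N * (1 + 2 * s) \<ge> 1"
    using N s mult_mono[of 1 "5 * real N" 1 "1 + 2 * s"] by simp
  have A1: "A \<ge> 1" unfolding A_def using b1 \<epsilon> by (intro ge_one_powr_ge_zero) auto
  have A\<epsilon>: "(1 + 2 * s) * A powr (- \<epsilon>) = 1 / (5 * N)"
  proof -
    have "A powr (- \<epsilon>) = 1 / (5 * N * (1 + 2 * s))"
      unfolding A_def using b1 \<epsilon> by (simp add: powr_powr powr_minus_divide)
    then show ?thesis using s by simp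
  qed
  \<comment> \<open>This constant covers the radii below \<open>A * \<rho> \<xi>\<close>, where nothing decays, and the loss of at most a factor two in rounding a radius down to a dyadic one.\<close>
  define Cd where "Cd = (4 * A) ^ J"
  show ?case
  proof (rule 1(1)[of Cd])
    show "Cd \<ge> 0" using A1 by (simp add: Cd_def)
    fix U :: "'n multiindex \<Rightarrow> real ^ 'n \<Rightarrow> real" and \<Omega> \<Xi> l \<rho> \<xi> \<eta> R
    assume nm: "near_minimizer m \<Xi> \<xi> \<eta> U" and \<eta>: "\<eta> > 0" and fin: "finite \<Xi>" and l: "l \<ge> m"
      and ld: "local_density \<Omega> \<Xi> l K \<rho>" and sg: "slow_growth \<Omega> \<epsilon> \<rho>" and \<xi>: "\<xi> \<in> \<Omega>"
      and R: "R \<ge> 0" "cube \<xi> R \<subseteq> \<Omega>"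
    have Uf: "finite_energy m U" using nm by (simp add: near_minimizer_def lagrange_jet_def)
    define r where "r = \<rho> \<xi>"
    have r: "r > 0" using ld \<xi> by (simp add: local_density_def r_def)
    define E where "E = energy m U"
    have E: "E \<ge> 0" by (simp add: E_def)
    \<comment> \<open>Since \<open>1 / (1 + C) = 1 - \<theta>\<close>, subtracting \<open>\<eta>\<close> turns the decay step into a contraction without error term.\<close>
    define G where "G R = max 0 (tail_energy m U \<xi> R - \<eta>)" for R
    have G0: "G R \<ge> 0" for R by (simp add: G_def)
    have GE: "G R \<le> E" for R using tail_energy_le_energy[OF Uf, of \<xi> R] \<eta> E by (simp add: G_def E_def)
    have Gmono: "G R' \<le> G R" if "R \<le> R'" for R R'
      unfolding G_def using tail_energy_antimono[OF Uf that, of \<xi>] by (intro max.mono) auto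
    have Gstep: "G (R + 5 * w) \<le> \<theta> * G R"
      if "R \<ge> 0" "w > 0" "cube \<xi> (R + 5 * w) \<subseteq> \<Omega>" "\<forall>\<alpha>\<in>cube \<xi> (R + 5 * w). \<rho> \<alpha> \<le> w" for R w
    proof -
      let ?a = "tail_energy m U \<xi> (R + 5 * w)" and ?b = "tail_energy m U \<xi> R"
      have "?a \<le> C * (?b - ?a) + \<eta>" by (rule step[OF nm fin l ld that])
      then have "(1 + C) * (?a - \<eta>) \<le> C * (?b - \<eta>)" by (simp add: algebra_simps)
      then have "?a - \<eta> \<le> \<theta> * (?b - \<eta>)" using C by (simp add: \<theta>_def field_simps)
      also have "\<dots> \<le> \<theta> * G R" unfolding G_def using \<theta> by (intro mult_left_mono) auto
      finally show ?thesis using \<theta> G0[of R] by (simp add: G_def[of "R + 5 * w"])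
    qed
    have double: "G (2 * R) \<le> (1 / 2) ^ J * G R" if R: "R \<ge> A * r" and sub: "cube \<xi> (2 * R) \<subseteq> \<Omega>" for R
    proof -
      have R0: "R > 0" using R A1 r by (meson less_le_trans mult_pos_pos zero_less_one)
      define w where "w = R / (5 * N)"
      have w: "w > 0" using R0 N by (simp add: w_def)
      have Nw: "real N * (5 * w) = R" using N by (simp add: w_def)
      have st: "G (R + real (Suc j) * (5 * w)) \<le> \<theta> * G (R + real j * (5 * w))" if j: "j < N" for j
      proof -
        have e: "R + real (Suc j) * (5 * w) = (R + real j * (5 * w)) + 5 * w" by (simp add: algebra_simps)
        have "real (Suc j) * (5 * w) \<le> real N * (5 * w)" using j w by (intro mult_right_mono) auto
        then have le: "(R + real j * (5 * w)) + 5 * w \<le> 2 * R" using Nw e by linarith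
        then have c: "cube \<xi> ((R + real j * (5 * w)) + 5 * w) \<subseteq> cube \<xi> (2 * R)" by (auto simp: cube_def)
        show ?thesis
          unfolding e
        proof (rule Gstep[OF _ w])
          show "0 \<le> R + real j * (5 * w)" using R0 w by simp
          show "cube \<xi> ((R + real j * (5 * w)) + 5 * w) \<subseteq> \<Omega>" using c sub by blast
          show "\<forall>\<alpha>\<in>cube \<xi> ((R + real j * (5 * w)) + 5 * w). \<rho> \<alpha> \<le> w"
          proof
            fix \<alpha> assume "\<alpha> \<in> cube \<xi> ((R + real j * (5 * w)) + 5 * w)"
            then have \<alpha>: "\<alpha> \<in> cube \<xi> (2 * R)" "\<alpha> \<in> \<Omega>" using c sub by auto
            have "\<rho> \<alpha> \<le> R * (1 + 2 * s) * A powr (- \<epsilon>)"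
              unfolding s_def
              by (rule slow_growth_cube[OF sg \<epsilon> \<xi> _ \<alpha>(2,1) _ A1]) (use r R in \<open>auto simp: r_def\<close>)
            also have "\<dots> = w" using A\<epsilon> by (simp add: mult.assoc w_def)
            finally show "\<rho> \<alpha> \<le> w" .
          qed
        qed
      qed
      have "G (R + real N * (5 * w)) \<le> \<theta> ^ N * G R"
        by (rule geometric_steps[OF st \<theta>(1)]) auto
      also have "\<dots> \<le> (1 / 2) ^ J * G R" using N G0 by (intro mult_right_mono) auto
      finally show ?thesis unfolding Nw by simp
    qed
    have dy: "G (2 ^ j * (A * r)) \<le> ((1 / 2) ^ J) ^ j * E" if "cube \<xi> (2 ^ j * (A * r)) \<subseteq> \<Omega>" for j
      using that
    proof (induction j)
      case 0
      then show ?case using GE by simp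
    next
      case (Suc j)
      have Ar: "A * r \<ge> 0" using A1 r by simp
      then have "2 ^ j * (A * r) \<le> 2 ^ Suc j * (A * r)" by (intro mult_right_mono) auto
      then have "cube \<xi> (2 ^ j * (A * r)) \<subseteq> cube \<xi> (2 ^ Suc j * (A * r))"
        unfolding cube_def by (intro Collect_mono impI) (rule order.trans)
      then have sub: "cube \<xi> (2 ^ j * (A * r)) \<subseteq> \<Omega>" using Suc.prems by blast
      have "1 * (A * r) \<le> 2 ^ j * (A * r)" using Ar by (intro mult_right_mono) auto
      then have "G (2 * (2 ^ j * (A * r))) \<le> (1 / 2) ^ J * G (2 ^ j * (A * r))"
        using Suc.prems by (intro double) (auto simp: mult.assoc)
      also have "\<dots> \<le> (1 / 2) ^ J * (((1 / 2) ^ J) ^ j * E)"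
        using Suc.IH[OF sub] by (intro mult_left_mono) auto
      finally show ?case by (simp add: mult.assoc)
    qed
    have T: "1 + R / r > 0" using R r by (simp add: add_pos_nonneg)
    have "G R * (1 + R / r) ^ J \<le> Cd * E"
    proof (cases "R < A * r")
      case True
      then have "R / r < A" using r by (simp add: divide_less_eq)
      then have "(1 + R / r) ^ J \<le> Cd" unfolding Cd_def using T A1 by (intro power_mono) auto
      then have "G R * (1 + R / r) ^ J \<le> E * Cd" using GE[of R] G0 E T by (intro mult_mono) auto
      then show ?thesis by (simp add: mult.commute)
    next
      case False
      then have Ar: "A * r \<le> R" "A * r > 0" using A1 r by auto
      then have "R / (A * r) \<ge> 1" by simp
      then obtain j where j: "2 ^ j \<le> R / (A * r)" "R / (A * r) < 2 ^ Suc j" by (rule dyadic_scale)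
      have jR: "2 ^ j * (A * r) \<le> R" using j(1) Ar by (simp add: le_divide_eq)
      then have "cube \<xi> (2 ^ j * (A * r)) \<subseteq> \<Omega>" using R(2) by (force simp: cube_def)
      then have "G R \<le> ((1 / 2) ^ J) ^ j * E" using dy[of j] Gmono[OF jR] by simp
      moreover have "(1 + R / r) ^ J \<le> (4 * A * 2 ^ j) ^ J"
      proof (rule power_mono)
        have "R < 2 ^ Suc j * (A * r)" using j(2) Ar by (simp add: divide_less_eq)
        then have "R / r < 2 * 2 ^ j * A" using r by (simp add: divide_less_eq mult_ac)
        moreover have "1 * 1 \<le> 2 ^ j * A" using A1 by (intro mult_mono) auto
        moreover have "2 * 2 ^ j * A = 2 * (2 ^ j * A)" "4 * A * 2 ^ j = 4 * (2 ^ j * A)" by simp_all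
        ultimately show "1 + R / r \<le> 4 * A * 2 ^ j" by linarith
      qed (use T in simp)
      ultimately have "G R * (1 + R / r) ^ J \<le> ((1 / 2) ^ J) ^ j * E * (4 * A * 2 ^ j) ^ J"
        using E T G0 by (intro mult_mono) auto
      also have "\<dots> = Cd * E * (((1 / 2) ^ j) ^ J * (2 ^ j) ^ J)"
        by (simp add: Cd_def power_mult_distrib power_mult[symmetric] mult_ac)
      also have "((1 / 2) ^ j) ^ J * (2 ^ j) ^ J = (1 :: real)"
        by (simp add: power_mult_distrib[symmetric])
      finally show ?thesis by simp
    qed
    then have "G R \<le> Cd * E / (1 + R / r) ^ J" using T by (simp add: le_divide_eq)
    then show "tail_energy m U \<xi> R \<le> Cd * energy m U / (1 + R / \<rho> \<xi>) ^ J + \<eta>"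
      by (simp add: G_def E_def r_def)
  qed
qed

section \<open>Pointwise decay of Lagrange functions\<close>

text \<open>A bump supported away from the other centers is admissible, so this bounds the energy of a
  Lagrange function.\<close>

lemma bump_energy:
  obtains C where "C \<ge> 0"
    and "\<And>(\<xi> :: real ^ 'n::finite) s. s > 0 \<Longrightarrow> finite_energy m (cutoff \<xi> s s) \<and> energy m (cutoff \<xi> s s) \<le> C * (s ^ CARD('n) / s ^ (2 * m))"
proof (rule cutoff_bounded[where 'n = 'n and m = m], goal_cases)
  case (1 B)
  note B = 1(2) and bd = 1(3)
  define D where "D = (\<Sum>\<beta> :: 'n multiindex | mi_order \<beta> = m. fact m / mi_fact \<beta> * B\<^sup>2)"
  have D: "D \<ge> 0" unfolding D_def by (intro sum_nonneg mult_nonneg_nonneg divide_nonneg_nonneg mi_fact_nonneg) auto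
  show ?case
  proof (rule 1(1)[of "D * 4 ^ CARD('n)"])
    show "0 \<le> D * 4 ^ CARD('n)" using D by simp
    fix \<xi> :: "real ^ 'n" and s :: real assume s: "s > 0"
    let ?c = "cutoff \<xi> s s"
    have out: "?c \<beta> x = 0" if "x \<notin> cube \<xi> (2 * s)" for \<beta> x
      using that s by (intro cutoff_outside) (auto simp: cube_def)
    have fe: "finite_energy m ?c"
      by (rule finite_energy_vanish_outside_cube[OF jet_cutoff out])
    have le: "edens m ?c x \<le> (D * (1 / s) ^ (2 * m)) * indicator (cube \<xi> (2 * s)) x" for x
    proof (cases "x \<in> cube \<xi> (2 * s)")
      case True
      have "edens m ?c x \<le> (\<Sum>\<beta> :: 'n multiindex | mi_order \<beta> = m. fact m / mi_fact \<beta> * (B\<^sup>2 * (1 / s) ^ (2 * m)))"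
        unfolding edens_def
      proof (intro sum_mono mult_left_mono divide_nonneg_nonneg mi_fact_nonneg)
        fix \<beta> :: "'n multiindex" assume "\<beta> \<in> {\<beta>. mi_order \<beta> = m}"
        then have "\<bar>?c \<beta> x\<bar> \<le> B * (1 / s) ^ m" using bd[OF s, of \<beta> \<xi> s x] by simp
        then have "\<bar>?c \<beta> x\<bar>\<^sup>2 \<le> (B * (1 / s) ^ m)\<^sup>2" by (intro power_mono) auto
        then show "(?c \<beta> x)\<^sup>2 \<le> B\<^sup>2 * (1 / s) ^ (2 * m)" by (simp add: power_mult_distrib power_even_eq)
      qed simp
      also have "\<dots> = D * (1 / s) ^ (2 * m)" by (simp only: D_def sum_distrib_right mult.assoc)
      finally show ?thesis using True by simp
    next
      case False
      then show ?thesis using out by (simp add: edens_def)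
    qed
    have "energy m ?c \<le> (\<integral>x. (D * (1 / s) ^ (2 * m)) * indicator (cube \<xi> (2 * s)) x \<partial>lborel)"
      unfolding energy_def
    proof (rule integral_mono[OF _ _ le])
      show "integrable lborel (edens m ?c)" using fe by (simp add: finite_energy_def)
      show "integrable lborel (\<lambda>x. (D * (1 / s) ^ (2 * m)) * indicator (cube \<xi> (2 * s)) x)"
        using emeasure_cube[of "2 * s" \<xi>] s by (intro integrable_mult_right integrable_real_indicator) auto
    qed
    also have "\<dots> = D * (1 / s) ^ (2 * m) * (2 * (2 * s)) ^ CARD('n)" using s by (simp add: measure_cube)
    also have "\<dots> = D * 4 ^ CARD('n) * (s ^ CARD('n) / s ^ (2 * m))"
      using power_mult_distrib[of 4 s "CARD('n)"] by (simp add: power_one_over)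
    finally show "finite_energy m ?c \<and> energy m ?c \<le> D * 4 ^ CARD('n) * (s ^ CARD('n) / s ^ (2 * m))"
      using fe by simp
  qed
qed

text \<open>Used to let the tolerance of near-minimizers tend to zero.\<close>

lemma limit_sqrt_bound:
  fixes X k a b :: real
  assumes "\<And>\<eta>. \<eta> > 0 \<Longrightarrow> X \<le> \<eta> + k + sqrt (a + b * \<eta>)"
  shows "X \<le> k + sqrt a"
proof -
  have "((\<lambda>\<eta>. \<eta> + k + sqrt (a + b * \<eta>)) \<longlongrightarrow> 0 + k + sqrt (a + b * 0)) (at_right 0)"
    by (intro tendsto_intros)
  then have "((\<lambda>\<eta>. \<eta> + k + sqrt (a + b * \<eta>)) \<longlongrightarrow> k + sqrt a) (at_right 0)" by simp
  moreover have "\<forall>\<^sub>F \<eta> in at_right 0. X \<le> \<eta> + k + sqrt (a + b * \<eta>)"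
    using assms by (auto simp: eventually_at_filter)
  ultimately show ?thesis by (rule tendsto_lowerbound) simp
qed

lemma local_energy_mono:
  assumes "finite_energy m U" "A \<in> sets borel" "B \<in> sets borel" "A \<subseteq> B"
  shows "local_energy m U A \<le> local_energy m U B"
  unfolding local_energy_def using assms
  by (intro integral_mono finite_energy_indicator) (auto simp: indicator_def)

text \<open>Polynomial decay of any order of the Lagrange function, at the scale \<open>\<rho> \<xi>\<close>.  Write \<open>T\<close> for
  \<open>1 + norm (x - \<xi>) / \<rho> \<xi>\<close>.  If \<open>\<rho> x\<close> is large compared with the distance of \<open>x\<close> from \<open>\<xi>\<close>, slow growth bounds \<open>T\<close>
  by a constant, and the value at \<open>x\<close> is bounded by the stability constant and the total energy.  Otherwise
  \<open>\<xi>\<close> is not among the centers used at \<open>x\<close>, and the value is bounded by the energy near \<open>x\<close>, hence by the tail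
  energy.  The quotient \<open>\<rho> x / \<rho> \<xi>\<close> is at most \<open>T\<close>, and its power that comes from the different scales costs at most
  \<open>2 * m\<close> orders of decay.
  The radius at which the tail is taken is a fixed fraction of the distance, so that the cube about \<open>\<xi>\<close>
  stays inside the domain.\<close>

lemma lagrange_pointwise_decay:
  fixes J :: nat and \<epsilon> K c0 d0 D0 :: real
  assumes m: "real m > real CARD('n::finite) / 2" and \<epsilon>: "0 < \<epsilon>" "\<epsilon> < 1" and c0: "c0 > 0" and d0: "d0 > 0" and D0: "D0 > 0"
  obtains C where "C \<ge> 0"
    and "\<And>(\<Omega> :: (real ^ 'n) set) \<Xi> l \<rho> \<xi> chi x. bounded \<Omega> \<Longrightarrow> finite \<Xi> \<Longrightarrow> \<Xi> \<subseteq> \<Omega> \<Longrightarrow> l \<ge> m \<Longrightarrow> local_density \<Omega> \<Xi> l K \<rho> \<Longrightarrow>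
     slow_growth \<Omega> \<epsilon> \<rho> \<Longrightarrow> \<xi> \<in> \<Xi> \<Longrightarrow> is_lagrange_function m \<Xi> \<xi> chi \<Longrightarrow> x \<in> \<Omega> \<Longrightarrow>
     \<forall>\<zeta>\<in>\<Xi>. \<zeta> \<noteq> \<xi> \<longrightarrow> \<rho> \<xi> \<le> c0 * norm (\<xi> - \<zeta>) \<Longrightarrow> ball \<xi> d0 \<subseteq> \<Omega> \<Longrightarrow> norm (x - \<xi>) \<le> D0 \<Longrightarrow>
     \<bar>chi x\<bar> \<le> C / (1 + norm (x - \<xi>) / \<rho> \<xi>) ^ J"
proof (rule density_estimate[OF m, where K = K], goal_cases)
  case (1 Cz)
  note that = 1(1) and Cz = 1(2) and est = 1(3)
  show ?case
  proof (rule tail_energy_decay[OF m \<epsilon>, where K = K and J = "2 * J + 2 * m"], goal_cases)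
    case (1 Cd)
    note Cd = 1(1) and tail = 1(2)
    show ?case
    proof (rule bump_energy[where 'n = 'n and m = m], goal_cases)
      case (1 Cb)
      note Cb = 1(1) and bump = 1(2)
      let ?d = "CARD('n)"
      define s where "s = sqrt (real ?d)"
      have s: "s \<ge> 1" by (simp add: s_def Suc_leI)
      \<comment> \<open>A bump of outer radius \<open>2 * \<kappa> * \<rho> \<xi>\<close> in the maximum norm misses the other centers, which have distance at least \<open>\<rho> \<xi> / c0\<close> in the Euclidean norm.\<close>
      define \<kappa> where "\<kappa> = 1 / (2 * c0 * s)"
      have \<kappa>: "\<kappa> > 0" using c0 s by (simp add: \<kappa>_def)
      define Ce where "Ce = Cb * (\<kappa> ^ ?d / \<kappa> ^ (2 * m))"
      have Ce: "Ce \<ge> 0" using Cb \<kappa> by (simp add: Ce_def)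
      \<comment> \<open>The largest \<open>T\<close> with \<open>T \<le> (1 + 2 * s) * T powr (1 - \<epsilon>)\<close>.\<close>
      define T0 where "T0 = (1 + 2 * s) powr (1 / \<epsilon>)"
      have T0: "T0 \<ge> 1" unfolding T0_def using s \<epsilon> by (intro ge_one_powr_ge_zero) auto
      \<comment> \<open>The fraction of the distance at which the tail energy is taken: at most one half, so that a small cube about \<open>x\<close> lies in the tail, and small enough for the cube about \<open>\<xi>\<close> to lie in the domain.\<close>
      define c where "c = min (1 / 2) (d0 / (2 * s * D0))"
      have c: "c > 0" "c \<le> 1 / 2" "s * (c * D0) < d0"
      proof -
        show "c > 0" "c \<le> 1 / 2" using d0 s D0 by (auto simp: c_def)
        have "s * (c * D0) \<le> s * (d0 / (2 * s * D0) * D0)"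
          unfolding c_def using s D0 by (intro mult_left_mono mult_right_mono) auto
        also have "\<dots> = d0 / 2" using s D0 by simp
        finally show "s * (c * D0) < d0" using d0 by simp
      qed
      define CA where "CA = (\<bar>K\<bar> + sqrt (Cz * T0 ^ (2 * m) * Ce)) * T0 ^ J"
      define CB where "CB = sqrt (Cz * Cd * Ce * (s / c) ^ (2 * J + 2 * m))"
      have CA: "CA \<ge> 0" using Cz Ce T0 by (simp add: CA_def)
      have CB: "CB \<ge> 0" using Cz Cd Ce s c by (simp add: CB_def)
      show ?case
      proof (rule that[of "CA + CB"])
        show "CA + CB \<ge> 0" using CA CB by simp
        fix \<Omega> \<Xi> :: "(real ^ 'n) set" and l \<rho> \<xi> chi x
        assume \<Omega>: "bounded \<Omega>" and fin: "finite \<Xi>" and sub: "\<Xi> \<subseteq> \<Omega>" and l: "l \<ge> m" and ld: "local_density \<Omega> \<Xi> l K \<rho>"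
          and sg: "slow_growth \<Omega> \<epsilon> \<rho>" and \<xi>: "\<xi> \<in> \<Xi>" and chi: "is_lagrange_function m \<Xi> \<xi> chi" and x: "x \<in> \<Omega>"
          and sep: "\<forall>\<zeta>\<in>\<Xi>. \<zeta> \<noteq> \<xi> \<longrightarrow> \<rho> \<xi> \<le> c0 * norm (\<xi> - \<zeta>)" and ball: "ball \<xi> d0 \<subseteq> \<Omega>" and xD: "norm (x - \<xi>) \<le> D0"
        have \<xi>\<Omega>: "\<xi> \<in> \<Omega>" using \<xi> sub by blast
        define r p D i where "r = \<rho> \<xi>" and "p = \<rho> x" and "D = norm (x - \<xi>)" and "i = infnorm (x - \<xi>)"
        have r: "r > 0" and p: "p > 0" using ld \<xi>\<Omega> x by (auto simp: local_density_def r_def p_def)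
        have iD: "i \<le> D" "D \<le> s * i" "i \<ge> 0"
          using infnorm_le_norm[of "x - \<xi>"] norm_le_infnorm[of "x - \<xi>"] infnorm_pos_le[of "x - \<xi>"] by (auto simp: i_def D_def s_def)
        define T where "T = 1 + D / r"
        have T: "T \<ge> 1" using r by (simp add: T_def D_def)
        have pT: "p \<le> r * T powr (1 - \<epsilon>)"
          using sg \<xi>\<Omega> x unfolding slow_growth_def p_def r_def T_def D_def by (metis norm_minus_commute)
        also have "\<dots> \<le> r * T" using powr_mono[of "1 - \<epsilon>" 1 T] T r \<epsilon> by (intro mult_left_mono) auto
        finally have pT1: "p \<le> r * T" .
        have md: "2 * m \<ge> ?d" using m by linarith
        define e where "e = 2 * m - ?d"
        have me: "y ^ (2 * m) / y ^ ?d = y ^ e" if "y > 0" for y :: real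
          using that md by (simp add: e_def power_diff)
        have pe: "p ^ e * (1 / r ^ e) \<le> T ^ (2 * m)"
        proof -
          have "p ^ e \<le> (r * T) ^ e" using p pT1 by (intro power_mono) auto
          then have "p ^ e * (1 / r ^ e) \<le> T ^ e" using r by (simp add: power_mult_distrib divide_le_eq mult.commute)
          also have "\<dots> \<le> T ^ (2 * m)" using T by (intro power_increasing) (auto simp: e_def)
          finally show ?thesis .
        qed
        have enr: "energy m U \<le> Ce * (1 / r ^ e) + \<eta>" if nm: "near_minimizer m \<Xi> \<xi> \<eta> U" for U \<eta>
        proof -
          define h where "h = \<kappa> * r"
          have h: "h > 0" using \<kappa> r by (simp add: h_def)
          have "cutoff \<xi> h h zero_mi \<zeta> = 0" if "\<zeta> \<in> \<Xi>" "\<zeta> \<noteq> \<xi>" for \<zeta>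
          proof (rule cutoff_outside)
            have "r \<le> c0 * norm (\<zeta> - \<xi>)" using sep that by (auto simp: r_def norm_minus_commute)
            also have "\<dots> \<le> c0 * (s * infnorm (\<zeta> - \<xi>))"
              using norm_le_infnorm[of "\<zeta> - \<xi>"] c0 by (intro mult_left_mono) (auto simp: s_def)
            finally show "h + h \<le> infnorm (\<zeta> - \<xi>)" using c0 s by (simp add: h_def \<kappa>_def field_simps)
          qed (use h in auto)
          moreover have "cutoff \<xi> h h zero_mi \<xi> = 1" using h by (subst cutoff_inside) (auto simp: infnorm_0)
          ultimately have "lagrange_jet m \<Xi> \<xi> (cutoff \<xi> h h)"
            using bump[OF h, of \<xi>] by (auto simp: lagrange_jet_def jet_cutoff)
          then have "energy m U \<le> energy m (cutoff \<xi> h h) + \<eta>" using nm by (simp add: near_minimizer_def)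
          also have "energy m (cutoff \<xi> h h) \<le> Cb * (h ^ ?d / h ^ (2 * m))" using bump[OF h, of \<xi>] by simp
          also have "h ^ ?d / h ^ (2 * m) = \<kappa> ^ ?d / \<kappa> ^ (2 * m) * (1 / (r ^ (2 * m) / r ^ ?d))"
            by (simp add: h_def power_mult_distrib)
          also have "\<dots> = \<kappa> ^ ?d / \<kappa> ^ (2 * m) * (1 / r ^ e)" unfolding me[OF r] ..
          finally show ?thesis by (simp add: Ce_def)
        qed
        have nmex: "\<exists>U. near_minimizer m \<Xi> \<xi> \<eta> U \<and> \<bar>U zero_mi x - chi x\<bar> \<le> \<eta>" if "\<eta> > 0" for \<eta>
          using near_minimizer_exists[OF chi fin \<xi> \<Omega> sub that] x by (metis near_minimizer_def)
        have estx: "\<exists>a. (\<forall>\<xi>\<in>\<Xi>. a \<xi> \<noteq> 0 \<longrightarrow> \<xi> \<in> cube x p) \<and> (\<Sum>\<xi>\<in>\<Xi>. \<bar>a \<xi>\<bar>) \<le> K \<and>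
           (U zero_mi x - a \<xi>)\<^sup>2 \<le> Cz * p ^ e * local_energy m U (cube x p)" if nm: "near_minimizer m \<Xi> \<xi> \<eta> U" for U \<eta>
        proof -
          have U: "jet U" "U zero_mi \<xi> = 1" "\<And>\<zeta>. \<zeta> \<in> \<Xi> \<Longrightarrow> \<zeta> \<noteq> \<xi> \<Longrightarrow> U zero_mi \<zeta> = 0"
            using nm by (auto simp: near_minimizer_def lagrange_jet_def)
          obtain a where a: "\<forall>\<xi>\<in>\<Xi>. a \<xi> \<noteq> 0 \<longrightarrow> \<xi> \<in> cube x p" "(\<Sum>\<xi>\<in>\<Xi>. \<bar>a \<xi>\<bar>) \<le> K"
            "(U zero_mi x - (\<Sum>\<xi>\<in>\<Xi>. a \<xi> * U zero_mi \<xi>))\<^sup>2 \<le> Cz * (p ^ (2 * m) / p ^ ?d) * local_energy m U (cube x p)"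
            using est[OF U(1) fin l ld x, of p] by (auto simp: p_def)
          have "(\<Sum>\<zeta>\<in>\<Xi>. a \<zeta> * U zero_mi \<zeta>) = (\<Sum>\<zeta>\<in>\<Xi>. if \<zeta> = \<xi> then a \<xi> else 0)"
            using U by (intro sum.cong) auto
          also have "\<dots> = a \<xi>" using fin \<xi> by simp
          finally show ?thesis using a unfolding me[OF p] by auto
        qed
        have "\<bar>chi x\<bar> \<le> (CA + CB) / T ^ J"
        proof (cases "p > i / 2")
          case True
          have X1: "\<bar>chi x\<bar> \<le> \<bar>K\<bar> + sqrt (Cz * T ^ (2 * m) * Ce)"
          proof (rule limit_sqrt_bound[where b = "Cz * p ^ e"])
            fix \<eta> :: real assume \<eta>: "\<eta> > 0"
            obtain U where nm: "near_minimizer m \<Xi> \<xi> \<eta> U" and Ux: "\<bar>U zero_mi x - chi x\<bar> \<le> \<eta>" using nmex[OF \<eta>] by blast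
            have Uf: "finite_energy m U" using nm by (simp add: near_minimizer_def lagrange_jet_def)
            obtain a where a: "(\<Sum>\<xi>\<in>\<Xi>. \<bar>a \<xi>\<bar>) \<le> K" "(U zero_mi x - a \<xi>)\<^sup>2 \<le> Cz * p ^ e * local_energy m U (cube x p)"
              using estx[OF nm] by blast
            have "\<bar>a \<xi>\<bar> \<le> (\<Sum>\<xi>\<in>\<Xi>. \<bar>a \<xi>\<bar>)" using fin \<xi> by (intro member_le_sum) auto
            then have aK: "\<bar>a \<xi>\<bar> \<le> \<bar>K\<bar>" using a by linarith
            have "local_energy m U (cube x p) \<le> energy m U"
              unfolding local_energy_def energy_def using Uf
              by (intro integral_mono finite_energy_indicator) (auto simp: finite_energy_def indicator_def)
            also have "\<dots> \<le> Ce * (1 / r ^ e) + \<eta>" by (rule enr[OF nm])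
            finally have "Cz * p ^ e * local_energy m U (cube x p) \<le> Cz * p ^ e * (Ce * (1 / r ^ e) + \<eta>)"
              using Cz p by (intro mult_left_mono) auto
            also have "\<dots> = Cz * (p ^ e * (1 / r ^ e)) * Ce + Cz * p ^ e * \<eta>" by (simp add: algebra_simps)
            also have "\<dots> \<le> Cz * T ^ (2 * m) * Ce + Cz * p ^ e * \<eta>"
              using Cz Ce pe by (intro add_right_mono mult_right_mono mult_left_mono) auto
            finally have "\<bar>U zero_mi x - a \<xi>\<bar> \<le> sqrt (Cz * T ^ (2 * m) * Ce + Cz * p ^ e * \<eta>)"
              using a(2) by (intro real_le_rsqrt) (simp add: power2_abs)
            then show "\<bar>chi x\<bar> \<le> \<eta> + \<bar>K\<bar> + sqrt (Cz * T ^ (2 * m) * Ce + Cz * p ^ e * \<eta>)"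
              using Ux aK by linarith
          qed
          have X2: "\<bar>K\<bar> + sqrt (Cz * T ^ (2 * m) * Ce) \<le> \<bar>K\<bar> + sqrt (Cz * T0 ^ (2 * m) * Ce)" and TT: "T \<le> T0"
          proof -
            have "s * i \<le> s * (2 * p)" using True s by (intro mult_left_mono) auto
            then have "D \<le> 2 * s * p" using iD(2) by simp
            also have "\<dots> \<le> 2 * s * (r * T powr (1 - \<epsilon>))" using pT s by (intro mult_left_mono) auto
            finally have "D / r \<le> 2 * s * T powr (1 - \<epsilon>)" using r by (simp add: divide_le_eq mult_ac)
            moreover have "1 \<le> T powr (1 - \<epsilon>)" using T \<epsilon> by (intro ge_one_powr_ge_zero) auto
            ultimately have "T \<le> (1 + 2 * s) * T powr (1 - \<epsilon>)" by (simp add: T_def distrib_right)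
            moreover have "T = T powr \<epsilon> * T powr (1 - \<epsilon>)" using T by (simp add: powr_add[symmetric])
            ultimately have "T powr \<epsilon> * T powr (1 - \<epsilon>) \<le> (1 + 2 * s) * T powr (1 - \<epsilon>)" by simp
            then have "T powr \<epsilon> \<le> 1 + 2 * s" using T by (simp add: mult_le_cancel_right)
            then have "(T powr \<epsilon>) powr (1 / \<epsilon>) \<le> T0" unfolding T0_def using \<epsilon> by (intro powr_mono2) auto
            then show TT: "T \<le> T0" using T \<epsilon> by (simp add: powr_powr)
            show "\<bar>K\<bar> + sqrt (Cz * T ^ (2 * m) * Ce) \<le> \<bar>K\<bar> + sqrt (Cz * T0 ^ (2 * m) * Ce)"
              using TT T Cz Ce by (intro add_left_mono real_sqrt_le_mono mult_right_mono mult_left_mono power_mono) auto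
          qed
          have "\<bar>chi x\<bar> * T ^ J \<le> (\<bar>K\<bar> + sqrt (Cz * T0 ^ (2 * m) * Ce)) * T0 ^ J"
            using TT T Cz Ce T0 by (intro mult_mono power_mono order.trans[OF X1 X2]) auto
          then have "\<bar>chi x\<bar> \<le> CA / T ^ J" using T by (simp add: CA_def le_divide_eq)
          also have "\<dots> \<le> (CA + CB) / T ^ J" using CB T by (intro divide_right_mono) auto
          finally show ?thesis .
        next
          case False
          define R where "R = c * i"
          have R: "R \<ge> 0" using c iD by (simp add: R_def)
          have Ri: "R \<le> i / 2" unfolding R_def using c(2) iD mult_right_mono[of c "1/2" i] by simp
          have cube: "cube \<xi> R \<subseteq> \<Omega>"
          proof
            fix y assume "y \<in> cube \<xi> R"
            then have "infnorm (y - \<xi>) \<le> c * i" by (simp add: cube_def R_def)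
            then have "s * infnorm (y - \<xi>) \<le> s * (c * D0)"
            proof (intro mult_left_mono)
              have "c * i \<le> c * D0" using c iD xD by (intro mult_left_mono) (auto simp: D_def)
              then show "infnorm (y - \<xi>) \<le> c * D0" using \<open>infnorm (y - \<xi>) \<le> c * i\<close> by simp
            qed (use s in simp)
            moreover have "norm (y - \<xi>) \<le> s * infnorm (y - \<xi>)" using norm_le_infnorm[of "y - \<xi>"] by (simp add: s_def)
            ultimately have "norm (y - \<xi>) < d0" using c(3) by simp
            then show "y \<in> \<Omega>" using ball by (auto simp: dist_norm norm_minus_commute)
          qed
          define S where "S = 1 + R / r"
          have S: "S > 0" using R r by (simp add: S_def add_pos_nonneg)
          have ST: "T \<le> (s / c) * S"
          proof -
            have sc: "s / c \<ge> 1" using s c by (simp add: le_divide_eq)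
            have "D \<le> s / c * R" using iD(2) c by (simp add: R_def)
            then have "D / r \<le> s / c * (R / r)" using r divide_right_mono[of D "s / c * R" r] by simp
            then show ?thesis using sc by (simp add: T_def S_def distrib_left)
          qed
          let ?J = "2 * J + 2 * m"
          have fromS: "1 / S ^ ?J \<le> (s / c) ^ ?J / T ^ ?J"
          proof -
            have "T ^ ?J \<le> ((s / c) * S) ^ ?J" using ST T by (intro power_mono) auto
            then have "T ^ ?J \<le> (s / c) ^ ?J * S ^ ?J" by (simp only: power_mult_distrib)
            then show ?thesis using S T by (simp add: divide_le_eq le_divide_eq del: power_mult_distrib)
          qed
          have "\<bar>chi x\<bar> \<le> 0 + sqrt (Cz * (p ^ e * (1 / r ^ e)) * Cd * Ce / S ^ ?J)"
          proof (rule limit_sqrt_bound[where b = "Cz * p ^ e * (Cd / S ^ ?J + 1)"])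
            fix \<eta> :: real assume \<eta>: "\<eta> > 0"
            obtain U where nm: "near_minimizer m \<Xi> \<xi> \<eta> U" and Ux: "\<bar>U zero_mi x - chi x\<bar> \<le> \<eta>" using nmex[OF \<eta>] by blast
            have Uf: "finite_energy m U" using nm by (simp add: near_minimizer_def lagrange_jet_def)
            obtain a where a: "\<forall>\<xi>\<in>\<Xi>. a \<xi> \<noteq> 0 \<longrightarrow> \<xi> \<in> cube x p" "(U zero_mi x - a \<xi>)\<^sup>2 \<le> Cz * p ^ e * local_energy m U (cube x p)"
              using estx[OF nm] by blast
            have "\<xi> \<notin> cube x p" using False p by (simp add: cube_def infnorm_sub[of \<xi> x] i_def)
            then have a0: "a \<xi> = 0" using a(1) \<xi> by blast
            have "local_energy m U (cube x p) \<le> tail_energy m U \<xi> R"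
              unfolding tail_energy_def
            proof (rule local_energy_mono[OF Uf])
              show "cube x p \<subseteq> {z. R \<le> infnorm (z - \<xi>)}"
              proof
                fix z assume "z \<in> cube x p"
                moreover have "infnorm (x - \<xi>) \<le> infnorm (x - z) + infnorm (z - \<xi>)"
                  using infnorm_triangle[of "x - z" "z - \<xi>"] by simp
                ultimately show "z \<in> {z. R \<le> infnorm (z - \<xi>)}"
                  using False Ri by (simp add: cube_def infnorm_sub[of x z] i_def)
              qed
            qed auto
            also have "\<dots> \<le> Cd * energy m U / S ^ ?J + \<eta>"
              unfolding S_def r_def by (rule tail[OF nm \<eta> fin l ld sg \<xi>\<Omega> R cube])
            also have "\<dots> \<le> Cd * (Ce * (1 / r ^ e) + \<eta>) / S ^ ?J + \<eta>"
              using enr[OF nm] Cd S by (intro add_right_mono divide_right_mono mult_left_mono) auto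
            finally have "Cz * p ^ e * local_energy m U (cube x p) \<le> Cz * p ^ e * (Cd * (Ce * (1 / r ^ e) + \<eta>) / S ^ ?J + \<eta>)"
              using Cz p by (intro mult_left_mono) auto
            also have "\<dots> = Cz * (p ^ e * (1 / r ^ e)) * Cd * Ce / S ^ ?J + Cz * p ^ e * (Cd / S ^ ?J + 1) * \<eta>"
              by (simp add: add_divide_distrib distrib_left distrib_right mult_ac)
            finally have "\<bar>U zero_mi x\<bar> \<le> sqrt (Cz * (p ^ e * (1 / r ^ e)) * Cd * Ce / S ^ ?J + Cz * p ^ e * (Cd / S ^ ?J + 1) * \<eta>)"
              using a(2) a0 by (intro real_le_rsqrt) (simp add: power2_abs)
            then show "\<bar>chi x\<bar> \<le> \<eta> + 0 + sqrt (Cz * (p ^ e * (1 / r ^ e)) * Cd * Ce / S ^ ?J + Cz * p ^ e * (Cd / S ^ ?J + 1) * \<eta>)"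
              using Ux by linarith
          qed
          also have "\<dots> \<le> sqrt (CB\<^sup>2 / (T ^ J)\<^sup>2)"
          proof -
            have "Cz * (p ^ e * (1 / r ^ e)) * Cd * Ce / S ^ ?J = (Cz * Cd * Ce) * (p ^ e * (1 / r ^ e)) * (1 / S ^ ?J)"
              by simp
            also have "\<dots> \<le> (Cz * Cd * Ce) * T ^ (2 * m) * ((s / c) ^ ?J / T ^ ?J)"
              using Cz Cd Ce pe fromS S T by (intro mult_mono mult_left_mono) auto
            also have "\<dots> = CB\<^sup>2 / (T ^ J)\<^sup>2"
            proof -
              have "CB\<^sup>2 = Cz * Cd * Ce * (s / c) ^ ?J"
                unfolding CB_def using Cz Cd Ce s c by (subst real_sqrt_pow2) auto
              moreover have "T ^ ?J = (T ^ J)\<^sup>2 * T ^ (2 * m)" by (simp add: power_add power_even_eq)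
              ultimately show ?thesis using T by (simp add: field_simps)
            qed
            finally show ?thesis by simp
          qed
          also have "\<dots> = CB / T ^ J" using CB T by (simp add: real_sqrt_divide)
          also have "\<dots> \<le> (CA + CB) / T ^ J" using CA T by (intro divide_right_mono) auto
          finally show ?thesis .
        qed
        then show "\<bar>chi x\<bar> \<le> (CA + CB) / (1 + norm (x - \<xi>) / \<rho> \<xi>) ^ J" by (simp add: T_def D_def r_def)
      qed
    qed
  qed
qed

section \<open>Summation over separated centers\<close>

text \<open>Scaled and rounded down, the coordinates of separated points are different vectors of integers.\<close>

lemma card_separated_le:
  fixes x :: "real ^ 'n::finite"
  assumes S: "finite S" "\<And>\<xi>. \<xi> \<in> S \<Longrightarrow> infnorm (\<xi> - x) \<le> L" and L: "L \<ge> 0" and h: "h > 0"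
    and sep: "\<And>\<xi> \<zeta>. \<xi> \<in> S \<Longrightarrow> \<zeta> \<in> S \<Longrightarrow> \<xi> \<noteq> \<zeta> \<Longrightarrow> h \<le> infnorm (\<xi> - \<zeta>)"
  shows "real (card S) \<le> (2 * L / h + 2) ^ CARD('n)"
proof -
  define I where "I = {\<lfloor>- (L / h)\<rfloor>..\<lfloor>L / h\<rfloor>}"
  define \<phi> where "\<phi> \<xi> = (\<lambda>i. \<lfloor>(\<xi> - x) $ i / h\<rfloor>)" for \<xi>
  have "\<phi> ` S \<subseteq> Pi\<^sub>E UNIV (\<lambda>_. I)"
  proof safe
    fix \<xi> i assume "\<xi> \<in> S"
    then have "\<bar>(\<xi> - x) $ i\<bar> \<le> L" using S(2) infnorm_le_iff by blast
    then have "- (L / h) \<le> (\<xi> - x) $ i / h" "(\<xi> - x) $ i / h \<le> L / h"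
      using h divide_right_mono[of "- L" "(\<xi> - x) $ i" h] divide_right_mono[of "(\<xi> - x) $ i" L h] by auto
    then show "\<phi> \<xi> i \<in> I" unfolding \<phi>_def I_def by (auto intro: floor_mono)
  qed auto
  moreover have "inj_on \<phi> S"
  proof (rule inj_onI, rule ccontr)
    fix \<xi> \<zeta> assume *: "\<xi> \<in> S" "\<zeta> \<in> S" "\<phi> \<xi> = \<phi> \<zeta>" "\<xi> \<noteq> \<zeta>"
    obtain i where i: "infnorm (\<xi> - \<zeta>) = \<bar>(\<xi> - \<zeta>) $ i\<bar>" using infnorm_attained by blast
    have "\<lfloor>(\<xi> - x) $ i / h\<rfloor> = \<lfloor>(\<zeta> - x) $ i / h\<rfloor>" using *(3) by (auto simp: \<phi>_def dest: fun_cong)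
    then have "\<bar>(\<xi> - x) $ i / h - (\<zeta> - x) $ i / h\<bar> < 1" by linarith
    then have "\<bar>((\<xi> - \<zeta>) $ i) / h\<bar> < 1" by (simp add: diff_divide_distrib[symmetric])
    then have "\<bar>(\<xi> - \<zeta>) $ i\<bar> < h" using h by simp
    then show False using sep[OF *(1,2,4)] i by simp
  qed
  ultimately have "card S \<le> card (Pi\<^sub>E (UNIV :: 'n set) (\<lambda>_. I))"
    by (intro card_inj_on_le[of \<phi>]) (auto simp: I_def intro!: finite_PiE)
  also have "\<dots> = card I ^ CARD('n)" by (simp add: card_PiE)
  finally have "real (card S) \<le> real (card I) ^ CARD('n)" by (metis of_nat_le_iff of_nat_power)
  also have "real (card I) \<le> 2 * L / h + 2"
  proof -
    have "\<lfloor>- (L / h)\<rfloor> \<le> \<lfloor>L / h\<rfloor>" using L h by (intro floor_mono) (simp add: order.trans[of _ 0])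
    then have "real (card I) = real_of_int (\<lfloor>L / h\<rfloor> - \<lfloor>- (L / h)\<rfloor> + 1)" by (simp add: I_def)
    also have "\<dots> \<le> L / h - (- (L / h) - 1) + 1" by linarith
    finally show ?thesis by simp
  qed
  then have "real (card I) ^ CARD('n) \<le> (2 * L / h + 2) ^ CARD('n)" by (intro power_mono) auto
  finally show ?thesis .
qed

text \<open>The points are sorted into dyadic shells about \<open>x\<close>.  In the shell of size \<open>2 ^ k\<close> the separation is at
  least a multiple of \<open>2 ^ - (k * b)\<close>, so it holds at most a multiple of \<open>2 ^ (k * (1 + b) * CARD('n))\<close> points;
  the exponent exceeds this growth by one.\<close>

lemma separated_sum_le:
  fixes x :: "real ^ 'n::finite" and b :: nat
  assumes S: "finite S" and p: "p > 0" and c0: "c0 > 0"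
    and sep: "\<And>\<xi> \<zeta>. \<xi> \<in> S \<Longrightarrow> \<zeta> \<in> S \<Longrightarrow> \<xi> \<noteq> \<zeta> \<Longrightarrow> p \<le> c0 * (1 + norm (x - \<xi>) / p) ^ b * norm (\<xi> - \<zeta>)"
  shows "(\<Sum>\<xi>\<in>S. (1 / (1 + norm (x - \<xi>) / p)) ^ (CARD('n) * (1 + b) + 1))
    \<le> 2 * ((2 * c0 * sqrt CARD('n) + 2) * 2 ^ (1 + b)) ^ CARD('n)"
proof -
  let ?d = "CARD('n)"
  define a where "a = ?d * (1 + b) + 1"
  define s where "s = sqrt (real ?d)"
  have s: "s \<ge> 1" by (simp add: s_def Suc_leI)
  define t where "t \<xi> = 1 + norm (x - \<xi>) / p" for \<xi>
  have t1: "t \<xi> \<ge> 1" for \<xi> using p by (simp add: t_def)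
  have "\<exists>j. 2 ^ j \<le> t \<xi> \<and> t \<xi> < 2 ^ Suc j" for \<xi>
    using dyadic_scale[OF t1[of \<xi>]] by blast
  then obtain j where j: "\<And>\<xi>. 2 ^ j \<xi> \<le> t \<xi>" "\<And>\<xi>. t \<xi> < 2 ^ Suc (j \<xi>)" by metis
  define C where "C = ((2 * c0 * s + 2) * 2 ^ (1 + b)) ^ ?d"
  have C: "C \<ge> 0" using c0 s by (simp add: C_def)
  have shell: "(\<Sum>\<xi>\<in>{\<xi>\<in>S. j \<xi> = k}. (1 / t \<xi>) ^ a) \<le> C * (1 / 2) ^ k" for k
  proof -
    let ?S = "{\<xi>\<in>S. j \<xi> = k}"
    \<comment> \<open>The separation in the shell, in the maximum norm.\<close>
    define h where "h = p / (c0 * s * 2 ^ (Suc k * b))"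
    have h: "h > 0" using p c0 s by (simp add: h_def)
    have "real (card ?S) \<le> (2 * (p * 2 ^ Suc k) / h + 2) ^ ?d"
    proof (rule card_separated_le[where x = x])
      fix \<xi> assume "\<xi> \<in> ?S"
      then have "t \<xi> < 2 ^ Suc k" using j(2)[of \<xi>] by auto
      then have "norm (x - \<xi>) / p < 2 ^ Suc k" by (simp add: t_def)
      then have "norm (x - \<xi>) \<le> p * 2 ^ Suc k" using p by (simp add: divide_less_eq mult.commute)
      then show "infnorm (\<xi> - x) \<le> p * 2 ^ Suc k"
        using infnorm_le_norm[of "\<xi> - x"] by (simp add: norm_minus_commute)
    next
      fix \<xi> \<zeta> assume *: "\<xi> \<in> ?S" "\<zeta> \<in> ?S" "\<xi> \<noteq> \<zeta>"
      have "p \<le> c0 * t \<xi> ^ b * norm (\<xi> - \<zeta>)" using sep * by (auto simp: t_def)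
      also have "\<dots> \<le> c0 * (2 ^ Suc k) ^ b * (s * infnorm (\<xi> - \<zeta>))"
        using * j(2)[of \<xi>] t1[of \<xi>] c0 norm_le_infnorm[of "\<xi> - \<zeta>"]
        by (intro mult_mono mult_left_mono power_mono) (auto simp: s_def)
      finally show "h \<le> infnorm (\<xi> - \<zeta>)"
        using c0 s by (simp add: h_def divide_le_eq power_mult[symmetric] power_add mult_ac)
    qed (use S p h in auto)
    also have "2 * (p * 2 ^ Suc k) / h = (2 * c0 * s) * 2 ^ (Suc k * (1 + b))"
      using p by (simp add: h_def power_add power_mult algebra_simps)
    also have "(2 * c0 * s) * 2 ^ (Suc k * (1 + b)) + 2 \<le> (2 * c0 * s + 2) * 2 ^ (Suc k * (1 + b))"
    proof -
      have "(1 :: real) \<le> 2 ^ (Suc k * (1 + b))" by (rule one_le_power) simp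
      then show ?thesis unfolding distrib_right by linarith
    qed
    then have "((2 * c0 * s) * 2 ^ (Suc k * (1 + b)) + 2) ^ ?d \<le> ((2 * c0 * s + 2) * 2 ^ (Suc k * (1 + b))) ^ ?d"
      using c0 s by (intro power_mono) auto
    also have "((2 * c0 * s + 2) * 2 ^ (Suc k * (1 + b))) ^ ?d = C * 2 ^ (k * (1 + b) * ?d)"
    proof -
      have "(2 :: real) ^ (Suc k * (1 + b)) = 2 ^ (1 + b) * 2 ^ (k * (1 + b))"
        unfolding mult_Suc by (rule power_add)
      moreover have "(2 :: real) ^ (k * (1 + b) * ?d) = (2 ^ (k * (1 + b))) ^ ?d" by (rule power_mult)
      moreover have "(u * (v * y)) ^ ?d = (u * v) ^ ?d * y ^ ?d" for u v y :: real
        by (simp only: mult.assoc[symmetric] power_mult_distrib)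
      ultimately show ?thesis unfolding C_def by (simp only:)
    qed
    finally have card: "real (card ?S) \<le> C * 2 ^ (k * (1 + b) * ?d)" .
    have "(\<Sum>\<xi>\<in>?S. (1 / t \<xi>) ^ a) \<le> of_nat (card ?S) * (1 / 2 ^ k) ^ a"
    proof (rule sum_bounded_above)
      fix \<xi> assume "\<xi> \<in> ?S"
      then have "2 ^ k \<le> t \<xi>" using j(1)[of \<xi>] by auto
      then show "(1 / t \<xi>) ^ a \<le> (1 / 2 ^ k) ^ a"
        using t1[of \<xi>] by (intro power_mono divide_left_mono) auto
    qed
    also have "\<dots> \<le> C * 2 ^ (k * (1 + b) * ?d) * (1 / 2 ^ k) ^ a"
      using card by (intro mult_right_mono) auto
    also have "\<dots> = C * (1 / 2) ^ k"
    proof -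
      have "(2 ^ k) ^ a = (2 :: real) ^ (k * (1 + b) * ?d) * 2 ^ k"
        unfolding power_mult[symmetric] power_add[symmetric] by (simp add: a_def algebra_simps)
      then show ?thesis by (simp add: power_one_over)
    qed
    finally show ?thesis .
  qed
  have "(\<Sum>\<xi>\<in>S. (1 / t \<xi>) ^ a) = (\<Sum>k\<in>j ` S. \<Sum>\<xi>\<in>{\<xi>\<in>S. j \<xi> = k}. (1 / t \<xi>) ^ a)"
    by (rule sum.image_gen[OF S])
  also have "\<dots> \<le> (\<Sum>k\<in>j ` S. C * (1 / 2) ^ k)" by (rule sum_mono[OF shell])
  also have "\<dots> = C * (\<Sum>k\<in>j ` S. (1 / 2) ^ k)" by (simp add: sum_distrib_left)
  also have "\<dots> \<le> C * 2"
  proof (rule mult_left_mono[OF _ C])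
    have "(\<Sum>k\<in>j ` S. (1 / 2) ^ k) \<le> (\<Sum>k. (1 / 2 :: real) ^ k)"
      using S by (intro sum_le_suminf summable_geometric) auto
    also have "(\<Sum>k. (1 / 2 :: real) ^ k) = 2" by (simp add: suminf_geometric)
    finally show "(\<Sum>k\<in>j ` S. (1 / 2 :: real) ^ k) \<le> 2" .
  qed
  finally have "(\<Sum>\<xi>\<in>S. (1 / t \<xi>) ^ a) \<le> 2 * C" by simp
  then show ?thesis unfolding a_def t_def C_def s_def .
qed

text \<open>Distances measured in units of \<open>\<rho> x\<close> and of \<open>\<rho> \<xi>\<close> are polynomially comparable, and so are \<open>\<rho> x\<close> and \<open>\<rho> \<xi>\<close>
  themselves.  The first fact turns decay at the scale of the center into decay at the scale of the
  evaluation point, the second one bounds the number of centers.\<close>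

lemma slow_growth_compare:
  assumes sg: "slow_growth \<Omega> \<epsilon> \<rho>" and \<epsilon>: "0 < \<epsilon>" "\<epsilon> < 1" and x: "x \<in> \<Omega>" "\<rho> x > 0" and \<xi>: "\<xi> \<in> \<Omega>" "\<rho> \<xi> > 0"
    and b: "real b \<ge> 1 / \<epsilon>"
  shows "(1 + norm (x - \<xi>) / \<rho> x) powr \<epsilon> \<le> 1 + norm (x - \<xi>) / \<rho> \<xi>"
    and "\<rho> x \<le> \<rho> \<xi> * (1 + norm (x - \<xi>) / \<rho> x) ^ b"
proof -
  define p r D where "p = \<rho> x" and "r = \<rho> \<xi>" and "D = norm (x - \<xi>)"
  have p: "p > 0" and r: "r > 0" and D: "D \<ge> 0" using x \<xi> by (auto simp: p_def r_def D_def)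
  define t T where "t = 1 + D / p" and "T = 1 + D / r"
  have t: "t \<ge> 1" and T: "T \<ge> 1" using p r D by (auto simp: t_def T_def)
  have 1: "r \<le> p * t powr (1 - \<epsilon>)" using sg x \<xi> by (simp add: slow_growth_def p_def r_def D_def t_def)
  have 2: "p \<le> r * T powr (1 - \<epsilon>)" using sg x \<xi> unfolding slow_growth_def p_def r_def D_def T_def by (metis norm_minus_commute)
  have "t powr \<epsilon> \<le> T"
  proof -
    have te: "t powr \<epsilon> = t * t powr (\<epsilon> - 1)" using t powr_add[of t 1 "\<epsilon> - 1"] by simp
    have "t powr (\<epsilon> - 1) \<le> 1" using powr_mono[of "\<epsilon> - 1" 0 t] t \<epsilon> by simp
    then have "t powr \<epsilon> \<le> (t - 1) * t powr (\<epsilon> - 1) + 1" unfolding te by (simp add: left_diff_distrib)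
    also have "(t - 1) * t powr (\<epsilon> - 1) = D / (p * t powr (1 - \<epsilon>))"
      using t powr_minus_divide[of t "1 - \<epsilon>"] by (simp add: t_def)
    also have "\<dots> \<le> D / r" using 1 r D p t by (intro divide_left_mono) auto
    finally show ?thesis by (simp add: T_def)
  qed
  then show "(1 + norm (x - \<xi>) / \<rho> x) powr \<epsilon> \<le> 1 + norm (x - \<xi>) / \<rho> \<xi>"
    by (simp add: t_def T_def p_def r_def D_def)
  have "p \<le> r * t ^ b"
  proof (cases "p \<le> r")
    case True
    have "1 \<le> t ^ b" using t by simp
    then have "r * 1 \<le> r * t ^ b" using r by (intro mult_left_mono) auto
    then show ?thesis using True by simp
  next
    case False
    have rT: "r * T \<le> p * t" using False p r by (simp add: T_def t_def distrib_left)
    have "p powr \<epsilon> * p powr (1 - \<epsilon>) = p" using p by (simp add: powr_add[symmetric])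
    also have "p \<le> r powr \<epsilon> * (r * T) powr (1 - \<epsilon>)"
    proof -
      have "r powr \<epsilon> * r powr (1 - \<epsilon>) = r" using r by (simp add: powr_add[symmetric])
      then have "r powr \<epsilon> * (r * T) powr (1 - \<epsilon>) = r * T powr (1 - \<epsilon>)"
        by (simp only: powr_mult mult.assoc[symmetric])
      then show ?thesis using 2 by simp
    qed
    also have "\<dots> \<le> r powr \<epsilon> * (p * t) powr (1 - \<epsilon>)"
      using rT r T \<epsilon> by (intro mult_left_mono powr_mono2) auto
    also have "\<dots> = r powr \<epsilon> * t powr (1 - \<epsilon>) * p powr (1 - \<epsilon>)" by (simp add: powr_mult mult_ac)
    finally have "p powr \<epsilon> \<le> r powr \<epsilon> * t powr (1 - \<epsilon>)" using p by (simp add: mult_le_cancel_right)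
    then have "(p powr \<epsilon>) powr (1 / \<epsilon>) \<le> (r powr \<epsilon> * t powr (1 - \<epsilon>)) powr (1 / \<epsilon>)"
      using \<epsilon> by (intro powr_mono2) auto
    then have "p \<le> r * t powr ((1 - \<epsilon>) / \<epsilon>)" using p r \<epsilon> by (simp add: powr_powr powr_mult)
    also have "\<dots> \<le> r * t powr (real b)"
    proof (intro mult_left_mono powr_mono)
      have "(1 - \<epsilon>) / \<epsilon> \<le> 1 / \<epsilon>" using \<epsilon> by (intro divide_right_mono) auto
      then show "(1 - \<epsilon>) / \<epsilon> \<le> real b" using b by simp
    qed (use r t in auto)
    also have "t powr (real b) = t ^ b" using t by (simp add: powr_realpow)
    finally show ?thesis .
  qed
  then show "\<rho> x \<le> \<rho> \<xi> * (1 + norm (x - \<xi>) / \<rho> x) ^ b"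
    by (simp add: t_def p_def r_def D_def)
qed

section \<open>The penalized Lebesgue constant\<close>

text \<open>A single center cannot reproduce linear polynomials on an open set.  So the minimum in the definition of
  the separation distance is taken over a nonempty set.\<close>

lemma local_density_two_centers:
  fixes \<Omega> :: "(real ^ 'n::finite) set"
  assumes \<Omega>: "open \<Omega>" and ld: "local_density \<Omega> \<Xi> l K \<rho>" and l: "l \<ge> 1" and \<xi>: "\<xi> \<in> \<Xi>" "\<xi> \<in> \<Omega>"
  shows "\<Xi> - {\<xi>} \<noteq> {}"
proof
  assume "\<Xi> - {\<xi>} = {}"
  then have \<Xi>: "\<Xi> = {\<xi>}" using \<xi> by blast
  obtain a where a: "\<forall>p\<in>poly_space l. \<forall>\<alpha>\<in>\<Omega>. (\<Sum>\<xi>\<in>\<Xi>. a \<xi> \<alpha> * p \<xi>) = p \<alpha>"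
    using ld unfolding local_density_def by blast
  fix i :: 'n
  have 1: "(\<lambda>x. 1) \<in> poly_space l" by (rule poly_space_const)
  have 2: "(\<lambda>x. x $ i) \<in> poly_space l"
    using poly_space_mult_coord[OF poly_space_const[of 1 0], of i] poly_space_mono[of "Suc 0" l] l by auto
  have eq: "\<alpha> $ i = \<xi> $ i" if "\<alpha> \<in> \<Omega>" for \<alpha>
    using bspec[OF bspec[OF a 1] that] bspec[OF bspec[OF a 2] that] by (simp add: \<Xi>)
  obtain e where e: "e > 0" "ball \<xi> e \<subseteq> \<Omega>" using \<Omega> \<xi> open_contains_ball by blast
  have "\<xi> + (e / 2) *\<^sub>R axis i 1 \<in> \<Omega>"
    using e by (intro subsetD[OF e(2)]) (simp add: dist_norm)
  from eq[OF this] show False using e by (simp add: axis_def)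
qed

lemma quasi_uniformity_separation:
  assumes fin: "finite \<Xi>" and two: "\<Xi> - {\<xi>} \<noteq> {}" and \<xi>: "\<xi> \<in> \<Xi>" and \<rho>: "\<rho> \<xi> > 0"
  shows "quasi_uniformity_ratio \<Xi> \<rho> > 0"
    and "\<zeta> \<in> \<Xi> \<Longrightarrow> \<zeta> \<noteq> \<xi> \<Longrightarrow> \<rho> \<xi> \<le> quasi_uniformity_ratio \<Xi> \<rho> * norm (\<xi> - \<zeta>)"
proof -
  let ?q = "center_sep \<Xi> \<xi>" and ?c = "quasi_uniformity_ratio \<Xi> \<rho>"
  have "?q \<in> (\<lambda>\<zeta>. norm (\<xi> - \<zeta>)) ` (\<Xi> - {\<xi>})"
    unfolding center_sep_def using fin two by (intro Min_in) auto
  then have q: "?q > 0" by auto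
  have c: "\<rho> \<xi> / ?q \<le> ?c"
    unfolding quasi_uniformity_ratio_def using fin \<xi> by (intro Max_ge) auto
  then show c0: "?c > 0" using q \<rho> by (meson divide_pos_pos less_le_trans)
  assume "\<zeta> \<in> \<Xi>" "\<zeta> \<noteq> \<xi>"
  then have "?q \<le> norm (\<xi> - \<zeta>)" unfolding center_sep_def using fin by (intro Min_le) auto
  then have "?c * ?q \<le> ?c * norm (\<xi> - \<zeta>)" using c0 by (intro mult_left_mono) auto
  then show "\<rho> \<xi> \<le> ?c * norm (\<xi> - \<zeta>)" using c q by (simp add: divide_le_eq)
qed

text \<open>A ball about a point of \<open>\<Omega>\<close> that leaves \<open>\<Omega>\<close> meets the frontier, because it is connected.\<close>

lemma ball_subset_if_frontier_distance:
  fixes \<Omega> S :: "(real ^ 'n::finite) set"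
  assumes "\<xi> \<in> S" "\<xi> \<in> \<Omega>" and d: "setdist S (frontier \<Omega>) = d0"
  shows "ball \<xi> d0 \<subseteq> \<Omega>"
proof (rule ccontr)
  assume "\<not> ball \<xi> d0 \<subseteq> \<Omega>"
  then have ne: "ball \<xi> d0 - \<Omega> \<noteq> {}" by blast
  then have "d0 > 0" by (metis Diff_empty ball_eq_empty empty_Diff not_less)
  then have "\<xi> \<in> ball \<xi> d0 \<inter> \<Omega>" using assms(2) by simp
  then have "ball \<xi> d0 \<inter> \<Omega> \<noteq> {}" by blast
  then have "ball \<xi> d0 \<inter> frontier \<Omega> \<noteq> {}" using ne by (intro connected_Int_frontier) auto
  then obtain z where z: "dist \<xi> z < d0" "z \<in> frontier \<Omega>" by auto
  then show False using setdist_le_dist[OF assms(1) z(2)] d by simp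
qed

theorem theorem5p1:
  fixes \<Omega> :: "(real ^ 'n::finite) set"
    and m :: nat
    and \<sigma> \<epsilon> c0 K r0 :: real
  assumes "real m > real CARD('n) / 2"
    and "open \<Omega>" and "bounded \<Omega>"
    and "\<sigma> \<ge> 0"
    and "0 < \<epsilon>" and "\<epsilon> < 1"
    and "r0 > 0"
  shows "\<exists>C::real. \<forall>(f :: real ^ 'n \<Rightarrow> real) (\<Xi> :: (real ^ 'n) set) (l :: nat)
            (\<rho> :: real ^ 'n \<Rightarrow> real) (chi :: real ^ 'n \<Rightarrow> real ^ 'n \<Rightarrow> real).
           f \<in> Cc \<Omega> \<and>
           setdist (supp_on \<Omega> f) (frontier \<Omega>) = r0 \<and>
           finite \<Xi> \<and> \<Xi> \<subseteq> \<Omega> \<and> \<Xi> \<inter> supp_on \<Omega> f \<noteq> {} \<and>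
           l \<ge> m \<and> local_density \<Omega> \<Xi> l K \<rho> \<and>
           slow_growth \<Omega> \<epsilon> \<rho> \<and>
           weakly_quasi_uniform \<Xi> \<rho> \<and> quasi_uniformity_ratio \<Xi> \<rho> = c0 \<and>
           (\<forall>\<xi>\<in>\<Xi>. is_lagrange_function m \<Xi> \<xi> (chi \<xi>))
           \<longrightarrow> penalized_lebesgue \<Omega> (\<Xi> \<inter> supp_on \<Omega> f) chi \<sigma> \<rho> \<le> ereal C"
proof -
  have m1: "m \<ge> 1" using assms(1) by (cases m) auto
  \<comment> \<open>The bound is chosen before the centers, whose existence implies that \<open>c0\<close> is positive.\<close>
  define c1 where "c1 = (if c0 > 0 then c0 else 1)"
  have c1: "c1 > 0" by (simp add: c1_def)
  obtain B where B: "\<And>x. x \<in> \<Omega> \<Longrightarrow> norm x \<le> B" using \<open>bounded \<Omega>\<close> bounded_iff by blast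
  define D0 where "D0 = 2 * \<bar>B\<bar> + 1"
  have D0: "D0 > 0" by (simp add: D0_def)
  obtain b :: nat where b: "real b \<ge> 1 / \<epsilon>" using real_arch_simple by blast
  define a where "a = CARD('n) * (1 + b) + 1"
  \<comment> \<open>The order of decay pays for the penalty \<open>\<sigma>\<close> and for the number of centers; \<open>\<epsilon>\<close> is lost in passing from the scale of the center to that of \<open>x\<close>.\<close>
  obtain J :: nat where "real J \<ge> (\<sigma> + real a) / \<epsilon>" using real_arch_simple by blast
  then have J: "\<epsilon> * real J \<ge> \<sigma> + real a" using \<open>0 < \<epsilon>\<close> by (simp add: divide_le_eq mult.commute)
  show ?thesis
  proof (rule lagrange_pointwise_decay[OF assms(1) \<open>0 < \<epsilon>\<close> \<open>\<epsilon> < 1\<close> c1 \<open>r0 > 0\<close> D0, where K = K and J = J], goal_cases)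
    case (1 C)
    note C = 1(1) and decay = 1(2)
    define M where "M = 2 * ((2 * c1 * sqrt CARD('n) + 2) * 2 ^ (1 + b)) ^ CARD('n)"
    show ?case
    proof (intro exI[of _ "C * M"] allI impI, elim conjE)
      fix f \<Xi> l \<rho> chi
      assume f: "f \<in> Cc \<Omega>" and dist: "setdist (supp_on \<Omega> f) (frontier \<Omega>) = r0"
        and fin: "finite \<Xi>" and sub: "\<Xi> \<subseteq> \<Omega>" and ne: "\<Xi> \<inter> supp_on \<Omega> f \<noteq> {}"
        and l: "l \<ge> m" and ld: "local_density \<Omega> \<Xi> l K \<rho>" and sg: "slow_growth \<Omega> \<epsilon> \<rho>"
        and ratio: "quasi_uniformity_ratio \<Xi> \<rho> = c0"
        and chi: "\<forall>\<xi>\<in>\<Xi>. is_lagrange_function m \<Xi> \<xi> (chi \<xi>)"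
      have \<rho>: "\<rho> x > 0" if "x \<in> \<Omega>" for x using ld that by (simp add: local_density_def)
      have two: "\<Xi> - {\<xi>} \<noteq> {}" if "\<xi> \<in> \<Xi>" for \<xi>
        using that sub l m1 by (intro local_density_two_centers[OF \<open>open \<Omega>\<close> ld]) auto
      obtain \<xi>0 where "\<xi>0 \<in> \<Xi>" using ne by blast
      then have "c0 > 0" using quasi_uniformity_separation(1)[OF fin two, of \<xi>0 \<rho>] \<rho> sub ratio by blast
      then have c01: "c1 = c0" by (simp add: c1_def)
      have sep: "\<rho> \<xi> \<le> c1 * norm (\<xi> - \<zeta>)" if "\<xi> \<in> \<Xi>" "\<zeta> \<in> \<Xi>" "\<zeta> \<noteq> \<xi>" for \<xi> \<zeta>
        using quasi_uniformity_separation(2)[OF fin two[OF that(1)] that(1) _ that(2,3), of \<rho>] \<rho> sub that ratio c01 by auto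
      show "penalized_lebesgue \<Omega> (\<Xi> \<inter> supp_on \<Omega> f) chi \<sigma> \<rho> \<le> ereal (C * M)"
        unfolding penalized_lebesgue_def
      proof (rule SUP_least)
        fix x assume x: "x \<in> \<Omega>"
        define t where "t \<xi> = 1 + norm (x - \<xi>) / \<rho> x" for \<xi>
        have t1: "t \<xi> \<ge> 1" for \<xi> using \<rho>[OF x] by (simp add: t_def)
        have each: "\<bar>chi \<xi> x\<bar> * t \<xi> powr \<sigma> \<le> C * (1 / t \<xi>) ^ a" if \<xi>: "\<xi> \<in> \<Xi> \<inter> supp_on \<Omega> f" for \<xi>
        proof -
          have \<xi>': "\<xi> \<in> \<Xi>" "\<xi> \<in> \<Omega>" using \<xi> sub by auto
          define T where "T = 1 + norm (x - \<xi>) / \<rho> \<xi>"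
          have "ball \<xi> r0 \<subseteq> \<Omega>" using \<xi> \<xi>' by (intro ball_subset_if_frontier_distance[OF _ _ dist]) auto
          moreover have "norm (x - \<xi>) \<le> D0"
            using norm_triangle_ineq4[of x \<xi>] B[OF x] B[OF \<xi>'(2)] by (simp add: D0_def)
          ultimately have cT: "\<bar>chi \<xi> x\<bar> \<le> C / T ^ J"
            unfolding T_def using chi \<xi>' sep
            by (intro decay[OF \<open>bounded \<Omega>\<close> fin sub l ld sg _ _ x]) auto
          have tT: "t \<xi> powr \<epsilon> \<le> T"
            unfolding t_def T_def
            by (rule slow_growth_compare(1)[OF sg \<open>0 < \<epsilon>\<close> \<open>\<epsilon> < 1\<close> x \<rho>[OF x] \<xi>'(2) \<rho>[OF \<xi>'(2)] b])
          have tp: "t \<xi> powr \<epsilon> > 0" using t1[of \<xi>] by simp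
          have "(t \<xi> powr \<epsilon>) ^ J \<le> T ^ J" using tT tp by (intro power_mono) auto
          then have "C / T ^ J \<le> C / (t \<xi> powr \<epsilon>) ^ J"
          proof (intro divide_left_mono mult_pos_pos zero_less_power)
            show "T > 0" using tT tp by linarith
          qed (use C tp in auto)
          then have "\<bar>chi \<xi> x\<bar> * t \<xi> powr \<sigma> \<le> C / (t \<xi> powr \<epsilon>) ^ J * t \<xi> powr \<sigma>"
            using cT by (intro mult_right_mono) auto
          also have "\<dots> = C * t \<xi> powr (\<sigma> - \<epsilon> * real J)"
            using t1[of \<xi>] by (simp add: powr_power powr_diff mult.commute)
          also have "\<dots> \<le> C * t \<xi> powr (- real a)"
            using t1[of \<xi>] J C by (intro mult_left_mono powr_mono) auto
          also have "t \<xi> powr (- real a) = (1 / t \<xi>) ^ a"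
            using t1[of \<xi>] by (simp add: powr_minus_divide powr_realpow power_one_over)
          finally show ?thesis .
        qed
        have "(\<Sum>\<xi>\<in>\<Xi> \<inter> supp_on \<Omega> f. \<bar>chi \<xi> x\<bar> * t \<xi> powr \<sigma>) \<le> (\<Sum>\<xi>\<in>\<Xi> \<inter> supp_on \<Omega> f. C * (1 / t \<xi>) ^ a)"
          by (rule sum_mono[OF each])
        also have "\<dots> = C * (\<Sum>\<xi>\<in>\<Xi> \<inter> supp_on \<Omega> f. (1 / t \<xi>) ^ a)" by (simp add: sum_distrib_left)
        also have "(\<Sum>\<xi>\<in>\<Xi> \<inter> supp_on \<Omega> f. (1 / t \<xi>) ^ a) \<le> M"
          unfolding a_def t_def M_def
        proof (rule separated_sum_le[OF _ \<rho>[OF x] c1])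
          show "finite (\<Xi> \<inter> supp_on \<Omega> f)" using fin by simp
          fix \<xi> \<zeta> assume *: "\<xi> \<in> \<Xi> \<inter> supp_on \<Omega> f" "\<zeta> \<in> \<Xi> \<inter> supp_on \<Omega> f" "\<xi> \<noteq> \<zeta>"
          have \<xi>: "\<xi> \<in> \<Omega>" using * sub by blast
          have "\<rho> x \<le> \<rho> \<xi> * t \<xi> ^ b"
            unfolding t_def
            by (rule slow_growth_compare(2)[OF sg \<open>0 < \<epsilon>\<close> \<open>\<epsilon> < 1\<close> x \<rho>[OF x] \<xi> \<rho>[OF \<xi>] b])
          also have "\<dots> \<le> (c1 * norm (\<xi> - \<zeta>)) * t \<xi> ^ b"
            using * sep[of \<xi> \<zeta>] t1[of \<xi>] by (intro mult_right_mono) auto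
          finally show "\<rho> x \<le> c1 * (1 + norm (x - \<xi>) / \<rho> x) ^ b * norm (\<xi> - \<zeta>)"
            by (simp add: t_def mult_ac)
        qed
        finally show "ereal (\<Sum>\<xi>\<in>\<Xi> \<inter> supp_on \<Omega> f. \<bar>chi \<xi> x\<bar> * (1 + norm (x - \<xi>) / \<rho> x) powr \<sigma>) \<le> ereal (C * M)"
          using C by (simp add: t_def mult_left_mono)
      qed
    qed
  qed
qed

end
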